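(* Let $N\ge2$, $s\in(1/2,1)$, let $V\colon(0,+\infty)\to[0,+\infty)$ and $K\colon(0,+\infty)\to(0,+\infty)$ be continuous, and let $f\colon\mathbb{R}\to\mathbb{R}$ be continuous satisfying (f1), (f2), (f3) with exponents $q_1,q_2>2$. Assume $\lim_{R\to0^+}\mathcal S_0(q_1,R)=\lim_{R\to+\infty}\mathcal S_\infty(q_2,R)=0$. Then the equation \[ (-\Delta)^su+V(|x|)u=K(|x|)f(u)\quad\text{in }\mathbb{R}^N \] admits a (weak) solution $u\in H^s_{V,\mathrm{rad}}(\mathbb{R}^N)$ with $u\ne0$ and $u\ge0$.
   Context: For $0<s<1$, $2^*_s=\frac{2N}{N-2s}$, $C(N,s)=\left(\int_{\mathbb{R}^N}\frac{1-\cos\zeta_1}{|\zeta|^{N+2s}}d\zeta\right)^{-1}$, $[u]_{H^s}=\left(\frac{C(N,s)}{2}\iint\frac{|u(x)-u(y)|^2}{|x-y|^{N+2s}}dx\,dy\right)^{1/2}$, $\dot H^s(\mathbb{R}^N)=\{u\in L^{2^*_s}:[u]_{H^s}<\infty\}$, $H^s_V(\mathbb{R}^N)=\{u\in\dot H^s:\int V(|x|)|u|^2<\infty\}$ with norm $\|u\|^2=[u]_{H^s}^2+\int V(|x|)|u|^2dx$, $H^s_{V,\mathrm{rad}}$ its radial subspace. $B_R$ is the open ball of radius $R$ at $0$; $\mathcal S_0(q,R)=\sup\{\int_{B_R}K(|x|)|u|^q:u\in H^s_{V,\mathrm{rad}},\|u\|=1\}$, $\mathcal S_\infty(q,R)=\sup\{\int_{B_R^c}K(|x|)|u|^q:u\in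 H^s_{V,\mathrm{rad}},\|u\|=1\}$. $F(t)=\int_0^tf$. (f1): there exist $C>0$, $q_1>2$, $q_2>2$ with $|f(t)|\le C\min\{|t|^{q_1-1},|t|^{q_2-1}\}$. (f2): there is $t_0>0$ with $F(t_0)>0$. (f3): there is $\mu>2$ with $0\le\mu F(t)\le f(t)t$ for all $t$. A weak solution is a critical point in $H^s_{V,\mathrm{rad}}(\mathbb{R}^N)$ of the $C^1$ functional $\mathcal E(u)=\frac12\|u\|^2-\int_{\mathbb{R}^N}K(|x|)F(u)dx$, i.e. $\frac{C(N,s)}{2}\iint\frac{(u(x)-u(y))(v(x)-v(y))}{|x-y|^{N+2s}}+\int V(|x|)uv-\int K(|x|)f(u)v=0$ for all $v\in H^s_{V,\mathrm{rad}}(\mathbb{R}^N)$. *)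

theory Defs
  imports "HOL-Analysis.Analysis"
begin

definition dimN :: "'n::finite itself \<Rightarrow> real" where
  "dimN _ = real CARD('n)"

definition crit_exp :: "'n::finite itself \<Rightarrow> real \<Rightarrow> real" where
  "crit_exp n s = 2 * dimN n / (dimN n - 2 * s)"

text \<open>The constant C(N,s); zeta_1 is the first coordinate (a fixed coordinate index).\<close>
definition CNs :: "'n::finite itself \<Rightarrow> real \<Rightarrow> real" where
  "CNs n s = inverse (integral\<^sup>L lborel
      (\<lambda>\<zeta>::real^'n. (1 - cos (\<zeta> $ (SOME i. True))) / norm \<zeta> powr (dimN n + 2 * s)))"

definition gagliardo_int :: "real \<Rightarrow> (real^'n::finite \<Rightarrow> real) \<Rightarrow> ennreal" where
  "gagliardo_int s u = (\<integral>\<^sup>+ p. ennreal ((u (fst p) - u (snd p))\<^sup>2 /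
       norm (fst p - snd p) powr (dimN TYPE('n) + 2 * s)) \<partial>(lborel \<Otimes>\<^sub>M lborel))"

definition hs_semi_sq :: "real \<Rightarrow> (real^'n::finite \<Rightarrow> real) \<Rightarrow> real" where
  "hs_semi_sq s u = CNs TYPE('n) s / 2 * enn2real (gagliardo_int s u)"

definition Hdot :: "real \<Rightarrow> (real^'n::finite \<Rightarrow> real) set" where
  "Hdot s = {u. u \<in> borel_measurable lborel
     \<and> (\<integral>\<^sup>+ x. ennreal (\<bar>u x\<bar> powr crit_exp TYPE('n) s) \<partial>lborel) < \<infinity>
     \<and> gagliardo_int s u < \<infinity>}"

definition HsV :: "real \<Rightarrow> (real \<Rightarrow> real) \<Rightarrow> (real^'n::finite \<Rightarrow> real) set" where
  "HsV s V = {u. u \<in> Hdot s \<and>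
     (\<integral>\<^sup>+ x. ennreal (V (norm x) * (u x)\<^sup>2) \<partial>lborel) < \<infinity>}"

definition radial :: "(real^'n::finite \<Rightarrow> real) \<Rightarrow> bool" where
  "radial u \<longleftrightarrow> (\<forall>x y. norm x = norm y \<longrightarrow> u x = u y)"

definition HsVrad :: "real \<Rightarrow> (real \<Rightarrow> real) \<Rightarrow> (real^'n::finite \<Rightarrow> real) set" where
  "HsVrad s V = {u. u \<in> HsV s V \<and> radial u}"

definition HsV_norm_sq :: "real \<Rightarrow> (real \<Rightarrow> real) \<Rightarrow> (real^'n::finite \<Rightarrow> real) \<Rightarrow> real" where
  "HsV_norm_sq s V u = hs_semi_sq s u + integral\<^sup>L lborel (\<lambda>x. V (norm x) * (u x)\<^sup>2)"

definition S0 :: "real \<Rightarrow> (real \<Rightarrow> real) \<Rightarrow> (real \<Rightarrow> real) \<Rightarrow> 'n::finite itself \<Rightarrow> real \<Rightarrow> real \<Rightarrow> ennreal" where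
  "S0 s V K n q R = (SUP u\<in>{u::real^'n \<Rightarrow> real. u \<in> HsVrad s V \<and> HsV_norm_sq s V u = 1}.
      \<integral>\<^sup>+ x\<in>ball 0 R. ennreal (K (norm x) * \<bar>u x\<bar> powr q) \<partial>lborel)"

definition Sinf :: "real \<Rightarrow> (real \<Rightarrow> real) \<Rightarrow> (real \<Rightarrow> real) \<Rightarrow> 'n::finite itself \<Rightarrow> real \<Rightarrow> real \<Rightarrow> ennreal" where
  "Sinf s V K n q R = (SUP u\<in>{u::real^'n \<Rightarrow> real. u \<in> HsVrad s V \<and> HsV_norm_sq s V u = 1}.
      \<integral>\<^sup>+ x\<in>- ball 0 R. ennreal (K (norm x) * \<bar>u x\<bar> powr q) \<partial>lborel)"

definition primF :: "(real \<Rightarrow> real) \<Rightarrow> real \<Rightarrow> real" where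
  "primF f t = (LBINT \<tau>=0..t. f \<tau>)"

definition weak_solution :: "real \<Rightarrow> (real \<Rightarrow> real) \<Rightarrow> (real \<Rightarrow> real) \<Rightarrow> (real \<Rightarrow> real)
    \<Rightarrow> (real^'n::finite \<Rightarrow> real) \<Rightarrow> bool" where
  "weak_solution s V K f u \<longleftrightarrow> u \<in> HsVrad s V \<and>
    (\<forall>v \<in> HsVrad s V.
      CNs TYPE('n) s / 2 * integral\<^sup>L (lborel \<Otimes>\<^sub>M lborel)
         (\<lambda>p. (u (fst p) - u (snd p)) * (v (fst p) - v (snd p)) /
               norm (fst p - snd p) powr (dimN TYPE('n) + 2 * s))
      + integral\<^sup>L lborel (\<lambda>x. V (norm x) * u x * v x)
      - integral\<^sup>L lborel (\<lambda>x. K (norm x) * f (u x) * v x) = 0)"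

end

theory Submission
  imports Defs "HOL-Library.Function_Algebras" "HOL-Library.Diagonal_Subsequence"
begin

text \<open>
  The functional \<open>E u = \<parallel>u\<parallel>\<^sup>2 / 2 - \<integral> K F(u)\<close>, with \<open>f\<close> set to zero on the negative axis, has the
  mountain pass geometry, and its nonlinear part has a compact, locally uniformly continuous
  derivative. Averaging the Gagliardo energy over a thin shell shows that a radial function has
  energy \<open>O(r\<^bsup>N-1\<^esup>)\<close> on balls of radius \<open>r\<close> away from the origin. As \<open>s > 1/2\<close>, this yields Hoelder type
  control of its averages, hence bounds away from the origin and almost everywhere convergent
  subsequences of bounded sequences. The hypotheses on \<open>S0\<close> and \<open>Sinf\<close> make the contributions near
  the origin and near infinity uniformly small, which upgrades almost everywhere convergence to
  convergence of the derivatives. The deformation argument only needs Euler steps along the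
  gradient, since the gradient is uniformly continuous on bounded sets. The critical point is
  nonnegative by testing with its negative part.
\<close>

section \<open>A mountain pass theorem in semi-Hilbert spaces\<close>

text \<open>Two features shape the development. Functions are not identified almost everywhere, so
  the energy form is only positive semidefinite: limits, gradients and Riesz representatives are
  never unique, and statements are phrased through the form. Moreover \<open>V\<close> may vanish,
  so a bound on the norm gives no pointwise control near the origin; the passage to the limit in the
  derivative of the nonlinear part happens only on annuli. The Hoelder exponent comes from counting
  powers of r: the kernel contributes r^(N+2s), the energy of a small ball r^(N-1), and two averages
  divide by r^(2N), which leaves r^(2s-1). This is where s > 1/2 enters. The minimum of two powers
  in the bound on \<open>f\<close> lets q1 be used near 0 and q2 near infinity, each with its own
  smallness hypothesis. Uniform continuity of the derivative of the nonlinear part is itself a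
  consequence of compactness: two bounded sequences that approach each other have a common almost
  everywhere limit along a subsequence.\<close>

instantiation "fun" :: (type, real_vector) real_vector
begin

definition "c *\<^sub>R f = (\<lambda>x. c *\<^sub>R f x)"

instance
  by standard (auto simp: scaleR_fun_def fun_eq_iff algebra_simps)

end

lemma scaleR_fun_apply [simp]: "(c *\<^sub>R f) x = c *\<^sub>R f x"
  by (simp add: scaleR_fun_def)

locale semi_inner_space =
  fixes S :: "'a::real_vector set" and ip :: "'a \<Rightarrow> 'a \<Rightarrow> real"
  assumes subspace: "subspace S"
    and ip_add: "x \<in> S \<Longrightarrow> y \<in> S \<Longrightarrow> z \<in> S \<Longrightarrow> ip (x + y) z = ip x z + ip y z"
    and ip_scale: "x \<in> S \<Longrightarrow> y \<in> S \<Longrightarrow> ip (c *\<^sub>R x) y = c * ip x y"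
    and ip_sym: "x \<in> S \<Longrightarrow> y \<in> S \<Longrightarrow> ip x y = ip y x"
    and ip_nonneg: "x \<in> S \<Longrightarrow> ip x x \<ge> 0"
begin

definition nrm :: "'a \<Rightarrow> real" where
  "nrm u = sqrt (ip u u)"

lemma S_add: "x \<in> S \<Longrightarrow> y \<in> S \<Longrightarrow> x + y \<in> S"
  and S_scale: "x \<in> S \<Longrightarrow> c *\<^sub>R x \<in> S"
  and S_diff: "x \<in> S \<Longrightarrow> y \<in> S \<Longrightarrow> x - y \<in> S"
  and S_zero: "0 \<in> S"
  using subspace subspace_diff by (auto simp: subspace_def)

lemma S_minus: "x \<in> S \<Longrightarrow> - x \<in> S"
  using S_scale[of x "-1"] by simp

lemmas S_mem = S_add S_scale S_diff S_minus S_zero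

lemma ip_add_right: "x \<in> S \<Longrightarrow> y \<in> S \<Longrightarrow> z \<in> S \<Longrightarrow> ip z (x + y) = ip z x + ip z y"
  by (metis S_add ip_add ip_sym)

lemma ip_scale_right: "x \<in> S \<Longrightarrow> y \<in> S \<Longrightarrow> ip y (c *\<^sub>R x) = c * ip y x"
  by (metis S_scale ip_scale ip_sym)

lemma ip_diff: "x \<in> S \<Longrightarrow> y \<in> S \<Longrightarrow> z \<in> S \<Longrightarrow> ip (x - y) z = ip x z - ip y z"
  using ip_add[of x "(-1) *\<^sub>R y" z] ip_scale[of y z "-1"] by (simp add: S_mem)

lemma ip_diff_right: "x \<in> S \<Longrightarrow> y \<in> S \<Longrightarrow> z \<in> S \<Longrightarrow> ip z (x - y) = ip z x - ip z y"
  by (metis S_diff ip_diff ip_sym)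

lemma nrm_nonneg: "x \<in> S \<Longrightarrow> nrm x \<ge> 0"
  by (simp add: nrm_def ip_nonneg)

lemma nrm_sq: "x \<in> S \<Longrightarrow> (nrm x)\<^sup>2 = ip x x"
  by (simp add: nrm_def ip_nonneg)

lemma nrm_scale: "x \<in> S \<Longrightarrow> nrm (c *\<^sub>R x) = \<bar>c\<bar> * nrm x"
  by (simp add: nrm_def ip_scale ip_scale_right S_mem real_sqrt_mult flip: mult.assoc)

lemma nrm_zero [simp]: "nrm 0 = 0"
  using nrm_scale[of 0 0] S_zero by simp

lemma nrm_minus_commute: "x \<in> S \<Longrightarrow> y \<in> S \<Longrightarrow> nrm (x - y) = nrm (y - x)"
  using nrm_scale[of "x - y" "-1"] by (simp add: S_mem)

lemma Cauchy_Schwarz: assumes "x \<in> S" "y \<in> S" shows "\<bar>ip x y\<bar> \<le> nrm x * nrm y"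
proof -
  have q: "0 \<le> ip x x + 2 * t * ip x y + t\<^sup>2 * ip y y" for t
  proof -
    have "0 \<le> ip (x + t *\<^sub>R y) (x + t *\<^sub>R y)"
      using assms by (intro ip_nonneg S_mem)
    also have "\<dots> = ip x x + 2 * t * ip x y + t\<^sup>2 * ip y y"
      using assms by (simp add: ip_add ip_add_right ip_scale ip_scale_right S_mem ip_sym[of y x]
          power2_eq_square algebra_simps)
    finally show ?thesis .
  qed
  have "(ip x y)\<^sup>2 \<le> ip x x * ip y y"
  proof (cases "ip y y = 0")
    case True
    have "ip x y = 0"
    proof (rule ccontr)
      assume "ip x y \<noteq> 0"
      \<comment> \<open>With \<open>ip y y = 0\<close> the quadratic is affine in t with nonzero
        slope; at this t it takes the value -1.\<close>
      then show False
        using q[of "- (ip x x + 1) / (2 * ip x y)"] True by (simp add: field_simps)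
    qed
    with True show ?thesis by simp
  next
    case False
    then have p: "ip y y > 0" using ip_nonneg[OF assms(2)] by simp
    have "0 \<le> ip x x - (ip x y)\<^sup>2 / ip y y"
      using q[of "- ip x y / ip y y"] p by (simp add: power2_eq_square field_simps)
    then show ?thesis using p by (simp add: field_simps)
  qed
  then have "sqrt ((ip x y)\<^sup>2) \<le> sqrt (ip x x * ip y y)"
    by (rule real_sqrt_le_mono)
  then show ?thesis by (simp add: nrm_def real_sqrt_mult)
qed

lemma nrm_triangle: assumes "x \<in> S" "y \<in> S" shows "nrm (x + y) \<le> nrm x + nrm y"
proof (rule power2_le_imp_le)
  have "(nrm (x + y))\<^sup>2 = (nrm x)\<^sup>2 + 2 * ip x y + (nrm y)\<^sup>2"
    using assms by (simp add: nrm_sq S_mem ip_add ip_add_right ip_sym[of y x])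
  also have "\<dots> \<le> (nrm x + nrm y)\<^sup>2"
    using Cauchy_Schwarz[OF assms] by (simp add: power2_sum)
  finally show "(nrm (x + y))\<^sup>2 \<le> (nrm x + nrm y)\<^sup>2" .
  show "0 \<le> nrm x + nrm y" using assms by (simp add: nrm_nonneg)
qed

lemma nrm_triangle_diff: "x \<in> S \<Longrightarrow> y \<in> S \<Longrightarrow> nrm (x - y) \<le> nrm x + nrm y"
  using nrm_triangle[of x "(-1) *\<^sub>R y"] nrm_scale[of y "-1"] by (simp add: S_mem)

lemma nrm_diff_ge: "x \<in> S \<Longrightarrow> y \<in> S \<Longrightarrow> \<bar>nrm x - nrm y\<bar> \<le> nrm (x - y)"
  using nrm_triangle[of "x - y" y] nrm_triangle[of "y - x" x] nrm_minus_commute[of x y]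
  by (simp add: S_mem)

lemma parallelogram:
  assumes "x \<in> S" "y \<in> S"
  shows "(nrm (x + y))\<^sup>2 + (nrm (x - y))\<^sup>2 = 2 * (nrm x)\<^sup>2 + 2 * (nrm y)\<^sup>2"
  using assms by (simp add: nrm_sq S_mem ip_add ip_add_right ip_diff ip_diff_right)

end

section \<open>Completeness and the Riesz representation\<close>

locale semi_hilbert = semi_inner_space +
  assumes complete: "(\<And>n. X n \<in> S) \<Longrightarrow>
     (\<And>e. e > 0 \<Longrightarrow> \<exists>M. \<forall>m\<ge>M. \<forall>n\<ge>M. nrm (X m - X n) < e) \<Longrightarrow>
     \<exists>x\<in>S. (\<lambda>n::nat. nrm (X n - x)) \<longlonglongrightarrow> 0"
begin

text \<open>The representing vector is the limit of a minimising sequence of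
  \<^term>\<open>\<lambda>v. (nrm v)\<^sup>2 / 2 - L v\<close>.\<close>

lemma Riesz:
  assumes add: "\<And>x y. x \<in> S \<Longrightarrow> y \<in> S \<Longrightarrow> L (x + y) = L x + L y"
    and scale: "\<And>x c. x \<in> S \<Longrightarrow> L (c *\<^sub>R x) = c * L x"
    and bound: "\<And>x. x \<in> S \<Longrightarrow> \<bar>L x\<bar> \<le> B * nrm x"
  shows "\<exists>x\<in>S. \<forall>v\<in>S. ip x v = L v"
proof -
  define J where "J v = (nrm v)\<^sup>2 / 2 - L v" for v
  have Ldiff: "L (x - y) = L x - L y" if "x \<in> S" "y \<in> S" for x y
    using add[of x "(-1) *\<^sub>R y"] scale[of y "-1"] that by (simp add: S_mem)
  have "J v \<ge> - (B\<^sup>2 / 2)" if "v \<in> S" for v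
  proof -
    have "0 \<le> (nrm v - B)\<^sup>2" by simp
    then show ?thesis using bound[OF that] by (simp add: J_def power2_diff field_simps abs_le_iff)
  qed
  then have bdd: "bdd_below (J ` S)" by (auto intro!: bdd_belowI)
  define m where "m = Inf (J ` S)"
  have m_le: "m \<le> J v" if "v \<in> S" for v
    unfolding m_def using bdd that by (intro cInf_lower) auto
  have "\<exists>v\<in>S. J v < m + 1 / real (Suc n)" for n
  proof -
    have "m < m + 1 / real (Suc n)" by simp
    then show ?thesis
      unfolding m_def using cInf_lessD[of "J ` S"] S_zero by blast
  qed
  then obtain X where X: "\<And>n. X n \<in> S" "\<And>n. J (X n) < m + 1 / real (Suc n)" by metis
  \<comment> \<open>The midpoint of two near-minimisers still has \<open>J\<close>-value at least
    \<open>m\<close>, and the parallelogram identity measures what it gains by the distance of the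
    two points.\<close>
  have dist: "(nrm (X k - X n))\<^sup>2 \<le> 4 * (1 / real (Suc k) + 1 / real (Suc n))" for k n
  proof -
    let ?h = "(1/2) *\<^sub>R (X k + X n)"
    have hS: "?h \<in> S" using X by (intro S_mem)
    have "J ?h = (nrm (X k + X n))\<^sup>2 / 8 - (L (X k) + L (X n)) / 2"
      using X by (simp add: J_def nrm_scale S_mem scale add power_mult_distrib power2_eq_square)
    moreover have "(nrm (X k + X n))\<^sup>2 = 2 * (nrm (X k))\<^sup>2 + 2 * (nrm (X n))\<^sup>2 - (nrm (X k - X n))\<^sup>2"
      using parallelogram[OF X(1) X(1), of k n] by simp
    ultimately have "J ?h = (J (X k) + J (X n)) / 2 - (nrm (X k - X n))\<^sup>2 / 8"
      by (simp add: J_def field_simps)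
    moreover define a b where "a = 1 / real (Suc k)" and "b = 1 / real (Suc n)"
    ultimately show ?thesis
      using m_le[OF hS] X(2)[of k] X(2)[of n] unfolding a_def[symmetric] b_def[symmetric] by argo
  qed
  have "\<exists>M. \<forall>k\<ge>M. \<forall>n\<ge>M. nrm (X k - X n) < e" if "e > 0" for e
  proof -
    have "0 < e\<^sup>2 / 8" using that by simp
    then obtain M where M: "1 / real (Suc M) < e\<^sup>2 / 8"
      using reals_Archimedean unfolding inverse_eq_divide by blast
    have "nrm (X k - X n) < e" if "k \<ge> M" "n \<ge> M" for k n
    proof (rule power2_less_imp_less)
      have "1 / real (Suc k) \<le> 1 / real (Suc M)" "1 / real (Suc n) \<le> 1 / real (Suc M)"
        using that by (auto intro!: divide_left_mono)
      then show "(nrm (X k - X n))\<^sup>2 < e\<^sup>2"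
        using dist[of k n] M by argo
    qed (use \<open>e > 0\<close> in simp)
    then show ?thesis by blast
  qed
  then obtain x where x: "x \<in> S" "(\<lambda>n. nrm (X n - x)) \<longlonglongrightarrow> 0"
    using complete[of X] X(1) by blast
  have "(\<lambda>n. nrm (X n) - nrm x) \<longlonglongrightarrow> 0"
    by (rule Lim_null_comparison[OF _ x(2)]) (use nrm_diff_ge X x in auto)
  then have n1: "(\<lambda>n. nrm (X n)) \<longlonglongrightarrow> nrm x" by (simp add: LIM_zero_iff)
  have "(\<lambda>n. B * nrm (X n - x)) \<longlonglongrightarrow> 0" using tendsto_mult_left[OF x(2), of B] by simp
  then have "(\<lambda>n. L (X n) - L x) \<longlonglongrightarrow> 0"
    by (rule Lim_null_comparison[rotated]) (use bound X x Ldiff S_diff in \<open>auto simp flip: Ldiff\<close>)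
  then have n2: "(\<lambda>n. L (X n)) \<longlonglongrightarrow> L x" by (simp add: LIM_zero_iff)
  have lJ: "(\<lambda>n. J (X n)) \<longlonglongrightarrow> J x" unfolding J_def by (intro tendsto_intros n1 n2) simp
  have "(\<lambda>n. m + 1 / real (Suc n)) \<longlonglongrightarrow> m + 0"
    by (intro tendsto_intros LIMSEQ_Suc[OF lim_1_over_n])
  then have Jm: "J x \<le> m"
    by (intro LIMSEQ_le[OF lJ, of _ m]) (use X(2) in \<open>auto intro!: exI[of _ 0] less_imp_le\<close>)
  have "ip x v = L v" if "v \<in> S" for v
  proof -
    have q: "0 \<le> t * (ip x v - L v) + t\<^sup>2 * (ip v v / 2)" for t
    proof -
      have "J x \<le> J (x + t *\<^sub>R v)" using Jm m_le[of "x + t *\<^sub>R v"] x(1) that by (simp add: S_mem)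
      moreover have "(nrm (x + t *\<^sub>R v))\<^sup>2 = (nrm x)\<^sup>2 + 2 * t * ip x v + t\<^sup>2 * ip v v"
        using x(1) that
        by (simp add: nrm_sq S_mem ip_add ip_add_right ip_scale ip_scale_right ip_sym[of v x])
          (simp add: power2_eq_square algebra_simps)
      ultimately show ?thesis using x(1) that by (simp add: J_def S_mem add scale algebra_simps)
    qed
    define d where "d = ip x v - L v"
    \<comment> \<open>The summand 1 keeps \<open>b\<close> positive when \<open>v\<close> has norm
      0. At t = -d/b the quadratic equals -(d/b)^2, which forces d = 0.\<close>
    define b where "b = ip v v / 2 + 1"
    have b: "b > 0" using ip_nonneg[OF that] by (simp add: b_def)
    have "0 \<le> (-d / b) * d + (-d / b)\<^sup>2 * (b - 1)"
      using q[of "-d / b"] by (simp add: d_def b_def)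
    also have "\<dots> = - (d\<^sup>2 / b\<^sup>2)" using b by (simp add: field_simps power2_eq_square)
    finally have "d\<^sup>2 \<le> 0" using b by (simp add: field_simps)
    then show ?thesis by (simp add: d_def)
  qed
  then show ?thesis using x(1) by blast
qed

end


text \<open>\<open>\<Phi>\<close> is the part subtracted from half the squared norm,
  \<open>D u\<close> its derivative at \<open>u\<close>. \<open>D_unif\<close> and
  \<open>D_compact\<close> are estimates in the dual norm, written out as bounds against
  \<open>nrm v\<close>; \<open>AR\<close> is the Ambrosetti-Rabinowitz condition.\<close>

locale mountain_pass = semi_hilbert +
  fixes \<Phi> :: "'a \<Rightarrow> real" and D :: "'a \<Rightarrow> 'a \<Rightarrow> real" and \<mu> :: real
  assumes D_add: "u \<in> S \<Longrightarrow> v \<in> S \<Longrightarrow> w \<in> S \<Longrightarrow> D u (v + w) = D u v + D u w"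
    and D_scale: "u \<in> S \<Longrightarrow> v \<in> S \<Longrightarrow> D u (c *\<^sub>R v) = c * D u v"
    and D_bound: "u \<in> S \<Longrightarrow> \<exists>B. \<forall>v\<in>S. \<bar>D u v\<bar> \<le> B * nrm v"
    and \<Phi>_deriv: "u \<in> S \<Longrightarrow> v \<in> S \<Longrightarrow>
        ((\<lambda>t. \<Phi> (u + t *\<^sub>R v)) has_real_derivative D (u + t *\<^sub>R v) v) (at t)"
    and \<Phi>_zero: "\<Phi> 0 = 0"
    and D_unif: "\<epsilon> > 0 \<Longrightarrow> \<exists>\<delta>>0. \<forall>u\<in>S. \<forall>w\<in>S. nrm u \<le> R \<longrightarrow> nrm w \<le> R \<longrightarrow> nrm (u - w) < \<delta> \<longrightarrow>
        (\<forall>v\<in>S. \<bar>D u v - D w v\<bar> \<le> \<epsilon> * nrm v)"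
    and D_compact: "(\<And>n::nat. X n \<in> S) \<Longrightarrow> (\<And>n. nrm (X n) \<le> R) \<Longrightarrow>
        \<exists>r::nat \<Rightarrow> nat. strict_mono r \<and> (\<forall>\<epsilon>>0. \<exists>M. \<forall>m\<ge>M. \<forall>n\<ge>M. \<forall>v\<in>S.
          \<bar>D (X (r m)) v - D (X (r n)) v\<bar> \<le> \<epsilon> * nrm v)"
    and \<mu>: "\<mu> > 2"
    and AR: "u \<in> S \<Longrightarrow> \<mu> * \<Phi> u \<le> D u u"
begin

section \<open>The gradient and Palais-Smale sequences\<close>

definition E :: "'a \<Rightarrow> real" where
  "E u = (nrm u)\<^sup>2 / 2 - \<Phi> u"

text \<open>A gradient of \<open>E\<close>, picked by choice: the representing vector is determined
  only up to vectors of norm 0, so only its products with elements of \<open>S\<close> carry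
  meaning.\<close>

definition G :: "'a \<Rightarrow> 'a" where
  "G u = (SOME g. g \<in> S \<and> (\<forall>v\<in>S. ip g v = ip u v - D u v))"

lemma G:
  assumes "u \<in> S"
  shows "G u \<in> S" "\<And>v. v \<in> S \<Longrightarrow> ip (G u) v = ip u v - D u v"
proof -
  obtain B where B: "\<forall>v\<in>S. \<bar>D u v\<bar> \<le> B * nrm v" using D_bound assms by blast
  have "\<exists>g\<in>S. \<forall>v\<in>S. ip g v = ip u v - D u v"
  proof (rule Riesz[where B = "nrm u + B"])
    fix v assume "v \<in> S"
    then show "\<bar>ip u v - D u v\<bar> \<le> (nrm u + B) * nrm v"
      using Cauchy_Schwarz[OF assms, of v] B[rule_format, of v] by (simp add: distrib_right)
  qed (simp_all add: ip_add_right ip_scale_right D_add D_scale assms right_diff_distrib)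
  then have "G u \<in> S \<and> (\<forall>v\<in>S. ip (G u) v = ip u v - D u v)"
    unfolding G_def Bex_def by (rule someI_ex)
  then show "G u \<in> S" "\<And>v. v \<in> S \<Longrightarrow> ip (G u) v = ip u v - D u v" by simp_all
qed

lemma E_zero: "E 0 = 0"
  by (simp add: E_def \<Phi>_zero)

text \<open>The gradient is the identity minus a representative of \<open>D\<close>. Testing the
  difference of two gradients with itself and dividing by its norm gives the bound.\<close>

lemma G_diff:
  assumes "u \<in> S" "w \<in> S" "\<And>v. v \<in> S \<Longrightarrow> \<bar>D u v - D w v\<bar> \<le> \<epsilon> * nrm v" "\<epsilon> \<ge> 0"
  shows "nrm (G u - G w) \<le> nrm (u - w) + \<epsilon>"
proof -
  let ?g = "G u - G w"
  have gS: "?g \<in> S" using assms G by (intro S_mem)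
  have "(nrm ?g)\<^sup>2 = ip (u - w) ?g - (D u ?g - D w ?g)"
    unfolding nrm_sq[OF gS] using assms G gS by (simp add: ip_diff S_mem)
  also have "\<dots> \<le> nrm (u - w) * nrm ?g + \<epsilon> * nrm ?g"
    using Cauchy_Schwarz[OF S_diff[OF assms(1,2)] gS] assms(3)[OF gS] by linarith
  finally have "nrm ?g * nrm ?g \<le> (nrm (u - w) + \<epsilon>) * nrm ?g"
    by (simp add: power2_eq_square algebra_simps)
  then show ?thesis
    using nrm_nonneg[OF gS] nrm_nonneg[OF S_diff[OF assms(1,2)]] \<open>\<epsilon> \<ge> 0\<close>
    by (cases "nrm ?g = 0") (simp_all add: mult_le_cancel_right)
qed

text \<open>Convergence in the seminorm, bundled with membership. Since \<open>S\<close> carries no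
  topology, all continuity below is sequential and expressed through this relation.\<close>

definition lim_to :: "(nat \<Rightarrow> 'a) \<Rightarrow> 'a \<Rightarrow> bool" where
  "lim_to X u \<longleftrightarrow> (\<forall>n. X n \<in> S) \<and> u \<in> S \<and> (\<lambda>n. nrm (X n - u)) \<longlonglongrightarrow> 0"

lemma lim_to_nrm: assumes "lim_to X u" shows "(\<lambda>n. nrm (X n)) \<longlonglongrightarrow> nrm u"
proof -
  have S: "X n \<in> S" "u \<in> S" for n using assms by (auto simp: lim_to_def)
  have "(\<lambda>n. nrm (X n) - nrm u) \<longlonglongrightarrow> 0"
  proof (rule Lim_null_comparison)
    show "\<forall>\<^sub>F n in sequentially. norm (nrm (X n) - nrm u) \<le> nrm (X n - u)"
      using nrm_diff_ge[OF S] by simp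
    show "(\<lambda>n. nrm (X n - u)) \<longlonglongrightarrow> 0" using assms by (simp add: lim_to_def)
  qed
  then show ?thesis by (simp add: LIM_zero_iff)
qed

lemma lim_to_D:
  assumes "lim_to X u" "\<epsilon> > 0"
  shows "\<forall>\<^sub>F n in sequentially. \<forall>v\<in>S. \<bar>D (X n) v - D u v\<bar> \<le> \<epsilon> * nrm v"
proof -
  have S: "X n \<in> S" "u \<in> S" for n using assms by (auto simp: lim_to_def)
  obtain \<delta> where \<delta>: "\<delta> > 0" "\<forall>x\<in>S. \<forall>w\<in>S. nrm x \<le> nrm u + 1 \<longrightarrow> nrm w \<le> nrm u + 1 \<longrightarrow>
      nrm (x - w) < \<delta> \<longrightarrow> (\<forall>v\<in>S. \<bar>D x v - D w v\<bar> \<le> \<epsilon> * nrm v)"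
    using D_unif[OF \<open>\<epsilon> > 0\<close>, of "nrm u + 1"] by blast
  have "\<forall>\<^sub>F n in sequentially. nrm (X n) < nrm u + 1"
    using order_tendstoD(2)[OF lim_to_nrm[OF assms(1)]] by simp
  moreover have "\<forall>\<^sub>F n in sequentially. nrm (X n - u) < \<delta>"
    using order_tendstoD(2)[of "\<lambda>n. nrm (X n - u)" 0 sequentially \<delta>] assms \<delta>(1)
    by (simp add: lim_to_def)
  ultimately show ?thesis
  proof eventually_elim
    case (elim n)
    then show ?case using \<delta>(2)[rule_format, OF S(1) S(2), of n] by simp
  qed
qed

lemma lim_to_G: assumes "lim_to X u" shows "lim_to (\<lambda>n. G (X n)) (G u)"
proof -
  have S: "X n \<in> S" "u \<in> S" for n using assms by (auto simp: lim_to_def)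
  have "(\<lambda>n. nrm (G (X n) - G u)) \<longlonglongrightarrow> 0"
  proof (rule tendstoI)
    fix e :: real assume "e > 0"
    then have "\<forall>\<^sub>F n in sequentially. nrm (X n - u) < e / 2"
      using order_tendstoD(2)[of "\<lambda>n. nrm (X n - u)" 0 sequentially "e/2"] assms
      by (simp add: lim_to_def)
    moreover have "\<forall>\<^sub>F n in sequentially. \<forall>v\<in>S. \<bar>D (X n) v - D u v\<bar> \<le> (e / 2) * nrm v"
      using \<open>e > 0\<close> by (intro lim_to_D[OF assms]) simp
    ultimately show "\<forall>\<^sub>F n in sequentially. dist (nrm (G (X n) - G u)) 0 < e"
    proof eventually_elim
      case (elim n)
      have "nrm (G (X n) - G u) \<le> nrm (X n - u) + e / 2"
        using elim(2) S \<open>e > 0\<close> by (intro G_diff) auto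
      then show ?case using elim(1) nrm_nonneg[of "G (X n) - G u"] S by (simp add: G S_mem)
    qed
  qed
  then show ?thesis using S by (auto simp: lim_to_def G)
qed

lemma \<Phi>_mvt:
  assumes "u \<in> S" "v \<in> S" "t > 0"
  shows "\<exists>\<xi>. 0 < \<xi> \<and> \<xi> < t \<and> \<Phi> (u + t *\<^sub>R v) - \<Phi> u = t * D (u + \<xi> *\<^sub>R v) v"
proof -
  obtain z where "0 < z" "z < t"
    "\<Phi> (u + t *\<^sub>R v) - \<Phi> (u + 0 *\<^sub>R v) = (t - 0) * D (u + z *\<^sub>R v) v"
    using MVT2[of 0 t "\<lambda>t. \<Phi> (u + t *\<^sub>R v)" "\<lambda>t. D (u + t *\<^sub>R v) v"] \<Phi>_deriv assms by auto
  then show ?thesis by auto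
qed

text \<open>The mean value theorem on the segment from \<open>u\<close> to \<open>X n\<close>,
  together with a uniform bound on \<open>D\<close> near \<open>u\<close>, makes
  \<open>\<Phi>\<close> Lipschitz there.\<close>

lemma lim_to_\<Phi>: assumes "lim_to X u" shows "(\<lambda>n. \<Phi> (X n)) \<longlonglongrightarrow> \<Phi> u"
proof -
  have S: "X n \<in> S" "u \<in> S" for n using assms by (auto simp: lim_to_def)
  obtain \<delta> where \<delta>: "\<delta> > 0" "\<forall>x\<in>S. \<forall>w\<in>S. nrm x \<le> nrm u + 1 \<longrightarrow> nrm w \<le> nrm u + 1 \<longrightarrow>
      nrm (x - w) < \<delta> \<longrightarrow> (\<forall>v\<in>S. \<bar>D x v - D w v\<bar> \<le> 1 * nrm v)"
    using D_unif[of 1 "nrm u + 1"] by auto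
  obtain B where B: "\<forall>v\<in>S. \<bar>D u v\<bar> \<le> B * nrm v" using D_bound S by blast
  have "\<forall>\<^sub>F n in sequentially. nrm (X n - u) < min 1 \<delta>"
    using order_tendstoD(2)[of "\<lambda>n. nrm (X n - u)" 0 sequentially "min 1 \<delta>"] assms \<delta>(1)
    by (simp add: lim_to_def)
  then have "\<forall>\<^sub>F n in sequentially. norm (\<Phi> (X n) - \<Phi> u) \<le> (B + 1) * nrm (X n - u)"
  proof eventually_elim
    case (elim n)
    define v where "v = X n - u"
    have vS: "v \<in> S" using S by (simp add: v_def S_mem)
    obtain \<xi> where \<xi>: "0 < \<xi>" "\<xi> < 1" "\<Phi> (u + 1 *\<^sub>R v) - \<Phi> u = 1 * D (u + \<xi> *\<^sub>R v) v"
      using \<Phi>_mvt[of u v 1] S vS by auto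
    have 1: "nrm (\<xi> *\<^sub>R v) \<le> nrm v"
      using \<xi> vS nrm_nonneg[OF vS] mult_right_mono[of \<xi> 1 "nrm v"] by (simp add: nrm_scale)
    have "nrm (u + \<xi> *\<^sub>R v) \<le> nrm u + 1"
      using nrm_triangle[of u "\<xi> *\<^sub>R v"] 1 S vS elim by (auto simp: v_def S_mem)
    moreover have "nrm ((u + \<xi> *\<^sub>R v) - u) < \<delta>" using 1 elim by (simp add: v_def)
    ultimately have "\<bar>D (u + \<xi> *\<^sub>R v) v - D u v\<bar> \<le> nrm v"
      using \<delta>(2)[rule_format, OF S_add[OF S(2) S_scale[OF vS]] S(2) _ _ _ vS, of \<xi>] by simp
    moreover have "\<bar>D u v\<bar> \<le> B * nrm v" using B vS by simp
    ultimately have "\<bar>D (u + \<xi> *\<^sub>R v) v\<bar> \<le> (B + 1) * nrm v" by (simp add: distrib_right)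
    then show ?case using \<xi>(3) by (simp add: v_def)
  qed
  moreover have "(\<lambda>n. (B + 1) * nrm (X n - u)) \<longlonglongrightarrow> 0"
    using tendsto_mult_left[of "\<lambda>n. nrm (X n - u)" 0 _ "B + 1"] assms by (simp add: lim_to_def)
  ultimately have "(\<lambda>n. \<Phi> (X n) - \<Phi> u) \<longlonglongrightarrow> 0"
    by (rule Lim_null_comparison)
  then show ?thesis by (simp add: LIM_zero_iff)
qed

lemma lim_to_E: "lim_to X u \<Longrightarrow> (\<lambda>n. E (X n)) \<longlonglongrightarrow> E u"
  unfolding E_def by (intro tendsto_intros lim_to_nrm lim_to_\<Phi>) simp_all

text \<open>Tailored to an Euler step, whose base point, direction and step length all vary along
  the sequence.\<close>

lemma lim_to_diff_scale:
  fixes a :: "nat \<Rightarrow> real"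
  assumes "lim_to X u" "lim_to Y v" "a \<longlonglongrightarrow> b"
  shows "lim_to (\<lambda>n. X n - a n *\<^sub>R Y n) (u - b *\<^sub>R v)"
proof -
  have S: "X n \<in> S" "u \<in> S" "Y n \<in> S" "v \<in> S" for n using assms by (auto simp: lim_to_def)
  have "(\<lambda>n. nrm (X n - a n *\<^sub>R Y n - (u - b *\<^sub>R v))) \<longlonglongrightarrow> 0"
  proof (rule Lim_null_comparison)
    show "\<forall>\<^sub>F n in sequentially. norm (nrm (X n - a n *\<^sub>R Y n - (u - b *\<^sub>R v)))
        \<le> nrm (X n - u) + (\<bar>a n\<bar> * nrm (Y n - v) + \<bar>a n - b\<bar> * nrm v)"
    proof (intro always_eventually allI)
      fix n
      have eq: "X n - a n *\<^sub>R Y n - (u - b *\<^sub>R v) = (X n - u) - (a n *\<^sub>R (Y n - v) + (a n - b) *\<^sub>R v)"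
        by (simp add: algebra_simps)
      have "nrm (X n - a n *\<^sub>R Y n - (u - b *\<^sub>R v))
          \<le> nrm (X n - u) + nrm (a n *\<^sub>R (Y n - v) + (a n - b) *\<^sub>R v)"
        unfolding eq using S by (intro nrm_triangle_diff S_mem)
      also have "nrm (a n *\<^sub>R (Y n - v) + (a n - b) *\<^sub>R v)
          \<le> nrm (a n *\<^sub>R (Y n - v)) + nrm ((a n - b) *\<^sub>R v)"
        using S by (intro nrm_triangle S_mem)
      finally show "norm (nrm (X n - a n *\<^sub>R Y n - (u - b *\<^sub>R v)))
        \<le> nrm (X n - u) + (\<bar>a n\<bar> * nrm (Y n - v) + \<bar>a n - b\<bar> * nrm v)"
        using S by (simp add: nrm_scale S_mem nrm_nonneg)
    qed
    have "(\<lambda>n. nrm (X n - u) + (\<bar>a n\<bar> * nrm (Y n - v) + \<bar>a n - b\<bar> * nrm v))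
        \<longlonglongrightarrow> 0 + (\<bar>b\<bar> * 0 + \<bar>b - b\<bar> * nrm v)"
      using assms unfolding lim_to_def by (intro tendsto_intros) auto
    then show "(\<lambda>n. nrm (X n - u) + (\<bar>a n\<bar> * nrm (Y n - v) + \<bar>a n - b\<bar> * nrm v)) \<longlonglongrightarrow> 0"
      by simp
  qed
  then show ?thesis using S by (auto simp: lim_to_def S_mem)
qed

text \<open>A Palais--Smale sequence is bounded by \<open>AR\<close>; compactness of \<open>D\<close> then makes
  \<open>X n = G (X n) + (representative of D (X n))\<close> Cauchy along a subsequence.\<close>

lemma Palais_Smale:
  fixes X :: "nat \<Rightarrow> 'a"
  assumes X: "\<And>n. X n \<in> S" and E: "(\<lambda>n. E (X n)) \<longlonglongrightarrow> c" and g: "(\<lambda>n. nrm (G (X n))) \<longlonglongrightarrow> 0"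
  shows "\<exists>u\<in>S. (\<forall>v\<in>S. ip u v = D u v) \<and> E u = c"
proof -
  \<comment> \<open>Subtracting \<open>ip (G u) u / \<mu>\<close> from \<open>E u\<close> leaves the
    quadratic term with the positive factor 1/2 - 1/\<mu>, and \<open>AR\<close> disposes of
    \<open>\<Phi>\<close>.\<close>
  have coer: "(1/2 - 1/\<mu>) * (nrm u)\<^sup>2 \<le> E u + nrm (G u) * nrm u / \<mu>" if "u \<in> S" for u
  proof -
    have "ip (G u) u = (nrm u)\<^sup>2 - D u u" using that by (simp add: G nrm_sq)
    have "D u u = (nrm u)\<^sup>2 - ip (G u) u" using \<open>ip (G u) u = _\<close> by simp
    moreover have "- ip (G u) u \<le> nrm (G u) * nrm u"
      using Cauchy_Schwarz[OF G(1)[OF that] that] by simp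
    ultimately have "\<Phi> u \<le> ((nrm u)\<^sup>2 + nrm (G u) * nrm u) / \<mu>"
      using AR[OF that] \<mu> by (simp add: field_simps)
    then show ?thesis by (simp add: E_def left_diff_distrib add_divide_distrib)
  qed
  have ex: "\<exists>K. \<forall>n. \<bar>f n\<bar> \<le> K" if "f \<longlonglongrightarrow> l" for f :: "nat \<Rightarrow> real" and l
    using convergent_imp_Bseq[OF convergentI[OF that]] by (auto simp: Bseq_def)
  obtain K1 where K1: "\<And>n. \<bar>E (X n)\<bar> \<le> K1" using ex[OF E] by blast
  obtain K2 where K2: "\<And>n. \<bar>nrm (G (X n))\<bar> \<le> K2" using ex[OF g] by blast
  define a where "a = 1/2 - 1/\<mu>"
  have a: "a > 0" using \<mu> by (simp add: a_def field_simps)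
  \<comment> \<open>The summand 1 forces a violating norm y to be at least 1, so that the constant
    \<open>K1\<close> can be replaced by \<open>K1 * y\<close> and one factor y cancelled.\<close>
  define R where "R = 1 + (K1 + K2 / \<mu>) / a"
  have XR: "nrm (X n) \<le> R" for n
  proof (rule ccontr)
    assume "\<not> nrm (X n) \<le> R"
    have K: "K1 \<ge> 0" "K2 \<ge> 0" using K1[of 0] K2[of 0] by linarith+
    have R1: "R \<ge> 1" unfolding R_def using K a \<mu> by simp
    define y where "y = nrm (X n)"
    have y: "y > R" "y \<ge> 1" using \<open>\<not> nrm (X n) \<le> R\<close> R1 by (auto simp: y_def)
    have "a * y\<^sup>2 \<le> E (X n) + nrm (G (X n)) * y / \<mu>" using coer[OF X] by (simp add: a_def y_def)
    also have "\<dots> \<le> K1 * y + K2 * y / \<mu>"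
    proof (rule add_mono)
      show "E (X n) \<le> K1 * y" using K1[of n] K y mult_left_mono[of 1 y K1] by simp
      show "nrm (G (X n)) * y / \<mu> \<le> K2 * y / \<mu>"
        using K2[of n] y \<mu> by (intro divide_right_mono mult_right_mono) auto
    qed
    finally have "a * y * y \<le> (K1 + K2 / \<mu>) * y" by (simp add: power2_eq_square algebra_simps)
    then have "a * y \<le> K1 + K2 / \<mu>" using y by simp
    then have "y \<le> (K1 + K2 / \<mu>) / a" using a by (simp add: field_simps)
    then show False using y unfolding R_def by linarith
  qed
  have "\<exists>r::nat \<Rightarrow> nat. strict_mono r \<and> (\<forall>\<epsilon>>0. \<exists>M. \<forall>m\<ge>M. \<forall>n\<ge>M. \<forall>v\<in>S.
          \<bar>D (X (r m)) v - D (X (r n)) v\<bar> \<le> \<epsilon> * nrm v)"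
    by (rule D_compact[of X R, OF X XR])
  then obtain r :: "nat \<Rightarrow> nat" where r: "strict_mono r" "\<forall>\<epsilon>>0. \<exists>M. \<forall>m\<ge>M. \<forall>n\<ge>M. \<forall>v\<in>S.
          \<bar>D (X (r m)) v - D (X (r n)) v\<bar> \<le> \<epsilon> * nrm v"
    by blast
  have gr: "(\<lambda>n. nrm (G (X (r n)))) \<longlonglongrightarrow> 0"
    using LIMSEQ_subseq_LIMSEQ[OF g r(1)] by (simp add: o_def)
  have Er: "(\<lambda>n. E (X (r n))) \<longlonglongrightarrow> c"
    using LIMSEQ_subseq_LIMSEQ[OF E r(1)] by (simp add: o_def)
  have "\<exists>M. \<forall>m\<ge>M. \<forall>n\<ge>M. nrm (X (r m) - X (r n)) < e" if "e > 0" for e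
  proof -
    have e4: "0 < e / 4" using that by simp
    obtain M1 where M1: "\<forall>m\<ge>M1. \<forall>n\<ge>M1. \<forall>v\<in>S.
          \<bar>D (X (r m)) v - D (X (r n)) v\<bar> \<le> (e/4) * nrm v"
      using r(2)[rule_format, OF e4] by blast
    obtain M2 where M2: "\<forall>n\<ge>M2. nrm (G (X (r n))) < e / 4"
      using order_tendstoD(2)[OF gr e4] by (auto simp: eventually_sequentially)
    have "nrm (X (r m) - X (r n)) < e" if mn: "m \<ge> max M1 M2" "n \<ge> max M1 M2" for m n
    proof -
      define x y where "x = X (r m)" and "y = X (r n)"
      define w where "w = x - y"
      have S: "x \<in> S" "y \<in> S" "w \<in> S" using X by (auto simp: x_def y_def w_def S_mem)
      have DD: "\<bar>D x w - D y w\<bar> \<le> e * nrm w / 4"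
        using M1[rule_format, of m n w] mn S by (simp add: x_def y_def)
      have "nrm w * nrm w = ip w w" using nrm_sq[OF S(3)] by (simp add: power2_eq_square)
      also have "\<dots> = ip x w - ip y w" using S by (simp add: w_def ip_diff)
      also have "\<dots> = ip (G x) w - ip (G y) w + (D x w - D y w)" using S by (simp add: G)
      also have "\<dots> \<le> nrm (G x) * nrm w + nrm (G y) * nrm w + e * nrm w / 4"
        using Cauchy_Schwarz[OF G(1)[OF S(1)] S(3)] Cauchy_Schwarz[OF G(1)[OF S(2)] S(3)]
          abs_ge_self[of "D x w - D y w"] DD by argo
      finally have "nrm w * nrm w \<le> (nrm (G x) + nrm (G y) + e/4) * nrm w" by (simp add: algebra_simps)
      then have "nrm w \<le> nrm (G x) + nrm (G y) + e/4"
        using nrm_nonneg[OF S(3)] nrm_nonneg[OF G(1)[OF S(1)]] nrm_nonneg[OF G(1)[OF S(2)]] \<open>e > 0\<close>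
        by (cases "nrm w = 0") (simp_all add: mult_le_cancel_right)
      also have "\<dots> < e" using M2[rule_format, of m] M2[rule_format, of n] mn \<open>e > 0\<close>
        by (simp add: x_def y_def)
      finally show ?thesis by (simp add: w_def x_def y_def)
    qed
    then show ?thesis by blast
  qed
  then obtain u where u: "u \<in> S" "(\<lambda>n. nrm (X (r n) - u)) \<longlonglongrightarrow> 0"
    using complete[of "\<lambda>n. X (r n)"] X by blast
  then have lt: "lim_to (\<lambda>n. X (r n)) u" using X by (simp add: lim_to_def)
  have "E u = c" using LIMSEQ_unique[OF lim_to_E[OF lt] Er] .
  moreover have "nrm (G u) = 0" using LIMSEQ_unique[OF lim_to_nrm[OF lim_to_G[OF lt]] gr] .
  then have "ip u v = D u v" if "v \<in> S" for v
    using Cauchy_Schwarz[OF G(1)[OF u(1)] that] G(2)[OF u(1) that] by simp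
  ultimately show ?thesis using u(1) by blast
qed

section \<open>Paths, Euler steps and the minimax argument\<close>

definition path :: "(real \<Rightarrow> 'a) \<Rightarrow> bool" where
  "path \<gamma> \<longleftrightarrow> (\<forall>t\<in>{0..1}. \<forall>\<tau>. (\<forall>n. \<tau> n \<in> {0..1}) \<longrightarrow> \<tau> \<longlonglongrightarrow> t \<longrightarrow> lim_to (\<lambda>n. \<gamma> (\<tau> n)) (\<gamma> t))"

lemma path_mem: "path \<gamma> \<Longrightarrow> t \<in> {0..1} \<Longrightarrow> \<gamma> t \<in> S"
  unfolding path_def lim_to_def by (metis tendsto_const)

text \<open>After composition with a sequentially continuous real functional, ordinary continuity on
  the unit interval is recovered, and with it compactness and the intermediate value
  theorem.\<close>

lemma path_continuous_on:
  assumes "path \<gamma>" "\<And>X u. lim_to X u \<Longrightarrow> (\<lambda>n. h (X n)) \<longlonglongrightarrow> h u"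
  shows "continuous_on {0..1} (\<lambda>t. h (\<gamma> t) :: real)"
  unfolding continuous_on_sequentially o_def using assms by (simp add: path_def)

lemma path_compose:
  assumes "path \<gamma>" "\<And>X u. lim_to X u \<Longrightarrow> lim_to (\<lambda>n. P (X n)) (P u)"
  shows "path (\<lambda>t. P (\<gamma> t))"
  using assms by (simp add: path_def)

lemma path_segment: assumes "e \<in> S" shows "path (\<lambda>t. t *\<^sub>R e)"
proof -
  have "lim_to (\<lambda>n. \<tau> n *\<^sub>R e) (t *\<^sub>R e)" if "\<tau> \<longlonglongrightarrow> t" for \<tau> and t :: real
  proof -
    have "lim_to (\<lambda>n. 0) 0" "lim_to (\<lambda>n. - e) (- e)" using assms by (auto simp: lim_to_def S_mem)
    from lim_to_diff_scale[OF this that] show ?thesis by simp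
  qed
  then show ?thesis by (simp add: path_def)
qed

text \<open>One explicit Euler step along the normalised gradient already deforms the sublevel sets,
  because \<^term>\<open>G\<close> is uniformly continuous on balls; the step size depends on the ball.\<close>

lemma Euler_step_decrease:
  assumes \<delta>: "\<delta> > 0" and R: "R \<ge> 0"
  shows "\<exists>h0>0. \<forall>u\<in>S. \<forall>h. nrm u \<le> R \<longrightarrow> \<delta> \<le> nrm (G u) \<longrightarrow> 0 \<le> h \<longrightarrow> h \<le> h0 \<longrightarrow>
           E (u - (h / (nrm (G u))\<^sup>2) *\<^sub>R G u) \<le> E u - h / 2"
proof -
  obtain \<delta>' where \<delta>': "\<delta>' > 0" "\<forall>x\<in>S. \<forall>w\<in>S. nrm x \<le> R + 1 \<longrightarrow> nrm w \<le> R + 1 \<longrightarrow>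
      nrm (x - w) < \<delta>' \<longrightarrow> (\<forall>v\<in>S. \<bar>D x v - D w v\<bar> \<le> (\<delta>/4) * nrm v)"
    using D_unif[of "\<delta>/4" "R + 1"] \<delta> by auto
  \<comment> \<open>A step moves by h / nrm (G u), hence by at most h / \<delta>. The three caps
    control the quadratic error, keep the intermediate point within the modulus
    \<open>\<delta>'\<close>, and keep it in the ball of radius R + 1.\<close>
  define h0 where "h0 = \<delta> * min (\<delta> / 4) (min (\<delta>' / 2) 1)"
  have "h0 > 0" using \<delta> \<delta>' by (simp add: h0_def)
  moreover have "E (u - (h / (nrm (G u))\<^sup>2) *\<^sub>R G u) \<le> E u - h / 2"
    if u: "u \<in> S" "nrm u \<le> R" "\<delta> \<le> nrm (G u)" "0 \<le> h" "h \<le> h0" for u h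
  proof (cases "h = 0")
    case False
    define g where "g = G u"
    define n where "n = nrm g"
    define t where "t = h / n\<^sup>2"
    have gS: "g \<in> S" using u by (simp add: g_def G)
    have n: "n \<ge> \<delta>" "n > 0" using u \<delta> by (auto simp: n_def g_def)
    have t: "t > 0" using False u n by (simp add: t_def)
    have tn: "t * n \<le> h0 / \<delta>"
    proof -
      have "t * n = h / n" using n by (simp add: t_def power2_eq_square)
      also have "\<dots> \<le> h0 / \<delta>" using u n \<delta> by (intro frac_le) auto
      finally show ?thesis .
    qed
    have h0': "h0 / \<delta> \<le> \<delta> / 4" "h0 / \<delta> < \<delta>'" "h0 / \<delta> \<le> 1" using \<delta> \<delta>' by (auto simp: h0_def)
    have mvtE: "\<exists>\<xi>. 0 < \<xi> \<and> \<xi> < t \<and> E (u - t *\<^sub>R g) - E u \<le> t * (D (u - \<xi> *\<^sub>R g) g - ip u g) + t\<^sup>2 * n\<^sup>2 / 2"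
    proof -
      obtain \<xi> where \<xi>: "0 < \<xi>" "\<xi> < t"
          "\<Phi> (u + t *\<^sub>R (- g)) - \<Phi> u = t * D (u + \<xi> *\<^sub>R (- g)) (- g)"
        using \<Phi>_mvt[of u "- g" t] u gS t by (auto simp: S_mem)
      have D: "D w (- g) = - D w g" if "w \<in> S" for w
        using D_scale[OF that gS, of "-1"] by simp
      have nn: "(nrm (u - t *\<^sub>R g))\<^sup>2 = (nrm u)\<^sup>2 - 2 * t * ip u g + t\<^sup>2 * n\<^sup>2"
        using u gS by (simp add: n_def nrm_sq S_mem ip_diff ip_diff_right ip_scale ip_scale_right ip_sym[of g u])
          (simp add: power2_eq_square algebra_simps)
      have "\<Phi> (u - t *\<^sub>R g) - \<Phi> u = - t * D (u - \<xi> *\<^sub>R g) g"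
        using \<xi>(3) D[of "u - \<xi> *\<^sub>R g"] u gS by (simp add: S_mem)
      then show ?thesis using \<xi> nn by (intro exI[of _ \<xi>]) (simp add: E_def algebra_simps)
    qed
    then obtain \<xi> where \<xi>: "0 < \<xi>" "\<xi> < t"
      "E (u - t *\<^sub>R g) - E u \<le> t * (D (u - \<xi> *\<^sub>R g) g - ip u g) + t\<^sup>2 * n\<^sup>2 / 2" by blast
    have \<xi>n: "nrm (\<xi> *\<^sub>R g) \<le> h0 / \<delta>"
    proof -
      have "nrm (\<xi> *\<^sub>R g) = \<xi> * n" using \<xi> gS by (simp add: nrm_scale n_def)
      also have "\<dots> \<le> t * n" using \<xi> n by simp
      finally show ?thesis using tn by simp
    qed
    have "nrm (u - \<xi> *\<^sub>R g) \<le> R + 1"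
      using nrm_triangle_diff[of u "\<xi> *\<^sub>R g"] \<xi>n h0' u gS by (simp add: S_mem)
    moreover have "nrm (u - \<xi> *\<^sub>R g - u) < \<delta>'"
      using \<xi>n h0' nrm_minus_commute[of "u - \<xi> *\<^sub>R g" u] u gS by (simp add: S_mem)
    ultimately have "\<bar>D (u - \<xi> *\<^sub>R g) g - D u g\<bar> \<le> (\<delta>/4) * n"
      using \<delta>'(2)[rule_format, OF S_diff[OF u(1) S_scale[OF gS]] u(1) _ _ _ gS, of \<xi>] u
      by (simp add: n_def)
    also have "\<dots> \<le> n * n / 4" using n by simp
    finally have "D (u - \<xi> *\<^sub>R g) g - ip u g \<le> n * n / 4 - (ip u g - D u g)" by linarith
    also have "ip u g - D u g = n * n"
      using G(2)[OF u(1) gS] nrm_sq[OF gS] by (simp add: g_def n_def power2_eq_square)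
    finally have "t * (D (u - \<xi> *\<^sub>R g) g - ip u g) \<le> t * (n * n / 4 - n * n)"
      using t by (intro mult_left_mono) auto
    moreover have "t\<^sup>2 * n\<^sup>2 / 2 \<le> t * (n * n / 8)"
    proof -
      have "t * n \<le> n / 4" using tn h0' n by linarith
      then have "(t * n) * (t * n) \<le> (n / 4) * (t * n)" using t n by (intro mult_right_mono) auto
      then show ?thesis by (simp add: power2_eq_square algebra_simps)
    qed
    \<comment> \<open>The gradient contributes -1, the variation of \<open>D\<close> at most 1/4 and
      the quadratic term at most 1/8.\<close>
    ultimately have "E (u - t *\<^sub>R g) - E u \<le> - (5/8) * (t * (n * n))" using \<xi>(3) by (simp add: algebra_simps)
    also have "t * (n * n) = h" using n by (simp add: t_def power2_eq_square)
    finally show ?thesis using u by (simp add: t_def n_def g_def)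
  qed simp
  ultimately show ?thesis by blast
qed

text \<open>A continuous ramp in the energy: the step is switched off below \<open>a\<close>, so
  that path endpoints do not move, and is full above \<open>b\<close>.\<close>

definition cutoff :: "real \<Rightarrow> real \<Rightarrow> real \<Rightarrow> real" where
  "cutoff a b x = max 0 (min 1 ((x - a) / (b - a)))"

text \<open>The maximum with \<open>\<delta>\<close> keeps the step continuous across zeros of the
  gradient; wherever the gradient has norm at least \<open>\<delta>\<close> it changes
  nothing.\<close>

definition Euler_step :: "real \<Rightarrow> real \<Rightarrow> real \<Rightarrow> real \<Rightarrow> 'a \<Rightarrow> 'a" where
  "Euler_step a b \<delta> h u = u - (h * cutoff a b (E u) / (max \<delta> (nrm (G u)))\<^sup>2) *\<^sub>R G u"

lemma Euler_step_mem: "u \<in> S \<Longrightarrow> Euler_step a b \<delta> h u \<in> S"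
  by (simp add: Euler_step_def G S_mem)

lemma Euler_step_lim:
  assumes "\<delta> > 0" "a < b" "lim_to X u"
  shows "lim_to (\<lambda>n. Euler_step a b \<delta> h (X n)) (Euler_step a b \<delta> h u)"
  unfolding Euler_step_def cutoff_def
  by (intro lim_to_diff_scale assms lim_to_G tendsto_intros lim_to_E lim_to_nrm) (use assms in auto)

lemma Euler_step_fixed: "a < b \<Longrightarrow> E u \<le> a \<Longrightarrow> Euler_step a b \<delta> h u = u"
  by (simp add: Euler_step_def cutoff_def divide_nonpos_pos max_absorb1 min.coboundedI2)

lemma Euler_step_dist:
  assumes "\<delta> > 0" "h \<ge> 0" "u \<in> S"
  shows "nrm (Euler_step a b \<delta> h u) \<le> nrm u + h / \<delta>"
proof -
  define m where "m = max \<delta> (nrm (G u))"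
  have m: "m \<ge> \<delta>" "m > 0" "nrm (G u) \<le> m" using assms by (auto simp: m_def)
  have c: "0 \<le> cutoff a b (E u)" "cutoff a b (E u) \<le> 1" by (auto simp: cutoff_def)
  have "nrm ((h * cutoff a b (E u) / m\<^sup>2) *\<^sub>R G u) = h * cutoff a b (E u) / m\<^sup>2 * nrm (G u)"
    using assms c by (simp add: nrm_scale G)
  also have "\<dots> \<le> h * 1 / m\<^sup>2 * m"
    using assms c m nrm_nonneg[OF G(1)[OF assms(3)]]
    by (intro mult_mono divide_right_mono mult_left_mono) auto
  also have "\<dots> = h / m" using m by (simp add: power2_eq_square)
  also have "\<dots> \<le> h / \<delta>" using m assms by (intro divide_left_mono) auto
  finally have "nrm ((h * cutoff a b (E u) / m\<^sup>2) *\<^sub>R G u) \<le> h / \<delta>" .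
  moreover have "nrm (Euler_step a b \<delta> h u) \<le> nrm u + nrm ((h * cutoff a b (E u) / m\<^sup>2) *\<^sub>R G u)"
    unfolding Euler_step_def m_def using assms by (intro nrm_triangle_diff S_mem G) auto
  ultimately show ?thesis by simp
qed

text \<open>Each path from 0 to \<open>e\<close> crosses the sphere of radius \<open>\<rho>\<close>,
  so the minimax level \<open>c\<close> is at least \<open>\<alpha>\<close>. If no almost critical
  point lay near level \<open>c\<close>, finitely many Euler steps would push a nearly optimal path
  strictly below \<open>c\<close>.\<close>

theorem mountain_pass:
  assumes \<rho>: "\<rho> > 0" and \<alpha>: "\<alpha> > 0" "\<And>u. u \<in> S \<Longrightarrow> nrm u = \<rho> \<Longrightarrow> E u \<ge> \<alpha>"
    and e: "e \<in> S" "nrm e > \<rho>" "E e \<le> 0"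
  shows "\<exists>u\<in>S. (\<forall>v\<in>S. ip u v = D u v) \<and> E u \<ge> \<alpha>"
proof -
  define \<Gamma> where "\<Gamma> = {\<gamma>. path \<gamma> \<and> \<gamma> 0 = 0 \<and> \<gamma> 1 = e}"
  define M where "M \<gamma> = (SUP t\<in>{0..1}. E (\<gamma> t))" for \<gamma> :: "real \<Rightarrow> 'a"
  have cont: "continuous_on {0..1} (\<lambda>t. E (\<gamma> t))" "continuous_on {0..1} (\<lambda>t. nrm (\<gamma> t))"
    if "\<gamma> \<in> \<Gamma>" for \<gamma>
    using that by (auto intro!: path_continuous_on lim_to_E lim_to_nrm simp: \<Gamma>_def)
  have E_le_M: "E (\<gamma> t) \<le> M \<gamma>" if "\<gamma> \<in> \<Gamma>" "t \<in> {0..1}" for \<gamma> t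
    unfolding M_def using that cont(1)
    by (intro cSUP_upper bounded_imp_bdd_above compact_imp_bounded compact_continuous_image) auto
  have M_\<alpha>: "\<alpha> \<le> M \<gamma>" if "\<gamma> \<in> \<Gamma>" for \<gamma>
  proof -
    obtain t where "t \<in> {0..1}" "nrm (\<gamma> t) = \<rho>"
      using IVT'[of "\<lambda>t. nrm (\<gamma> t)" 0 \<rho> 1] cont(2)[OF \<open>\<gamma> \<in> \<Gamma>\<close>] \<open>\<gamma> \<in> \<Gamma>\<close> \<rho> e
      by (auto simp: \<Gamma>_def)
    then show ?thesis using \<alpha>(2)[of "\<gamma> t"] E_le_M[OF that, of t] path_mem[of \<gamma> t] that
      by (auto simp: \<Gamma>_def)
  qed
  have ne: "(\<lambda>t. t *\<^sub>R e) \<in> \<Gamma>" using path_segment[OF e(1)] by (simp add: \<Gamma>_def)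
  define c where "c = Inf (M ` \<Gamma>)"
  have bdd: "bdd_below (M ` \<Gamma>)" using M_\<alpha> by (auto intro!: bdd_belowI)
  have c_\<alpha>: "\<alpha> \<le> c" unfolding c_def using ne M_\<alpha> by (intro cINF_greatest) auto
  have c_le: "c \<le> M \<gamma>" if "\<gamma> \<in> \<Gamma>" for \<gamma> unfolding c_def using bdd that by (intro cINF_lower)
  have PS: "\<exists>u\<in>S. \<bar>E u - c\<bar> \<le> \<epsilon> \<and> nrm (G u) < \<epsilon>" if "\<epsilon> > 0" for \<epsilon>
  proof (rule ccontr)
    assume neg: "\<not> ?thesis"
    \<comment> \<open>The bound \<alpha>/2 makes the threshold c - \<eta> nonnegative, so both
      endpoints, where \<open>E\<close> is at most 0, stay fixed. The bound \<epsilon> keeps the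
      energy band inside the region where the gradient is large.\<close>
    define \<eta> where "\<eta> = min \<epsilon> (\<alpha> / 2)"
    have \<eta>: "\<eta> > 0" "\<eta> \<le> \<epsilon>" "\<eta> \<le> \<alpha> / 2" using that \<alpha> by (auto simp: \<eta>_def)
    have big: "nrm (G u) \<ge> \<epsilon>" if "u \<in> S" "\<bar>E u - c\<bar> \<le> \<eta>" for u
      using neg that \<eta> by force
    obtain \<gamma> where \<gamma>: "\<gamma> \<in> \<Gamma>" "M \<gamma> < c + \<eta>"
      using cInf_lessD[of "M ` \<Gamma>" "c + \<eta>"] ne \<eta> unfolding c_def by auto
    have "bounded ((\<lambda>t. nrm (\<gamma> t)) ` {0..1})"
      using cont(2)[OF \<gamma>(1)] by (intro compact_imp_bounded compact_continuous_image) auto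
    then obtain R0 where "\<forall>t\<in>{0..1}. \<bar>nrm (\<gamma> t)\<bar> \<le> R0"
      by (auto simp: bounded_iff)
    then have R0: "\<bar>nrm (\<gamma> t)\<bar> \<le> R0" if "t \<in> {0..1}" for t
      using that by blast
    \<comment> \<open>All k steps together move a point by at most k h / \<epsilon>, and k h will be
      4 \<eta>. The step size can only be chosen once the reachable ball is known.\<close>
    define R where "R = R0 + 4 * \<eta> / \<epsilon>"
    have R: "R \<ge> 0" using R0[of 0] \<eta> that by (simp add: R_def)
    obtain h0 where h0: "h0 > 0" "\<And>u h. u \<in> S \<Longrightarrow> nrm u \<le> R \<Longrightarrow> \<epsilon> \<le> nrm (G u) \<Longrightarrow> 0 \<le> h \<Longrightarrow> h \<le> h0 \<Longrightarrow>
           E (u - (h / (nrm (G u))\<^sup>2) *\<^sub>R G u) \<le> E u - h / 2"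
      using Euler_step_decrease[OF \<open>\<epsilon> > 0\<close> R] by blast
    obtain k :: nat where k: "4 * \<eta> / h0 < real k" using reals_Archimedean2 by blast
    have "0 < 4 * \<eta> / h0" using \<eta> h0(1) by simp
    then have k0: "k > 0" using k by (metis less_trans of_nat_0_less_iff)
    \<comment> \<open>As long as the energy exceeds \<open>b\<close>, each step lowers it by h/2,
      hence k steps by 2 \<eta>: from below c + \<eta> to below c - \<eta>, which contradicts
      exceeding \<open>b\<close>.\<close>
    define h where "h = 4 * \<eta> / real k"
    have h: "h > 0" "h \<le> h0" "real k * h = 4 * \<eta>"
      using k k0 \<eta> h0(1) by (auto simp: h_def field_simps)
    define a b where "a = c - \<eta>" and "b = c - \<eta> / 2"
    have ab: "a < b" using \<eta> by (simp add: a_def b_def)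
    define P where "P = Euler_step a b \<epsilon> h"
    have step: "E (P u) \<le> E u" "E u > b \<Longrightarrow> E (P u) \<le> E u - h / 2"
      if u: "u \<in> S" "nrm u \<le> R" "E u \<le> c + \<eta>" for u
    proof -
      have c01: "0 \<le> cutoff a b (E u)" "cutoff a b (E u) \<le> 1" by (auto simp: cutoff_def)
      have main: "E (P u) \<le> E u - h * cutoff a b (E u) / 2"
      proof (cases "E u \<le> a")
        case True
        then show ?thesis using Euler_step_fixed[OF ab True] by (simp add: P_def cutoff_def ab divide_nonpos_pos max_absorb1 min.coboundedI2)
      next
        case False
        then have "nrm (G u) \<ge> \<epsilon>" using u by (intro big) (auto simp: a_def)
        moreover have "h * cutoff a b (E u) \<le> h0" using h c01 mult_mono[of h h0 "cutoff a b (E u)" 1] by simp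
        ultimately show ?thesis using h0(2)[of u "h * cutoff a b (E u)"] u c01 h
          by (simp add: P_def Euler_step_def max_absorb2)
      qed
      then show "E (P u) \<le> E u" using mult_nonneg_nonneg[of h "cutoff a b (E u)"] c01 h by linarith
      assume "E u > b"
      then have "cutoff a b (E u) = 1" using ab by (simp add: cutoff_def)
      then show "E (P u) \<le> E u - h / 2" using main by simp
    qed
    \<comment> \<open>The linear decrease is claimed only if the current energy exceeds
      \<open>b\<close>; by monotonicity all earlier energies then exceeded it as well.\<close>
    have iter: "(P ^^ j) u \<in> S \<and> nrm ((P ^^ j) u) \<le> nrm u + real j * h / \<epsilon> \<and> E ((P ^^ j) u) \<le> E u \<and>
        (E ((P ^^ j) u) > b \<longrightarrow> E ((P ^^ j) u) \<le> E u - real j * h / 2)"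
      if u: "u \<in> S" "nrm u \<le> R0" "E u \<le> c + \<eta>" "j \<le> k" for u j
      using \<open>j \<le> k\<close>
    proof (induction j)
      case (Suc j)
      define w where "w = (P ^^ j) u"
      have IH: "w \<in> S" "nrm w \<le> nrm u + real j * h / \<epsilon>" "E w \<le> E u"
        "E w > b \<longrightarrow> E w \<le> E u - real j * h / 2" using Suc by (auto simp: w_def)
      have "real j * h / \<epsilon> \<le> 4 * \<eta> / \<epsilon>"
        using Suc.prems h(1) that(1) \<open>\<epsilon> > 0\<close> unfolding h(3)[symmetric] by (intro divide_right_mono mult_right_mono) auto
      then have wR: "nrm w \<le> R" using IH u by (simp add: R_def)
      have s1: "E (P w) \<le> E w" and s2: "E w > b \<Longrightarrow> E (P w) \<le> E w - h / 2"
        using step[OF IH(1) wR] IH(3) u by auto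
      have "nrm (P w) \<le> nrm w + h / \<epsilon>" unfolding P_def using h IH \<open>\<epsilon> > 0\<close> by (intro Euler_step_dist) auto
      then have "nrm (P w) \<le> nrm u + real (Suc j) * h / \<epsilon>" using IH(2) by (simp add: add_divide_distrib distrib_right)
      moreover have "P w \<in> S" using IH by (simp add: P_def Euler_step_mem)
      moreover have "E (P w) > b \<longrightarrow> E (P w) \<le> E u - real (Suc j) * h / 2"
      proof
        assume "E (P w) > b"
        then have "E w > b" using s1 by simp
        then show "E (P w) \<le> E u - real (Suc j) * h / 2" using s2 IH(4) by (simp add: field_simps)
      qed
      ultimately show ?case using s1 IH(3) by (simp add: w_def)
    qed (use u in auto)
    have lim_iter: "lim_to (\<lambda>n. (P ^^ j) (X n)) ((P ^^ j) u)" if "lim_to X u" for X u j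
    proof (induction j)
      case (Suc j)
      show ?case using Euler_step_lim[OF \<open>\<epsilon> > 0\<close> ab Suc.IH, of h] by (simp add: P_def)
    qed (use that in simp)
    have fixed: "(P ^^ j) u = u" if "E u \<le> a" for u j
      by (induction j) (simp_all add: P_def Euler_step_fixed[OF ab that])
    define \<gamma>' where "\<gamma>' t = (P ^^ k) (\<gamma> t)" for t
    have a0: "a \<ge> 0" using \<eta> c_\<alpha> \<alpha> by (simp add: a_def)
    have "path \<gamma>" using \<gamma>(1) by (simp add: \<Gamma>_def)
    then have "path \<gamma>'" unfolding \<gamma>'_def by (rule path_compose[where P = "P ^^ k"]) (rule lim_iter)
    moreover have "\<gamma>' 0 = 0" "\<gamma>' 1 = e" using \<gamma>(1) fixed[of 0] fixed[of e] E_zero e a0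
      by (auto simp: \<gamma>'_def \<Gamma>_def)
    ultimately have \<gamma>': "\<gamma>' \<in> \<Gamma>" by (simp add: \<Gamma>_def)
    have "E (\<gamma>' t) \<le> b" if t: "t \<in> {0..1}" for t
    proof (rule ccontr)
      assume "\<not> E (\<gamma>' t) \<le> b"
      moreover have El: "E (\<gamma> t) < c + \<eta>" using E_le_M[OF \<gamma>(1) t] \<gamma>(2) by simp
      moreover have "\<gamma> t \<in> S" using \<gamma>(1) t path_mem by (auto simp: \<Gamma>_def)
      moreover have "nrm (\<gamma> t) \<le> R0" using R0[OF t] by simp
      ultimately have "E (\<gamma>' t) \<le> E (\<gamma> t) - real k * h / 2"
        using iter[of "\<gamma> t" k] by (auto simp: \<gamma>'_def)
      then have "E (\<gamma>' t) < c - \<eta>" using El h(3) by simp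
      then show False using \<open>\<not> E (\<gamma>' t) \<le> b\<close> \<eta> by (simp add: b_def)
    qed
    then have "M \<gamma>' \<le> b" unfolding M_def by (intro cSUP_least) auto
    then show False using c_le[OF \<gamma>'] \<eta> by (simp add: b_def)
  qed
  have "\<exists>u\<in>S. \<bar>E u - c\<bar> \<le> inverse (real (Suc n)) \<and> nrm (G u) < inverse (real (Suc n))" for n
    by (rule PS) simp
  then obtain X where X: "\<And>n. X n \<in> S" "\<And>n. \<bar>E (X n) - c\<bar> \<le> inverse (real (Suc n))"
      "\<And>n. nrm (G (X n)) < inverse (real (Suc n))" by metis
  have "(\<lambda>n. E (X n) - c) \<longlonglongrightarrow> 0"
    by (rule Lim_null_comparison[OF _ LIMSEQ_inverse_real_of_nat]) (use X(2) in simp)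
  then have E: "(\<lambda>n. E (X n)) \<longlonglongrightarrow> c" by (simp add: LIM_zero_iff)
  have "(\<lambda>n. nrm (G (X n))) \<longlonglongrightarrow> 0"
    by (rule Lim_null_comparison[OF _ LIMSEQ_inverse_real_of_nat])
      (use X(3) G(1)[OF X(1)] nrm_nonneg in \<open>auto simp: less_imp_le\<close>)
  from Palais_Smale[OF X(1) E this] show ?thesis using c_\<alpha> by auto
qed

end

section \<open>Lebesgue measure and the fractional kernel\<close>

lemma nn_integral_lborel_translate:
  fixes f :: "'a::euclidean_space \<Rightarrow> ennreal"
  assumes [measurable]: "f \<in> borel_measurable borel"
  shows "(\<integral>\<^sup>+x. f (c + x) \<partial>lborel) = (\<integral>\<^sup>+x. f x \<partial>lborel)"
proof -
  have "(\<integral>\<^sup>+x. f x \<partial>lborel) = (\<integral>\<^sup>+x. f x \<partial>distr lborel borel ((+) c))"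
    by (simp add: lborel_distr_plus)
  also have "\<dots> = (\<integral>\<^sup>+x. f (c + x) \<partial>lborel)"
    by (subst nn_integral_distr) auto
  finally show ?thesis by simp
qed

text \<open>Uniqueness of Haar measure, specialised: the pushforward is translation invariant and
  agrees with Lebesgue measure on balls.\<close>

lemma distr_lborel_orthogonal:
  fixes T :: "'a::euclidean_space \<Rightarrow> 'a"
  assumes T: "orthogonal_transformation T"
  shows "distr lborel borel T = lborel"
proof (rule measure_eqI)
  have lin: "linear T" and bT: "bij T"
    using T by (auto simp: orthogonal_transformation_linear orthogonal_transformation_bij)
  have [measurable]: "T \<in> borel_measurable borel"
    using lin by (intro borel_measurable_continuous_onI linear_continuous_on linear_linear[THEN iffD2])
  show "sets (distr lborel borel T) = sets lborel" by simp
  fix A assume "A \<in> sets (distr lborel borel T)"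
  then have A [measurable]: "A \<in> sets borel" by simp
  let ?B = "ball (0::'a) 1"
  have [measurable]: "?B \<in> sets borel" by simp
  define b where "b = emeasure lborel ?B"
  have "unit_ball_vol (real DIM('a)) > 0" by simp
  then have p: "unit_ball_vol (real DIM('a)) \<noteq> 0" by linarith
  have b: "b \<noteq> 0" "b \<noteq> \<infinity>"
    using p by (auto simp: b_def emeasure_ball)
  \<comment> \<open>Only here the isometry enters: the preimage of a unit ball under
    \<open>T\<close> is again a unit ball.\<close>
  have b_shift: "(\<integral>\<^sup>+x. indicator ?B (y - T x) \<partial>lborel) = b" for y
  proof -
    obtain y' where y': "y = T y'" using bT by (metis bij_pointE)
    have "norm (y - T x) = dist y' x" for x
      using T lin by (simp add: y' dist_norm orthogonal_transformation_norm flip: linear_diff)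
    then have "indicator ?B (y - T x) = (indicator (ball y' 1) x :: ennreal)" for x
      by (auto simp: indicator_def)
    then have "(\<integral>\<^sup>+x. indicator ?B (y - T x) \<partial>lborel) = emeasure lborel (ball y' 1)" by simp
    then show ?thesis by (simp add: b_def emeasure_ball)
  qed
  have inv: "(\<integral>\<^sup>+x. indicator A (T x) \<partial>lborel) = (\<integral>\<^sup>+x. indicator A (T x + y) \<partial>lborel)" for y
  proof -
    obtain y' where y': "y = T y'" using bT by (metis bij_pointE)
    have "(\<integral>\<^sup>+x. indicator A (T x) \<partial>lborel) = (\<integral>\<^sup>+x. indicator A (T (y' + x)) \<partial>lborel)"
      by (rule nn_integral_lborel_translate[symmetric, where f = "\<lambda>x. indicator A (T x)"]) simp
    then show ?thesis by (simp add: y' linear_add[OF lin] add.commute)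
  qed
  have "emeasure (distr lborel borel T) A * b = (\<integral>\<^sup>+x. indicator A (T x) \<partial>lborel) * b"
  proof -
    have "emeasure (distr lborel borel T) A = (\<integral>\<^sup>+x. indicator A x \<partial>distr lborel borel T)" by simp
    also have "\<dots> = (\<integral>\<^sup>+x. indicator A (T x) \<partial>lborel)" by (subst nn_integral_distr) auto
    finally show ?thesis by simp
  qed
  \<comment> \<open>Averaging over the ball and exchanging integrals moves the shift by
    \<open>T x\<close> from \<open>A\<close> to the ball, where \<open>b_shift\<close> makes the
    inner integral constant. The factor \<open>b\<close> cancels, being positive and finite.\<close>
  also have "\<dots> = (\<integral>\<^sup>+y. (\<integral>\<^sup>+x. indicator A (T x) \<partial>lborel) * indicator ?B y \<partial>lborel)"
    by (subst nn_integral_cmult_indicator) (simp_all add: b_def)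
  also have "\<dots> = (\<integral>\<^sup>+y. (\<integral>\<^sup>+x. indicator A (T x + y) * indicator ?B y \<partial>lborel) \<partial>lborel)"
  proof (rule nn_integral_cong)
    fix y
    show "(\<integral>\<^sup>+x. indicator A (T x) \<partial>lborel) * indicator ?B y
        = (\<integral>\<^sup>+x. indicator A (T x + y) * indicator ?B y \<partial>lborel)"
      by (subst nn_integral_multc) (auto simp: inv[of y])
  qed
  also have "\<dots> = (\<integral>\<^sup>+x. (\<integral>\<^sup>+y. indicator A (T x + y) * indicator ?B y \<partial>lborel) \<partial>lborel)"
    by (rule lborel_pair.Fubini') measurable
  also have "\<dots> = (\<integral>\<^sup>+x. (\<integral>\<^sup>+y. indicator A y * indicator ?B (y - T x) \<partial>lborel) \<partial>lborel)"
  proof (rule nn_integral_cong)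
    fix x
    show "(\<integral>\<^sup>+y. indicator A (T x + y) * indicator ?B y \<partial>lborel)
        = (\<integral>\<^sup>+y. indicator A y * indicator ?B (y - T x) \<partial>lborel)"
      using nn_integral_lborel_translate[where c = "T x" and f = "\<lambda>y. indicator A y * indicator ?B (y - T x)"]
      by simp
  qed
  also have "\<dots> = (\<integral>\<^sup>+y. (\<integral>\<^sup>+x. indicator A y * indicator ?B (y - T x) \<partial>lborel) \<partial>lborel)"
    by (rule lborel_pair.Fubini') measurable
  also have "\<dots> = (\<integral>\<^sup>+y. indicator A y * b \<partial>lborel)"
    by (subst nn_integral_cmult) (auto simp: b_shift)
  also have "\<dots> = emeasure lborel A * b"
    by (subst nn_integral_multc) auto
  finally show "emeasure (distr lborel borel T) A = emeasure lborel A"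
    using b by (metis infinity_ennreal_def mult_divide_eq_ennreal)
qed

lemma nn_integral_lborel_orthogonal:
  fixes f :: "'a::euclidean_space \<Rightarrow> ennreal" and T :: "'a \<Rightarrow> 'a"
  assumes T: "orthogonal_transformation T" and [measurable]: "f \<in> borel_measurable borel"
  shows "(\<integral>\<^sup>+x. f (T x) \<partial>lborel) = (\<integral>\<^sup>+x. f x \<partial>lborel)"
proof -
  have [measurable]: "T \<in> borel_measurable borel"
    using orthogonal_transformation_linear[OF T]
    by (intro borel_measurable_continuous_onI linear_continuous_on) (simp add: linear_conv_bounded_linear)
  have "(\<integral>\<^sup>+x. f x \<partial>lborel) = (\<integral>\<^sup>+x. f x \<partial>distr lborel borel T)"
    by (simp add: distr_lborel_orthogonal[OF T])
  also have "\<dots> = (\<integral>\<^sup>+x. f (T x) \<partial>lborel)"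
    by (rule nn_integral_distr) measurable
  finally show ?thesis by simp
qed

section \<open>Integrability of power kernels and the normalising constant\<close>

lemma ennreal_term_le_suminf: "f k \<le> (\<Sum>k. f k :: ennreal)"
  using sum_le_suminf[of f "{k}"] by simp

lemma nn_integral_suminf_cball:
  fixes c r :: "nat \<Rightarrow> real"
  shows "(\<integral>\<^sup>+x. (\<Sum>k. ennreal (c k) * indicator (cball (0::'a::euclidean_space) (r k)) x) \<partial>lborel)
    = (\<Sum>k. ennreal (c k) * emeasure lborel (cball (0::'a) (r k)))"
proof -
  have "(\<integral>\<^sup>+x. ennreal (c k) * indicator (cball (0::'a) (r k)) x \<partial>lborel)
      = ennreal (c k) * emeasure lborel (cball (0::'a) (r k))" for k
    by (rule nn_integral_cmult_indicator) simp
  moreover have "(\<lambda>x. ennreal (c k) * indicator (cball (0::'a) (r k)) x) \<in> borel_measurable lborel" for k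
    by (intro borel_measurable_times_ennreal borel_measurable_indicator borel_measurable_const) simp
  ultimately show ?thesis by (subst nn_integral_suminf) auto
qed

lemma emeasure_lborel_open_pos:
  fixes U :: "'a::euclidean_space set"
  assumes "open U" "U \<noteq> {}"
  shows "emeasure lborel U > 0"
proof -
  obtain x e where "e > 0" "ball x e \<subseteq> U"
    using assms by (meson all_not_in_conv open_contains_ball)
  then have "emeasure lborel (ball x e) \<le> emeasure lborel U"
    using assms by (intro emeasure_mono) auto
  moreover have "emeasure lborel (ball x e) > 0"
    using \<open>e > 0\<close> by (simp add: emeasure_ball ennreal_zero_less_mult_iff)
  ultimately show ?thesis by (rule less_le_trans[rotated])
qed

text \<open>A substitute for polar coordinates: the integrand is dominated by a sum of constants on
  balls whose weighted volumes form a geometric series.\<close>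

lemma nn_integral_dyadic_finite:
  fixes g :: "'a::euclidean_space \<Rightarrow> real" and c r :: "nat \<Rightarrow> real"
  assumes le: "\<And>x. x \<in> B \<Longrightarrow> \<exists>k. g x \<le> c k \<and> norm x \<le> r k"
    and cr: "\<And>k. c k * r k ^ DIM('a) = A * \<rho> ^ k" and "0 \<le> \<rho>" "\<rho> < 1" "0 \<le> A"
    and nonneg: "\<And>k. 0 \<le> c k" "\<And>k. 0 \<le> r k"
  shows "(\<integral>\<^sup>+x\<in>B. ennreal (g x) \<partial>lborel) < \<infinity>"
proof -
  let ?\<omega> = "unit_ball_vol (real DIM('a))"
  have "(\<integral>\<^sup>+x\<in>B. ennreal (g x) \<partial>lborel)
      \<le> (\<integral>\<^sup>+x. (\<Sum>k. ennreal (c k) * indicator (cball (0::'a) (r k)) x) \<partial>lborel)"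
  proof (rule nn_integral_mono)
    fix x :: 'a
    show "ennreal (g x) * indicator B x \<le> (\<Sum>k. ennreal (c k) * indicator (cball (0::'a) (r k)) x)"
    proof (cases "x \<in> B")
      case True
      then obtain k where k: "g x \<le> c k" "norm x \<le> r k" using le by blast
      then have "ennreal (g x) * indicator B x \<le> ennreal (c k) * indicator (cball (0::'a) (r k)) x"
        using True by (simp add: ennreal_leI)
      also have "\<dots> \<le> (\<Sum>k. ennreal (c k) * indicator (cball (0::'a) (r k)) x)"
        by (rule ennreal_term_le_suminf)
      finally show ?thesis .
    qed simp
  qed
  also have "\<dots> = (\<Sum>k. ennreal (c k) * emeasure lborel (cball (0::'a) (r k)))"
    by (rule nn_integral_suminf_cball)
  also have "\<dots> = (\<Sum>k. ennreal (?\<omega> * A * \<rho> ^ k))"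
  proof (rule suminf_cong)
    fix k
    have "ennreal (c k) * emeasure lborel (cball (0::'a) (r k)) = ennreal (c k * (?\<omega> * r k ^ DIM('a)))"
      using nonneg by (simp add: emeasure_cball ennreal_mult)
    also have "c k * (?\<omega> * r k ^ DIM('a)) = ?\<omega> * A * \<rho> ^ k"
      using cr[of k] by (simp add: mult.left_commute mult.assoc)
    finally show "ennreal (c k) * emeasure lborel (cball (0::'a) (r k)) = ennreal (?\<omega> * A * \<rho> ^ k)" .
  qed
  also have "\<dots> = ennreal (\<Sum>k. ?\<omega> * A * \<rho> ^ k)"
    using assms(3-5) by (intro suminf_ennreal_eq summable_sums summable_mult summable_geometric) auto
  finally show ?thesis by (simp add: le_less_trans)
qed

text \<open>The dyadic series has ratio 2^(a-N), which is below 1 because a < N.\<close>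

lemma nn_integral_powr_ball:
  fixes a :: real
  assumes a: "0 \<le> a" "a < DIM('a::euclidean_space)"
  shows "(\<integral>\<^sup>+x\<in>cball (0::'a) 1 - {0}. ennreal (norm x powr - a) \<partial>lborel) < \<infinity>"
proof (rule nn_integral_dyadic_finite)
  let ?N = "real DIM('a)"
  fix x :: 'a assume x: "x \<in> cball 0 1 - {0}"
  \<comment> \<open>The index of the shell 2^(-k-1) < |x| \<le> 2^(-k).\<close>
  define k where "k = nat \<lfloor>- log 2 (norm x)\<rfloor>"
  have "- log 2 (norm x) \<ge> 0" using x by simp
  then have k: "real k \<le> - log 2 (norm x)" "- log 2 (norm x) < real k + 1"
    unfolding k_def by linarith+
  have xk: "norm x = 2 powr (log 2 (norm x))" using x by simp
  have "norm x \<le> 2 powr (- real k)" by (subst xk) (use k in simp)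
  moreover have "norm x powr - a = 2 powr (log 2 (norm x) * - a)" by (subst xk) (simp only: powr_powr)
  moreover have "\<dots> \<le> 2 powr (a * real (k + 1))"
    using k a mult_left_mono[of "- log 2 (norm x)" "real k + 1" a] by (simp add: algebra_simps)
  ultimately show "\<exists>k. norm x powr - a \<le> 2 powr (a * real (k + 1)) \<and> norm x \<le> 2 powr (- real k)"
    by (intro exI[of _ k]) simp
next
  show "2 powr (a * real (k + 1)) * (2 powr (- real k)) ^ DIM('a) = 2 powr a * (2 powr (a - real DIM('a))) ^ k" for k
    by (simp add: powr_powr algebra_simps flip: powr_realpow powr_add)
qed (use a powr_less_mono[of "a - real DIM('a)" 0 2] in auto)

text \<open>Here the shells are 2^k \<le> |x| < 2^(k+1) and the ratio is 2^(N-a).\<close>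

lemma nn_integral_powr_outside:
  fixes a :: real
  assumes a: "DIM('a::euclidean_space) < a"
  shows "(\<integral>\<^sup>+x\<in>- ball (0::'a) 1. ennreal (norm x powr - a) \<partial>lborel) < \<infinity>"
proof (rule nn_integral_dyadic_finite)
  fix x :: 'a assume "x \<in> - ball 0 1"
  then have x: "norm x \<ge> 1" "x \<noteq> 0" by auto
  define k where "k = nat \<lfloor>log 2 (norm x)\<rfloor>"
  have "log 2 (norm x) \<ge> 0" using x by (subst zero_le_log_cancel_iff) auto
  then have k: "real k \<le> log 2 (norm x)" "log 2 (norm x) < real k + 1"
    unfolding k_def by linarith+
  have xk: "norm x = 2 powr (log 2 (norm x))" using x by simp
  have "norm x \<le> 2 powr (real (k + 1))" by (subst xk) (use k in simp)
  moreover have "norm x powr - a = 2 powr (log 2 (norm x) * - a)" by (subst xk) (simp only: powr_powr)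
  moreover have "\<dots> \<le> 2 powr (- a * real k)"
    using k a mult_left_mono[of "real k" "log 2 (norm x)" a] by (simp add: algebra_simps)
  ultimately show "\<exists>k. norm x powr - a \<le> 2 powr (- a * real k) \<and> norm x \<le> 2 powr (real (k + 1))"
    by (intro exI[of _ k]) simp
next
  show "2 powr (- a * real k) * (2 powr (real (k + 1))) ^ DIM('a)
      = 2 powr real DIM('a) * (2 powr (real DIM('a) - a)) ^ k" for k
    by (simp add: powr_powr algebra_simps flip: powr_realpow powr_add)
qed (use a powr_less_mono[of "real DIM('a) - a" 0 2] in auto)

text \<open>Near the origin the singularity has order N + 2s - 2 < N, since s < 1; at infinity the
  decay has order N + 2s > N. The bound serves both the constant C(N,s) and the finiteness of the
  energy of a test function.\<close>

lemma nn_integral_Levy_kernel: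
  assumes "2 \<le> CARD('n::finite)" "0 < s" "s < 1"
  shows "(\<integral>\<^sup>+z. ennreal (min 1 ((norm z)\<^sup>2) / norm (z::real^'n) powr (dimN TYPE('n) + 2 * s)) \<partial>lborel) < \<infinity>"
proof -
  let ?N = "real CARD('n)"
  have meas: "(\<lambda>z::real^'n. ennreal (norm z powr c) * indicator A z) \<in> borel_measurable lborel"
    if [measurable]: "A \<in> sets borel" for c A
    by measurable
  have "(\<integral>\<^sup>+z. ennreal (min 1 ((norm z)\<^sup>2) / norm (z::real^'n) powr (dimN TYPE('n) + 2 * s)) \<partial>lborel)
      \<le> (\<integral>\<^sup>+z. ennreal (norm z powr - (?N + 2 * s - 2)) * indicator (cball (0::real^'n) 1 - {0}) z
          + ennreal (norm z powr - (?N + 2 * s)) * indicator (- ball (0::real^'n) 1) z \<partial>lborel)"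
  proof (rule nn_integral_mono)
    fix z :: "real^'n"
    show "ennreal (min 1 ((norm z)\<^sup>2) / norm z powr (dimN TYPE('n) + 2 * s))
      \<le> ennreal (norm z powr - (?N + 2 * s - 2)) * indicator (cball 0 1 - {0}) z
          + ennreal (norm z powr - (?N + 2 * s)) * indicator (- ball 0 1) z"
    proof (cases "z = 0")
      case False
      have "- (?N + 2 * s - 2) = 2 - (?N + 2 * s)" by simp
      then have "(norm z)\<^sup>2 / norm z powr (?N + 2 * s) = norm z powr - (?N + 2 * s - 2)"
        using \<open>z \<noteq> 0\<close> by (simp only:) (simp add: powr_diff)
      then have "norm z \<le> 1 \<Longrightarrow> min 1 ((norm z)\<^sup>2) / norm z powr (?N + 2 * s) = norm z powr - (?N + 2 * s - 2)"
        by (simp add: power_le_one min_absorb2)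
      moreover have "norm z > 1 \<Longrightarrow> min 1 ((norm z)\<^sup>2) / norm z powr (?N + 2 * s) = norm z powr - (?N + 2 * s)"
        unfolding powr_minus_divide by (simp add: min_absorb1)
      ultimately show ?thesis
        by (cases "norm z \<le> 1") (simp_all add: dimN_def indicator_def split del: if_split)
    qed simp
  qed
  also have "\<dots> = (\<integral>\<^sup>+z\<in>cball (0::real^'n) 1 - {0}. ennreal (norm z powr - (?N + 2 * s - 2)) \<partial>lborel)
      + (\<integral>\<^sup>+z\<in>- ball (0::real^'n) 1. ennreal (norm z powr - (?N + 2 * s)) \<partial>lborel)"
    by (rule nn_integral_add) (rule meas, simp)+
  also have "\<dots> < \<infinity>"
    using nn_integral_powr_ball[where 'a = "real^'n", of "?N + 2 * s - 2"]
      nn_integral_powr_outside[where 'a = "real^'n", of "?N + 2 * s"] assms by simp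
  finally show ?thesis .
qed

text \<open>A Bochner integral defaults to 0 and so does \<open>inverse 0\<close>, hence
  integrability and strict positivity must both be shown. The first follows from 1 - cos t \<le> min
  2 (t^2), the second because the integrand is positive on an open slab.\<close>

lemma CNs_pos:
  assumes "2 \<le> CARD('n::finite)" "0 < s" "s < 1"
  shows "CNs TYPE('n) s > 0"
proof -
  define i :: 'n where "i = (SOME i. True)"
  define g where "g \<zeta> = (1 - cos (\<zeta> $ i)) / norm \<zeta> powr (dimN TYPE('n) + 2 * s)" for \<zeta> :: "real^'n"
  have [measurable]: "g \<in> borel_measurable borel"
    unfolding g_def by measurable
  have g0: "g \<zeta> \<ge> 0" for \<zeta> by (simp add: g_def)
  have le: "g \<zeta> \<le> 2 * (min 1 ((norm \<zeta>)\<^sup>2) / norm \<zeta> powr (dimN TYPE('n) + 2 * s))" for \<zeta>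
  proof -
    have "1 - cos t \<le> t\<^sup>2 / 2" for t :: real
    proof -
      have "1 - cos t = 2 * (sin (t / 2))\<^sup>2" using cos_double_sin[of "t/2"] by simp
      also have "(sin (t / 2))\<^sup>2 \<le> (t / 2)\<^sup>2"
        unfolding abs_le_square_iff[symmetric] by (rule abs_sin_x_le_abs_x)
      finally show ?thesis by (simp add: power_divide)
    qed
    from this[of "\<zeta> $ i"] have "1 - cos (\<zeta> $ i) \<le> (\<zeta> $ i)\<^sup>2" using zero_le_power2[of "\<zeta> $ i"] by linarith
    also have "\<dots> \<le> (norm \<zeta>)\<^sup>2" using component_le_norm_cart[of \<zeta> i]
      by (metis abs_le_square_iff abs_norm_cancel)
    finally have "1 - cos (\<zeta> $ i) \<le> 2 * min 1 ((norm \<zeta>)\<^sup>2)"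
      using cos_ge_minus_one[of "\<zeta> $ i"] zero_le_power2[of "norm \<zeta>"] by linarith
    then show ?thesis unfolding g_def times_divide_eq_right by (intro divide_right_mono) auto
  qed
  have "(\<integral>\<^sup>+\<zeta>. ennreal (g \<zeta>) \<partial>lborel) \<le> (\<integral>\<^sup>+\<zeta>. ennreal 2 * ennreal (min 1 ((norm \<zeta>)\<^sup>2) / norm (\<zeta>::real^'n) powr (dimN TYPE('n) + 2 * s)) \<partial>lborel)"
  proof (rule nn_integral_mono)
    fix \<zeta> :: "real^'n"
    have "ennreal (g \<zeta>) \<le> ennreal (2 * (min 1 ((norm \<zeta>)\<^sup>2) / norm \<zeta> powr (dimN TYPE('n) + 2 * s)))"
      by (rule ennreal_leI[OF le])
    then show "ennreal (g \<zeta>) \<le> ennreal 2 * ennreal (min 1 ((norm \<zeta>)\<^sup>2) / norm \<zeta> powr (dimN TYPE('n) + 2 * s))"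
      by (subst ennreal_mult'[symmetric]) auto
  qed
  also have "\<dots> = ennreal 2 * (\<integral>\<^sup>+\<zeta>. ennreal (min 1 ((norm \<zeta>)\<^sup>2) / norm (\<zeta>::real^'n) powr (dimN TYPE('n) + 2 * s)) \<partial>lborel)"
    by (rule nn_integral_cmult) measurable
  also have "\<dots> < \<infinity>"
    using nn_integral_Levy_kernel[OF assms] by (simp add: ennreal_mult_less_top)
  finally have int: "integrable lborel g"
    using g0 by (intro integrableI_nonneg) auto
  have "integral\<^sup>L lborel g \<noteq> 0"
  proof
    assume "integral\<^sup>L lborel g = 0"
    then have "AE \<zeta> in lborel. g \<zeta> = 0"
      using integral_nonneg_eq_0_iff_AE[OF int] g0 by simp
    then have "AE \<zeta> in lborel. \<zeta> \<notin> {\<zeta>::real^'n. 0 < \<zeta> $ i \<and> \<zeta> $ i < 1}"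
    proof eventually_elim
      case (elim \<zeta>)
      show ?case
      proof
        assume "\<zeta> \<in> {\<zeta>::real^'n. 0 < \<zeta> $ i \<and> \<zeta> $ i < 1}"
        then have z: "0 < \<zeta> $ i" "\<zeta> $ i < 1" by auto
        then have "\<zeta> \<noteq> 0" by auto
        moreover have "cos (\<zeta> $ i) < cos 0" using z pi_gt3 by (intro cos_monotone_0_pi) auto
        ultimately show False using elim by (simp add: g_def)
      qed
    qed
    moreover have op: "open {\<zeta>::real^'n. 0 < \<zeta> $ i \<and> \<zeta> $ i < 1}"
      by (intro open_Collect_conj open_Collect_less continuous_intros)
    ultimately have "emeasure lborel {\<zeta>::real^'n. 0 < \<zeta> $ i \<and> \<zeta> $ i < 1} = 0"
      by (subst (asm) AE_iff_measurable) (auto intro: borel_open)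
    moreover have "{\<zeta>::real^'n. 0 < \<zeta> $ i \<and> \<zeta> $ i < 1} \<noteq> {}"
      by (auto intro!: exI[of _ "\<chi> j. 1/2"])
    ultimately show False using emeasure_lborel_open_pos[OF op] by simp
  qed
  moreover have "integral\<^sup>L lborel g \<ge> 0" using g0 by simp
  ultimately have "integral\<^sup>L lborel g > 0" by simp
  moreover have "CNs TYPE('n) s = inverse (integral\<^sup>L lborel g)"
    unfolding CNs_def g_def i_def ..
  ultimately show ?thesis by simp
qed

section \<open>The fractional Sobolev inequality\<close>

text \<open>The parameter \<open>n\<close> only carries the dimension; \<open>N\<close> is a parameter so that constants
  depending on the dimension have no hidden type variable.\<close>

locale frac =
  fixes n :: "'n::finite itself" and s N :: real
  assumes N_def: "N = real CARD('n)" and N2: "CARD('n) \<ge> 2" and s_gt: "1/2 < s" and s_less: "s < 1"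
begin

definition p :: real where "p = 2 * N / (N - 2 * s)"

definition \<omega> :: real where "\<omega> = unit_ball_vol N"

definition vol :: "real \<Rightarrow> real" where "vol r = \<omega> * r powr N"

text \<open>On the diagonal the quotient is 0 / 0, which evaluates to 0.\<close>

definition gk :: "(real^'n \<Rightarrow> real) \<Rightarrow> real^'n \<Rightarrow> real^'n \<Rightarrow> real" where
  "gk u x y = (u x - u y)\<^sup>2 / norm (x - y) powr (N + 2 * s)"

text \<open>The square of a nonlocal gradient at the point \<open>x\<close>; its finiteness will
  play the role of \<open>x\<close> being a Lebesgue point.\<close>

definition Dsq :: "(real^'n \<Rightarrow> real) \<Rightarrow> real^'n \<Rightarrow> ennreal" where
  "Dsq u x = (\<integral>\<^sup>+y. ennreal (gk u x y) \<partial>lborel)"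

definition Gag :: "(real^'n \<Rightarrow> real) \<Rightarrow> real" where
  "Gag u = enn2real (gagliardo_int s u)"

definition Lp :: "(real^'n \<Rightarrow> real) \<Rightarrow> real" where
  "Lp u = enn2real (\<integral>\<^sup>+x. ennreal (\<bar>u x\<bar> powr p) \<partial>lborel)"

lemma N_ge: "N \<ge> 2" using N2 by (simp add: N_def)
lemma s_pos: "s > 0" using s_gt by simp
lemma \<omega>_pos: "\<omega> > 0" using N_ge by (simp add: \<omega>_def)
lemma N2s: "N - 2 * s > 0" using N_ge s_less by linarith
lemma p_pos: "p > 0" using N2s N_ge by (simp add: p_def)
lemma p_gt2: "p > 2" using N2s s_pos by (simp add: p_def field_simps)
lemma two_p: "2 / p = 1 - 2 * s / N" using N_ge by (simp add: p_def diff_divide_distrib)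
lemma vol_pos: "r > 0 \<Longrightarrow> vol r > 0" using \<omega>_pos by (simp add: vol_def)
lemma emeasure_ball_vol: "r \<ge> 0 \<Longrightarrow> emeasure lborel (ball (x::real^'n) r) = ennreal (vol r)"
  by (cases "r = 0") (simp_all add: emeasure_ball vol_def \<omega>_def flip: N_def powr_realpow)

lemma crit_exp_p: "crit_exp TYPE('n) s = p"
  by (simp add: crit_exp_def p_def dimN_def flip: N_def)

lemma gk_nonneg: "gk u x y \<ge> 0"
  by (simp add: gk_def)

lemma gk_measurable [measurable (raw)]:
  assumes [measurable]: "u \<in> borel_measurable borel" "f \<in> M \<rightarrow>\<^sub>M borel" "g \<in> M \<rightarrow>\<^sub>M borel"
  shows "(\<lambda>x. gk u (f x) (g x)) \<in> borel_measurable M"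
  unfolding gk_def by measurable

lemma gagliardo_gk: "gagliardo_int s u = (\<integral>\<^sup>+q. ennreal (gk u (fst q) (snd q)) \<partial>(lborel \<Otimes>\<^sub>M lborel))"
  by (simp add: gagliardo_int_def gk_def dimN_def flip: N_def)

lemma gagliardo_Dsq:
  assumes [measurable]: "u \<in> borel_measurable borel"
  shows "gagliardo_int s u = (\<integral>\<^sup>+x. Dsq u x \<partial>lborel)"
  unfolding gagliardo_gk Dsq_def
  by (subst lborel.nn_integral_fst[symmetric]) (auto simp: case_prod_beta)

lemma Dsq_measurable [measurable]:
  assumes [measurable]: "u \<in> borel_measurable borel"
  shows "Dsq u \<in> borel_measurable borel"
  unfolding Dsq_def[abs_def] by measurable

lemma HdotD:
  assumes "u \<in> Hdot s"
  shows "u \<in> borel_measurable borel" "gagliardo_int s u = ennreal (Gag u)"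
    "(\<integral>\<^sup>+x. ennreal (\<bar>u x\<bar> powr p) \<partial>lborel) = ennreal (Lp u)"
  using assms by (auto simp: Hdot_def Gag_def Lp_def crit_exp_p)

lemma Gag_nonneg: "Gag u \<ge> 0" and Lp_nonneg: "Lp u \<ge> 0"
  by (auto simp: Gag_def Lp_def)

lemma Dsq_finite_AE:
  assumes "u \<in> Hdot s"
  shows "AE x in lborel. Dsq u x < \<infinity>"
proof -
  note [measurable] = HdotD(1)[OF assms]
  have "(\<integral>\<^sup>+x. Dsq u x \<partial>lborel) \<noteq> \<infinity>"
    using HdotD(2)[OF assms] gagliardo_Dsq[of u] by simp
  then have "AE x in lborel. Dsq u x \<noteq> \<infinity>" by (intro nn_integral_noteq_infinite) auto
  then show ?thesis by (simp add: less_top)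
qed

lemma ball_Dsq:
  assumes [measurable]: "u \<in> borel_measurable borel" and "r > 0"
  shows "(\<integral>\<^sup>+y. ennreal ((u x - u y)\<^sup>2) * indicator (ball x r) y \<partial>lborel) \<le> ennreal (r powr (N + 2 * s)) * Dsq u x"
proof -
  have "(\<integral>\<^sup>+y. ennreal ((u x - u y)\<^sup>2) * indicator (ball x r) y \<partial>lborel)
      \<le> (\<integral>\<^sup>+y. ennreal (r powr (N + 2 * s)) * ennreal (gk u x y) \<partial>lborel)"
  proof (rule nn_integral_mono)
    fix y
    show "ennreal ((u x - u y)\<^sup>2) * indicator (ball x r) y \<le> ennreal (r powr (N + 2 * s)) * ennreal (gk u x y)"
    proof (cases "y \<in> ball x r \<and> x \<noteq> y")
      case True
      then have "norm (x - y) powr (N + 2 * s) \<le> r powr (N + 2 * s)"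
        using s_pos N_ge by (intro powr_mono2) (auto simp: dist_norm)
      then have "(u x - u y)\<^sup>2 \<le> r powr (N + 2 * s) * gk u x y"
        using True mult_right_mono[of "norm (x - y) powr (N + 2 * s)" "r powr (N + 2 * s)" "gk u x y"]
        by (simp add: gk_def)
      then show ?thesis using True by (simp add: gk_nonneg ennreal_leI flip: ennreal_mult)
    qed (cases "x = y"; simp)
  qed
  also have "\<dots> = ennreal (r powr (N + 2 * s)) * Dsq u x"
    unfolding Dsq_def by (rule nn_integral_cmult) measurable
  finally show ?thesis .
qed

text \<open>Values below the level \<open>l\<close> are bounded by l^2, values above it by the p-th
  power. The level stays free and is optimised in each application.\<close>

lemma sq_le_powr:
  assumes "l > 0"
  shows "t\<^sup>2 \<le> l\<^sup>2 + l powr (2 - p) * \<bar>t\<bar> powr p"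
proof (cases "\<bar>t\<bar> \<le> l")
  case True
  then have "t\<^sup>2 \<le> l\<^sup>2" using assms by (simp add: abs_le_square_iff[symmetric])
  then show ?thesis by (smt (verit) mult_nonneg_nonneg powr_ge_zero)
next
  case False
  then have t: "\<bar>t\<bar> > 0" using assms by simp
  have "t\<^sup>2 = \<bar>t\<bar> powr (2 - p) * \<bar>t\<bar> powr p"
    using t by (simp flip: powr_add)
  also have "\<dots> \<le> l powr (2 - p) * \<bar>t\<bar> powr p"
    using False assms p_gt2 t by (intro mult_right_mono powr_mono2') auto
  finally show ?thesis by (smt (verit) zero_le_power2)
qed

text \<open>The value at \<open>x\<close> is compared with the values on a ball around
  \<open>x\<close>: differences cost \<open>Dsq u x\<close>, the values themselves are split at
  level \<open>l\<close>.\<close>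

lemma pointwise_sq_bound:
  assumes u: "u \<in> Hdot s" and "r > 0" "l > 0" "d \<ge> 0" "Dsq u x \<le> ennreal d"
  shows "(u x)\<^sup>2 * vol r \<le> 2 * r powr (N + 2 * s) * d + 2 * l\<^sup>2 * vol r + 2 * l powr (2 - p) * Lp u"
proof -
  note [measurable] = HdotD(1)[OF u]
  let ?B = "ball x r"
  have [measurable]: "?B \<in> sets borel" by simp
  have "ennreal ((u x)\<^sup>2 * vol r) = (\<integral>\<^sup>+y. ennreal ((u x)\<^sup>2) * indicator ?B y \<partial>lborel)"
    using assms vol_pos[of r] by (subst nn_integral_cmult_indicator) (auto simp: emeasure_ball_vol ennreal_mult)
  also have "\<dots> \<le> (\<integral>\<^sup>+y. 2 * (ennreal ((u x - u y)\<^sup>2) * indicator ?B y) +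
      (ennreal (2 * l\<^sup>2) * indicator ?B y + ennreal (2 * l powr (2 - p)) * ennreal (\<bar>u y\<bar> powr p)) \<partial>lborel)"
  proof (rule nn_integral_mono)
    fix y
    \<comment> \<open>This square is exactly the gap in the next inequality.\<close>
    have "0 \<le> (u x - 2 * u y)\<^sup>2" by simp
    then have "(u x)\<^sup>2 \<le> 2 * (u x - u y)\<^sup>2 + 2 * (u y)\<^sup>2"
      by (simp add: power2_eq_square algebra_simps)
    also have "\<dots> \<le> 2 * (u x - u y)\<^sup>2 + (2 * l\<^sup>2 + 2 * l powr (2 - p) * \<bar>u y\<bar> powr p)"
      using sq_le_powr[OF \<open>l > 0\<close>, of "u y"] by simp
    finally have "ennreal ((u x)\<^sup>2) \<le> ennreal (2 * (u x - u y)\<^sup>2 + (2 * l\<^sup>2 + 2 * l powr (2 - p) * \<bar>u y\<bar> powr p))"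
      by (rule ennreal_leI)
    also have "\<dots> = 2 * ennreal ((u x - u y)\<^sup>2) + (ennreal (2 * l\<^sup>2) + ennreal (2 * l powr (2 - p)) * ennreal (\<bar>u y\<bar> powr p))"
      by (simp add: ennreal_mult ennreal_plus[symmetric] del: ennreal_plus)
        (simp add: ennreal_mult)
    finally show "ennreal ((u x)\<^sup>2) * indicator ?B y \<le> 2 * (ennreal ((u x - u y)\<^sup>2) * indicator ?B y) +
      (ennreal (2 * l\<^sup>2) * indicator ?B y + ennreal (2 * l powr (2 - p)) * ennreal (\<bar>u y\<bar> powr p))"
      by (cases "y \<in> ?B") auto
  qed
  also have "\<dots> = 2 * (\<integral>\<^sup>+y. ennreal ((u x - u y)\<^sup>2) * indicator ?B y \<partial>lborel) +
      (ennreal (2 * l\<^sup>2) * ennreal (vol r) + ennreal (2 * l powr (2 - p)) * ennreal (Lp u))"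
  proof -
    have "(\<integral>\<^sup>+y. 2 * (ennreal ((u x - u y)\<^sup>2) * indicator ?B y) \<partial>lborel)
        = 2 * (\<integral>\<^sup>+y. ennreal ((u x - u y)\<^sup>2) * indicator ?B y \<partial>lborel)"
      by (rule nn_integral_cmult) measurable
    moreover have "(\<integral>\<^sup>+y. ennreal (2 * l\<^sup>2) * indicator ?B y \<partial>lborel) = ennreal (2 * l\<^sup>2) * ennreal (vol r)"
      using assms by (subst nn_integral_cmult_indicator) (auto simp: emeasure_ball_vol)
    moreover have "(\<integral>\<^sup>+y. ennreal (2 * l powr (2 - p)) * ennreal (\<bar>u y\<bar> powr p) \<partial>lborel)
        = ennreal (2 * l powr (2 - p)) * ennreal (Lp u)"
      unfolding HdotD(3)[OF u, symmetric] by (rule nn_integral_cmult) measurable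
    moreover have "(\<integral>\<^sup>+y. f1 y + (f2 y + f3 y) \<partial>lborel)
        = (\<integral>\<^sup>+y. f1 y \<partial>lborel) + ((\<integral>\<^sup>+y. f2 y \<partial>lborel) + (\<integral>\<^sup>+y. f3 y \<partial>lborel))"
      if [measurable]: "f1 \<in> borel_measurable borel" "f2 \<in> borel_measurable borel" "f3 \<in> borel_measurable borel"
      for f1 f2 f3 :: "real^'n \<Rightarrow> ennreal"
      by (simp add: nn_integral_add)
    ultimately show ?thesis by simp
  qed
  also have "\<dots> \<le> 2 * (ennreal (r powr (N + 2 * s)) * ennreal d) +
      (ennreal (2 * l\<^sup>2) * ennreal (vol r) + ennreal (2 * l powr (2 - p)) * ennreal (Lp u))"
    using assms by (intro add_right_mono mult_left_mono order_trans[OF ball_Dsq]) auto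
  also have "\<dots> = ennreal (2 * r powr (N + 2 * s) * d + 2 * l\<^sup>2 * vol r + 2 * l powr (2 - p) * Lp u)"
    using assms vol_pos[of r] Lp_nonneg by (simp add: ennreal_mult[symmetric] ennreal_plus[symmetric] ac_simps del: ennreal_plus)
       (simp add: ennreal_mult ac_simps flip: ennreal_numeral)
  finally show ?thesis
    using assms vol_pos[of r] Lp_nonneg by (subst (asm) ennreal_le_iff) auto
qed

text \<open>Radius and level are chosen so that the three terms of the previous bound scale alike.
  What matters is that the result is linear in \<open>d\<close>, so that it can be integrated in
  \<open>x\<close>.\<close>

lemma pointwise_powr_bound:
  assumes u: "u \<in> Hdot s" and "Lp u > 0" "d > 0" "Dsq u x \<le> ennreal d"
  shows "\<bar>u x\<bar> powr p \<le> (4 + 4 / \<omega>) powr (p / 2) * Lp u powr (2 * s / N) * d"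
proof -
  define A where "A = Lp u"
  have A: "A > 0" using assms by (simp add: A_def)
  \<comment> \<open>With Q as below, this radius gives r^(2s) d = Q, and the level l with l^2 = Q
    satisfies l^(2-p) A = Q r^N. All terms are then multiples of Q r^N.\<close>
  define r where "r = A powr (2 / (p * N)) * d powr (- 1 / N)"
  have r: "r > 0" using A assms by (simp add: r_def)
  define Q where "Q = A powr (2 * s / N * (2 / p)) * d powr (2 / p)"
  have Q: "Q > 0" using A assms by (simp add: Q_def)
  define l where "l = sqrt Q"
  have l: "l > 0" "l\<^sup>2 = Q" using Q by (auto simp: l_def)
  have N0: "N > 0" using N_ge by simp
  have rN: "r powr N = A powr (2 / p) * d powr (- 1)"
    using N0 A assms p_pos by (simp add: r_def powr_mult powr_powr)
  have r2s: "r powr (2 * s) * d = Q"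
  proof -
    have "r powr (2 * s) = A powr (2 * s / N * (2 / p)) * d powr (- (2 * s / N))"
      using A assms by (simp add: r_def powr_mult powr_powr field_simps)
    then have "r powr (2 * s) * d = A powr (2 * s / N * (2 / p)) * (d powr (- (2 * s / N)) * d powr 1)"
      using assms by simp
    also have "d powr (- (2 * s / N)) * d powr 1 = d powr (2 / p)"
      unfolding two_p powr_add[symmetric] by simp
    finally show ?thesis by (simp add: Q_def)
  qed
  have lp: "l powr (2 - p) * A = Q * r powr N"
  proof -
    have lQ: "l = Q powr (1/2)" using Q by (simp add: l_def powr_half_sqrt)
    have "2 * s / N * (2 / p) * (1/2 * - p) = - (2 * s / N)" using p_pos by simp
    then have e1: "2 * s / N * (2 / p) * (1/2 * - p) + 1 = 2 / p" by (simp add: two_p)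
    have e2: "2 / p * (1/2 * - p) = - 1" using p_pos by simp
    have "l powr (2 - p) = Q * Q powr (1/2 * - p)"
    proof -
      have "1/2 * (2 - p) = 1 + 1/2 * - p" by (simp add: field_simps)
      then show ?thesis using Q unfolding lQ powr_powr by (simp only: powr_add) simp
    qed
    moreover have "Q powr (1/2 * - p) * A = r powr N"
    proof -
      have "Q powr (1/2 * - p) * A = A powr (2 * s / N * (2 / p) * (1/2 * - p)) * A powr 1 * d powr (2 / p * (1/2 * - p))"
        using A assms by (simp add: Q_def powr_mult powr_powr)
      also have "\<dots> = A powr (2 / p) * d powr (- 1)"
        unfolding e2 powr_add[symmetric] e1 ..
      finally show ?thesis using rN by simp
    qed
    ultimately show ?thesis by simp
  qed
  have "(u x)\<^sup>2 * vol r \<le> 2 * r powr (N + 2 * s) * d + 2 * l\<^sup>2 * vol r + 2 * l powr (2 - p) * Lp u"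
    using assms r l by (intro pointwise_sq_bound) auto
  also have "\<dots> = 2 * r powr N * (r powr (2 * s) * d) + 2 * Q * vol r + 2 * (l powr (2 - p) * A)"
    by (simp add: powr_add A_def l(2))
  also have "\<dots> = (2 + 4 / \<omega>) * Q * vol r"
    using \<omega>_pos r unfolding r2s lp by (simp add: vol_def field_simps)
  finally have "(u x)\<^sup>2 \<le> (2 + 4 / \<omega>) * Q" using vol_pos[OF r] by simp
  also have "\<dots> \<le> (4 + 4 / \<omega>) * Q" using Q by simp
  finally have *: "(u x)\<^sup>2 \<le> (4 + 4 / \<omega>) * Q" .
  have "\<bar>u x\<bar> powr p = ((u x)\<^sup>2) powr (p / 2)"
  proof (cases "u x = 0")
    case False
    then have "(u x)\<^sup>2 = \<bar>u x\<bar> powr 2" by (simp add: powr_numeral)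
    then show ?thesis by (simp only: powr_powr) simp
  qed simp
  also have "\<dots> \<le> ((4 + 4 / \<omega>) * Q) powr (p / 2)" using * p_pos by (intro powr_mono2) auto
  also have "\<dots> = (4 + 4 / \<omega>) powr (p / 2) * Q powr (p / 2)"
    using \<omega>_pos Q by (simp add: powr_mult)
  also have "Q powr (p / 2) = A powr (2 * s / N) * d"
    using A assms p_pos by (simp add: Q_def powr_mult powr_powr)
  finally show ?thesis by (simp add: A_def mult.assoc)
qed

text \<open>Integrating the pointwise bound gives \<open>A \<le> C A\<^bsup>2s/N\<^esup> [u]\<^sup>2\<close> for \<open>A = \<integral>|u|\<^sup>p\<close>,
  and \<open>A\<close> can be absorbed because it is finite for \<^term>\<open>u \<in> Hdot s\<close>.\<close>

lemma Sobolev: "\<exists>C>0. \<forall>u\<in>Hdot s. Lp u powr (2 / p) \<le> C * Gag u"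
proof -
  define C where "C = (4 + 4 / \<omega>) powr (p / 2)"
  have C: "C > 0" using \<omega>_pos by (simp add: C_def add_pos_pos less_imp_neq[symmetric])
  have "Lp u powr (2 / p) \<le> C * Gag u" if u: "u \<in> Hdot s" for u
  proof (cases "Lp u = 0")
    case True
    then show ?thesis using C Gag_nonneg[of u] by simp
  next
    case False
    then have A: "Lp u > 0" using Lp_nonneg[of u] by simp
    note [measurable] = HdotD(1)[OF u]
    define c where "c = C * Lp u powr (2 * s / N)"
    have c: "c > 0" using C A by (simp add: c_def)
    have "ennreal (\<bar>u x\<bar> powr p) \<le> ennreal c * Dsq u x" for x
    proof (cases "Dsq u x")
      case (real d)
      \<comment> \<open>The pointwise bound requires a positive \<open>d\<close>, so
        \<open>d\<close> is enlarged slightly to cover \<open>Dsq u x = 0\<close>.\<close>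
      have "\<bar>u x\<bar> powr p \<le> c * d"
      proof (rule field_le_epsilon)
        fix e :: real assume "e > 0"
        have d': "d + e / c > 0" "Dsq u x \<le> ennreal (d + e / c)"
          using real \<open>e > 0\<close> c by (auto simp: add_nonneg_pos intro!: ennreal_leI)
        have "\<bar>u x\<bar> powr p \<le> c * (d + e / c)"
          using pointwise_powr_bound[OF u A d'] by (simp add: C_def c_def)
        then show "\<bar>u x\<bar> powr p \<le> c * d + e" using c by (simp add: distrib_left)
      qed
      then show ?thesis using real c by (simp add: ennreal_mult[symmetric] ennreal_leI)
    next
      case top
      then show ?thesis using c by (simp add: ennreal_mult_top)
    qed
    then have "(\<integral>\<^sup>+x. ennreal (\<bar>u x\<bar> powr p) \<partial>lborel) \<le> (\<integral>\<^sup>+x. ennreal c * Dsq u x \<partial>lborel)"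
      by (intro nn_integral_mono)
    also have "\<dots> = ennreal c * (\<integral>\<^sup>+x. Dsq u x \<partial>lborel)" by (rule nn_integral_cmult) measurable
    finally have "ennreal (Lp u) \<le> ennreal (c * Gag u)"
      using c Gag_nonneg[of u] by (simp add: HdotD[OF u] gagliardo_Dsq[symmetric] ennreal_mult)
    then have "Lp u \<le> c * Gag u" using c Gag_nonneg[of u] by (subst (asm) ennreal_le_iff) auto
    \<comment> \<open>The exponents add up to 1 by \<open>two_p\<close>, so the second factor,
      positive and finite, cancels.\<close>
    moreover have "Lp u = Lp u powr (2 / p) * Lp u powr (2 * s / N)"
      using A unfolding two_p by (simp flip: powr_add)
    ultimately have "Lp u powr (2 / p) * Lp u powr (2 * s / N) \<le> (C * Gag u) * Lp u powr (2 * s / N)"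
      by (simp add: c_def algebra_simps)
    then show ?thesis using A by simp
  qed
  then show ?thesis using C by blast
qed

end

section \<open>Oscillation and compactness of radial functions\<close>

context frac begin

text \<open>A ball indicator that is jointly measurable in centre and point, as needed for
  integrating over centres.\<close>

definition ib :: "real \<Rightarrow> real^'n \<Rightarrow> real^'n \<Rightarrow> ennreal" where
  "ib r x y = (if dist x y < r then 1 else 0)"

lemma ib_measurable [measurable (raw)]:
  assumes [measurable]: "f \<in> M \<rightarrow>\<^sub>M borel" "g \<in> M \<rightarrow>\<^sub>M borel"
  shows "(\<lambda>x. ib r (f x) (g x)) \<in> borel_measurable M"
  unfolding ib_def by measurable

lemma nn_integral_ib: "r \<ge> 0 \<Longrightarrow> (\<integral>\<^sup>+y. ib r x y \<partial>lborel) = ennreal (vol r)"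
proof -
  assume "r \<ge> 0"
  have "(\<integral>\<^sup>+y. ib r x y \<partial>lborel) = (\<integral>\<^sup>+y. indicator (ball x r) y \<partial>lborel)"
    by (intro nn_integral_cong) (auto simp: ib_def indicator_def)
  then show ?thesis using \<open>r \<ge> 0\<close> by (simp add: emeasure_ball_vol)
qed

definition mean :: "(real^'n \<Rightarrow> real) \<Rightarrow> real^'n \<Rightarrow> real \<Rightarrow> real" where
  "mean u x r = (LINT y|lborel. indicator (ball x r) y * u y) / vol r"

lemma integrable_ball_const: "r \<ge> 0 \<Longrightarrow> integrable lborel (\<lambda>y::real^'n. indicator (ball x r) y * (c::real))"
  by (intro integrable_mult_left integrable_real_indicator) (auto simp: emeasure_ball_vol)

lemma integral_ball_const: "r \<ge> 0 \<Longrightarrow> (LINT y::real^'n|lborel. indicator (ball x r) y * (c::real)) = vol r * c"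
proof -
  assume r: "r \<ge> 0"
  have "(LINT y::real^'n|lborel. indicator (ball x r) y * c) = measure lborel (ball x r) * c"
    by simp
  also have "measure lborel (ball x r) = vol r"
    using r \<omega>_pos by (intro measure_eq_emeasure_eq_ennreal) (auto simp: emeasure_ball_vol vol_def)
  finally show ?thesis .
qed

lemma integrable_Lp:
  fixes u :: "real^'n \<Rightarrow> real"
  shows "u \<in> Hdot s \<Longrightarrow> integrable lborel (\<lambda>y. \<bar>u y\<bar> powr p)"
  using HdotD(1,3)[of u] by (intro integrableI_nonneg) auto

lemma integrable_ball:
  fixes u :: "real^'n \<Rightarrow> real"
  assumes u: "u \<in> Hdot s" and r: "r \<ge> 0"
  shows "integrable lborel (\<lambda>y. indicator (ball x r) y * u y)"
proof -
  note [measurable] = HdotD(1)[OF u]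
  have [measurable]: "ball x r \<in> sets borel" by simp
  have "integrable lborel (\<lambda>y. indicator (ball x r) y * 1 + \<bar>u y\<bar> powr p)"
    by (intro Bochner_Integration.integrable_add integrable_ball_const integrable_Lp assms)
  then show ?thesis
  proof (rule Bochner_Integration.integrable_bound)
    have "\<bar>t\<bar> \<le> 1 + \<bar>t\<bar> powr p" for t :: real
    proof (cases "\<bar>t\<bar> \<le> 1")
      case True
      then show ?thesis using powr_ge_zero[of "\<bar>t\<bar>" p] by linarith
    next
      case False
      then have "\<bar>t\<bar> powr 1 \<le> \<bar>t\<bar> powr p" using p_gt2 by (intro powr_mono) auto
      then show ?thesis using False by simp
    qed
    then show "AE y in lborel. norm (indicator (ball x r) y * u y) \<le> norm (indicator (ball x r) y * 1 + \<bar>u y\<bar> powr p)"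
      by (intro AE_I2) (auto simp: indicator_def)
  qed measurable
qed

text \<open>Jensen's inequality for the square, obtained by integrating the tangent at the mean. If
  the right-hand side is infinite, the claim is trivial.\<close>

lemma mean_sq_le:
  assumes u: "u \<in> Hdot s" and r: "r > 0"
  shows "ennreal ((c - mean u x r)\<^sup>2) * ennreal (vol r) \<le> (\<integral>\<^sup>+y. ennreal ((c - u y)\<^sup>2) * ib r x y \<partial>lborel)"
proof -
  note [measurable] = HdotD(1)[OF u]
  have [measurable]: "ball x r \<in> sets borel" by simp
  define m where "m = mean u x r"
  let ?f = "\<lambda>y. indicator (ball x r) y * (c - u y)\<^sup>2"
  have eq: "(\<integral>\<^sup>+y. ennreal ((c - u y)\<^sup>2) * ib r x y \<partial>lborel) = (\<integral>\<^sup>+y. ennreal (?f y) \<partial>lborel)"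
    by (intro nn_integral_cong) (auto simp: ib_def indicator_def)
  show ?thesis
  proof (cases "(\<integral>\<^sup>+y. ennreal (?f y) \<partial>lborel) = \<infinity>")
    case False
    then have int: "integrable lborel ?f"
      by (intro integrableI_nonneg) (auto simp: less_top)
    \<comment> \<open>The tangent of (c - t)^2 at t = m, evaluated at t = u y. Its linear part
      integrates to 0 around the mean.\<close>
    define h where "h y = indicator (ball x r) y * ((c - m)\<^sup>2 + 2 * (c - m) * m) - (2 * (c - m)) * (indicator (ball x r) y * u y)" for y
    have inth: "integrable lborel h"
      unfolding h_def using r u
      by (intro Bochner_Integration.integrable_diff integrable_ball_const integrable_mult_right integrable_ball) auto
    have "(LINT y|lborel. h y) = vol r * ((c - m)\<^sup>2 + 2 * (c - m) * m) - 2 * (c - m) * (LINT y|lborel. indicator (ball x r) y * u y)"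
    proof -
      have "(LINT y|lborel. h y) = (LINT y|lborel. indicator (ball x r) y * ((c - m)\<^sup>2 + 2 * (c - m) * m))
          - (LINT y|lborel. (2 * (c - m)) * (indicator (ball x r) y * u y))"
        unfolding h_def using r u
        by (intro Bochner_Integration.integral_diff integrable_ball_const integrable_mult_right integrable_ball) auto
      moreover have "(LINT y|lborel. indicator (ball x r) y * ((c - m)\<^sup>2 + 2 * (c - m) * m))
          = vol r * ((c - m)\<^sup>2 + 2 * (c - m) * m)"
        using r by (intro integral_ball_const) simp
      ultimately show ?thesis by (simp only: integral_mult_right_zero)
    qed
    also have "(LINT y|lborel. indicator (ball x r) y * u y) = vol r * m"
      using vol_pos[OF r] by (simp add: m_def mean_def)
    finally have "(LINT y|lborel. h y) = (c - m)\<^sup>2 * vol r" by (simp add: algebra_simps)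
    moreover have "(LINT y|lborel. h y) \<le> (LINT y|lborel. ?f y)"
    proof (rule integral_mono[OF inth int])
      fix y
      have "0 \<le> (u y - m)\<^sup>2" by simp
      then have "(c - m)\<^sup>2 + 2 * (c - m) * m - 2 * (c - m) * u y \<le> (c - u y)\<^sup>2"
        by (simp add: power2_eq_square algebra_simps)
      then show "h y \<le> ?f y" by (auto simp: h_def indicator_def)
    qed
    moreover have "(\<integral>\<^sup>+y. ennreal (?f y) \<partial>lborel) = ennreal (LINT y|lborel. ?f y)"
      by (rule nn_integral_eq_integral[OF int]) simp
    ultimately show ?thesis
      unfolding eq using vol_pos[OF r] by (simp add: m_def ennreal_leI flip: ennreal_mult)
  qed (simp add: eq)
qed

text \<open>Finiteness of \<open>Dsq u x\<close> bounds the squared deviation of the mean from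
  \<open>u x\<close> by a multiple of r^(2s), so \<open>x\<close> is a Lebesgue point with a
  rate.\<close>

lemma mean_tendsto:
  assumes u: "u \<in> Hdot s" and fin: "Dsq u x < \<infinity>"
  shows "(\<lambda>k. mean u x ((1/2) ^ k)) \<longlonglongrightarrow> u x"
proof -
  obtain d where d: "d \<ge> 0" "Dsq u x = ennreal d" using fin by (cases "Dsq u x") auto
  have bound: "(u x - mean u x r)\<^sup>2 \<le> d / \<omega> * r powr (2 * s)" if r: "r > 0" for r
  proof -
    have "ennreal ((u x - mean u x r)\<^sup>2) * ennreal (vol r) \<le> (\<integral>\<^sup>+y. ennreal ((u x - u y)\<^sup>2) * ib r x y \<partial>lborel)"
      by (rule mean_sq_le[OF u r])
    also have "\<dots> = (\<integral>\<^sup>+y. ennreal ((u x - u y)\<^sup>2) * indicator (ball x r) y \<partial>lborel)"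
      by (intro nn_integral_cong) (auto simp: ib_def indicator_def)
    also have "\<dots> \<le> ennreal (r powr (N + 2 * s)) * ennreal d"
      using ball_Dsq[OF HdotD(1)[OF u] r, of x] by (simp add: d)
    finally have "(u x - mean u x r)\<^sup>2 * vol r \<le> r powr (N + 2 * s) * d"
      using vol_pos[OF r] d by (simp flip: ennreal_mult)
    then show ?thesis using r \<omega>_pos by (simp add: vol_def powr_add field_simps)
  qed
  have "(\<lambda>k. ((1/2::real) powr (2 * s)) ^ k) \<longlonglongrightarrow> 0"
    using s_pos powr_less_mono2[of "2 * s" "1/2" 1] by (intro LIMSEQ_realpow_zero) auto
  moreover have "((1/2::real) ^ k) powr (2 * s) = ((1/2) powr (2 * s)) ^ k" for k
    by (simp add: powr_powr mult.commute flip: powr_realpow)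
  ultimately have "(\<lambda>k. ((1/2::real) ^ k) powr (2 * s)) \<longlonglongrightarrow> 0" by simp
  then have "(\<lambda>k. d / \<omega> * ((1/2::real) ^ k) powr (2 * s)) \<longlonglongrightarrow> 0"
    by (rule tendsto_mult_right_zero)
  then have "(\<lambda>k. (u x - mean u x ((1/2) ^ k))\<^sup>2) \<longlonglongrightarrow> 0"
    by (rule Lim_null_comparison[rotated]) (use bound in simp)
  then have "(\<lambda>k. sqrt ((u x - mean u x ((1/2) ^ k))\<^sup>2)) \<longlonglongrightarrow> sqrt 0"
    by (rule tendsto_real_sqrt)
  then have "(\<lambda>k. u x - mean u x ((1/2) ^ k)) \<longlonglongrightarrow> 0"
    by (simp add: tendsto_rabs_zero_iff)
  then have "(\<lambda>k. u x - (u x - mean u x ((1/2) ^ k))) \<longlonglongrightarrow> u x - 0"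
    by (intro tendsto_intros)
  then show ?thesis by simp
qed

text \<open>Jensen's inequality applied twice, once in each variable.\<close>

lemma mean_diff_le:
  assumes u: "u \<in> Hdot s" and r: "r1 > 0" "r2 > 0"
  shows "ennreal ((mean u x1 r1 - mean u x2 r2)\<^sup>2) * ennreal (vol r1 * vol r2) \<le>
    (\<integral>\<^sup>+z. \<integral>\<^sup>+w. ennreal ((u z - u w)\<^sup>2) * ib r1 x1 z * ib r2 x2 w \<partial>lborel \<partial>lborel)"
proof -
  note [measurable] = HdotD(1)[OF u]
  define m2 where "m2 = mean u x2 r2"
  have "ennreal ((mean u x1 r1 - m2)\<^sup>2) * ennreal (vol r1 * vol r2) = ennreal ((m2 - mean u x1 r1)\<^sup>2) * ennreal (vol r1) * ennreal (vol r2)"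
    using vol_pos[OF r(1)] vol_pos[OF r(2)] by (simp add: ennreal_mult power2_commute mult.assoc)
  also have "\<dots> \<le> (\<integral>\<^sup>+z. ennreal ((m2 - u z)\<^sup>2) * ib r1 x1 z \<partial>lborel) * ennreal (vol r2)"
    by (intro mult_right_mono mean_sq_le u r) simp
  also have "\<dots> = (\<integral>\<^sup>+z. ennreal ((m2 - u z)\<^sup>2) * ib r1 x1 z * ennreal (vol r2) \<partial>lborel)"
    by (rule nn_integral_multc[symmetric]) measurable
  also have "\<dots> \<le> (\<integral>\<^sup>+z. \<integral>\<^sup>+w. ennreal ((u z - u w)\<^sup>2) * ib r1 x1 z * ib r2 x2 w \<partial>lborel \<partial>lborel)"
  proof (rule nn_integral_mono)
    fix z
    have "ennreal ((m2 - u z)\<^sup>2) * ib r1 x1 z * ennreal (vol r2) = ib r1 x1 z * (ennreal ((u z - m2)\<^sup>2) * ennreal (vol r2))"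
      by (simp add: power2_commute ac_simps)
    also have "\<dots> \<le> ib r1 x1 z * (\<integral>\<^sup>+w. ennreal ((u z - u w)\<^sup>2) * ib r2 x2 w \<partial>lborel)"
      unfolding m2_def by (intro mult_left_mono mean_sq_le u r) simp
    also have "\<dots> = (\<integral>\<^sup>+w. ib r1 x1 z * (ennreal ((u z - u w)\<^sup>2) * ib r2 x2 w) \<partial>lborel)"
      by (rule nn_integral_cmult[symmetric]) measurable
    finally show "ennreal ((m2 - u z)\<^sup>2) * ib r1 x1 z * ennreal (vol r2) \<le>
      (\<integral>\<^sup>+w. ennreal ((u z - u w)\<^sup>2) * ib r1 x1 z * ib r2 x2 w \<partial>lborel)"
      by (simp add: ac_simps)
  qed
  finally show ?thesis by (simp add: m2_def)
qed

definition energy :: "(real^'n \<Rightarrow> real) \<Rightarrow> real^'n \<Rightarrow> real \<Rightarrow> ennreal" where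
  "energy u x r = (\<integral>\<^sup>+z. \<integral>\<^sup>+w. ennreal (gk u z w) * (ib r x z * ib r x w) \<partial>lborel \<partial>lborel)"

lemma energy_mono: "ball x r \<subseteq> ball x' r' \<Longrightarrow> energy u x r \<le> energy u x' r'"
  unfolding energy_def
  by (intro nn_integral_mono mult_left_mono mult_mono) (auto simp: ib_def subset_eq)

text \<open>An orthogonal map carrying \<open>x\<close> to \<open>x'\<close> preserves the kernel,
  Lebesgue measure and, by radiality, \<open>u\<close>; it is substituted in both integrals.\<close>

lemma energy_rotate:
  assumes u: "u \<in> borel_measurable borel" "radial u" and eq: "norm x = norm x'"
  shows "energy u x r = energy u x' r"
proof -
  note [measurable] = u(1)
  obtain T where T: "orthogonal_transformation T" "T x = x'"
    using orthogonal_transformation_exists[OF eq] by blast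
  have lin: "linear T" and nT: "norm (T z) = norm z" for z
    using T(1) by (auto simp: orthogonal_transformation)
  have dT: "dist (T z) (T w) = dist z w" for z w
    using nT[of "z - w"] by (simp add: dist_norm linear_diff[OF lin])
  have uT: "u (T z) = u z" for z using u(2) nT[of z] unfolding radial_def by blast
  have "energy u x' r = (\<integral>\<^sup>+z. \<integral>\<^sup>+w. ennreal (gk u (T z) w) * (ib r x' (T z) * ib r x' w) \<partial>lborel \<partial>lborel)"
    unfolding energy_def
    by (rule nn_integral_lborel_orthogonal[OF T(1), symmetric,
        where f = "\<lambda>z. \<integral>\<^sup>+w. ennreal (gk u z w) * (ib r x' z * ib r x' w) \<partial>lborel"]) measurable
  also have "\<dots> = (\<integral>\<^sup>+z. \<integral>\<^sup>+w. ennreal (gk u (T z) (T w)) * (ib r x' (T z) * ib r x' (T w)) \<partial>lborel \<partial>lborel)"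
    by (intro nn_integral_cong nn_integral_lborel_orthogonal[OF T(1), symmetric]) measurable
  also have "\<dots> = energy u x r"
    unfolding energy_def T(2)[symmetric] gk_def ib_def dT uT dist_norm[symmetric] ..
  finally show ?thesis by simp
qed

text \<open>A pair of points is counted only by centres within distance \<open>r\<close> of both, a
  set of volume at most \<open>vol r\<close>.\<close>

lemma nn_integral_energy:
  assumes [measurable]: "u \<in> borel_measurable borel" and r: "r \<ge> 0"
  shows "(\<integral>\<^sup>+x. energy u x r \<partial>lborel) \<le> ennreal (vol r) * gagliardo_int s u"
proof -
  have "(\<integral>\<^sup>+x. energy u x r \<partial>lborel)
      = (\<integral>\<^sup>+z. \<integral>\<^sup>+x. \<integral>\<^sup>+w. ennreal (gk u z w) * (ib r x z * ib r x w) \<partial>lborel \<partial>lborel \<partial>lborel)"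
    unfolding energy_def by (rule lborel_pair.Fubini') measurable
  also have "\<dots> = (\<integral>\<^sup>+z. \<integral>\<^sup>+w. \<integral>\<^sup>+x. ennreal (gk u z w) * (ib r x z * ib r x w) \<partial>lborel \<partial>lborel \<partial>lborel)"
    by (intro nn_integral_cong lborel_pair.Fubini') measurable
  also have "\<dots> \<le> (\<integral>\<^sup>+z. \<integral>\<^sup>+w. ennreal (vol r) * ennreal (gk u z w) \<partial>lborel \<partial>lborel)"
  proof (intro nn_integral_mono)
    fix z w
    have "(\<integral>\<^sup>+x. ennreal (gk u z w) * (ib r x z * ib r x w) \<partial>lborel)
        = ennreal (gk u z w) * (\<integral>\<^sup>+x. ib r x z * ib r x w \<partial>lborel)"
      by (rule nn_integral_cmult) measurable
    also have "\<dots> \<le> ennreal (gk u z w) * (\<integral>\<^sup>+x. ib r z x \<partial>lborel)"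
      by (intro mult_left_mono nn_integral_mono) (auto simp: ib_def dist_commute)
    finally show "(\<integral>\<^sup>+x. ennreal (gk u z w) * (ib r x z * ib r x w) \<partial>lborel) \<le> ennreal (vol r) * ennreal (gk u z w)"
      by (simp add: nn_integral_ib[OF r] mult.commute)
  qed
  also have "\<dots> = (\<integral>\<^sup>+z. ennreal (vol r) * Dsq u z \<partial>lborel)"
    unfolding Dsq_def by (intro nn_integral_cong nn_integral_cmult) measurable
  also have "\<dots> = ennreal (vol r) * gagliardo_int s u"
    unfolding gagliardo_Dsq[OF assms(1)] by (rule nn_integral_cmult) measurable
  finally show ?thesis .
qed

text \<open>Radial symmetry: the energy on a small ball is the same for every centre on the sphere,
  so averaging over a shell of width \<open>r\<close> gains a factor \<open>(r / |x|)\<^bsup>N-1\<^esup>\<close>.\<close>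

lemma energy_le:
  assumes u: "u \<in> Hdot s" "radial u" and x: "x \<noteq> 0" and r: "r > 0"
  shows "energy u x r * ennreal (\<omega> * r * norm x powr (N - 1)) \<le> ennreal (vol (2 * r) * Gag u)"
proof -
  note [measurable] = HdotD(1)[OF u(1)]
  define R where "R = norm x"
  have R: "R > 0" using x by (simp add: R_def)
  \<comment> \<open>A shell just outside the sphere through \<open>x\<close>. Its volume is at least
    \<omega> r R^(N-1), the first-order term of (R + r)^N - R^N.\<close>
  define A where "A = ball (0::real^'n) (R + r) - cball 0 R"
  have [measurable]: "A \<in> sets borel" by (simp add: A_def)
  have "emeasure lborel A = emeasure lborel (ball (0::real^'n) (R + r)) - emeasure lborel (cball (0::real^'n) R)"
    unfolding A_def using r R by (intro emeasure_Diff) (auto simp: emeasure_cball)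
  also have "\<dots> = ennreal (\<omega> * ((R + r) ^ CARD('n) - R ^ CARD('n)))"
    using R r \<omega>_pos by (simp add: emeasure_ball emeasure_cball ennreal_minus right_diff_distrib \<omega>_def N_def[symmetric])
  finally have emA: "emeasure lborel A = ennreal (\<omega> * ((R + r) ^ CARD('n) - R ^ CARD('n)))" .
  have "r * R powr (N - 1) \<le> (R + r) ^ CARD('n) - R ^ CARD('n)"
  proof -
    obtain k where k: "CARD('n) = Suc k" using N2 by (cases "CARD('n)") auto
    have "R powr (N - 1) = R ^ k" using R by (simp add: N_def k powr_realpow)
    moreover have "R ^ k \<le> (R + r) ^ k" using R r by (intro power_mono) auto
    then have "(R + r) * R ^ k \<le> (R + r) * (R + r) ^ k" using R r by (intro mult_left_mono) auto
    ultimately show ?thesis by (simp add: k algebra_simps)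
  qed
  then have "ennreal (\<omega> * r * R powr (N - 1)) \<le> emeasure lborel A"
    unfolding emA using \<omega>_pos by (intro ennreal_leI) (simp add: mult.assoc)
  then have "energy u x r * ennreal (\<omega> * r * R powr (N - 1)) \<le> energy u x r * emeasure lborel A"
    by (intro mult_left_mono) auto
  also have "\<dots> = (\<integral>\<^sup>+x'. energy u x r * indicator A x' \<partial>lborel)"
    by (rule nn_integral_cmult_indicator[symmetric]) simp
  also have "\<dots> \<le> (\<integral>\<^sup>+x'. energy u x' (2 * r) \<partial>lborel)"
  proof (rule nn_integral_mono)
    fix x'
    show "energy u x r * indicator A x' \<le> energy u x' (2 * r)"
    proof (cases "x' \<in> A")
      case True
      then have x': "R < norm x'" "norm x' < R + r" by (auto simp: A_def)
      \<comment> \<open>Radial projection to the sphere through \<open>x\<close> moves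
        \<open>x'\<close> by less than \<open>r\<close>; this is why the energies at shell points
        are taken on balls of radius 2r.\<close>
      define y where "y = (R / norm x') *\<^sub>R x'"
      have x'0: "x' \<noteq> 0" using x' R by auto
      have ny: "norm y = norm x" using x' R x'0 by (simp add: y_def R_def)
      have "x' - y = ((norm x' - R) / norm x') *\<^sub>R x'"
        using x'0 by (simp add: y_def scaleR_left_diff_distrib diff_divide_distrib)
      then have "norm (x' - y) = norm x' - R" using x' x'0 by simp
      then have "dist x' y < r" using x' by (simp add: dist_norm)
      have "ball y r \<subseteq> ball x' (2 * r)"
      proof
        fix w assume "w \<in> ball y r"
        then show "w \<in> ball x' (2 * r)"
          using dist_triangle[of x' w y] \<open>dist x' y < r\<close> by simp
      qed
      then have "energy u y r \<le> energy u x' (2 * r)" by (rule energy_mono)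
      then show ?thesis using energy_rotate[OF HdotD(1)[OF u(1)] u(2) ny] True by simp
    qed simp
  qed
  also have "\<dots> \<le> ennreal (vol (2 * r)) * gagliardo_int s u"
    using r by (intro nn_integral_energy) auto
  also have "\<dots> = ennreal (vol (2 * r) * Gag u)"
    using vol_pos[of "2 * r"] r Gag_nonneg[of u] by (simp add: HdotD(2)[OF u(1)] ennreal_mult)
  finally show ?thesis by (simp add: R_def)
qed

text \<open>Combines \<open>mean_diff_le\<close> with the energy bound away from the origin. Radii
  as small as r/4 are allowed, so that both consecutive dyadic balls and balls with different
  centres inside a doubled ball can be compared.\<close>

lemma mean_oscillation:
  assumes "a > 0"
  shows "\<exists>C>0. \<forall>u x x1 x2 r r1 r2. u \<in> Hdot s \<longrightarrow> radial u \<longrightarrow> a \<le> norm x \<longrightarrow> r > 0 \<longrightarrow>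
     ball x1 r1 \<subseteq> ball x r \<longrightarrow> ball x2 r2 \<subseteq> ball x r \<longrightarrow> r / 4 \<le> r1 \<longrightarrow> r / 4 \<le> r2 \<longrightarrow>
     (mean u x1 r1 - mean u x2 r2)\<^sup>2 \<le> C * r powr (2 * s - 1) * Gag u"
proof -
  \<comment> \<open>The factors stem from the kernel at distance below 2r, the volume of the doubled
    ball, and the division by two volumes of balls of radius r/4. The remaining a^(N-1) is the gain
    from the shell.\<close>
  define C where "C = 2 powr (N + 2 * s) * 2 powr N * (4 powr N)\<^sup>2 / (\<omega>\<^sup>2 * a powr (N - 1))"
  have "C > 0" using assms \<omega>_pos by (simp add: C_def)
  moreover have "(mean u x1 r1 - mean u x2 r2)\<^sup>2 \<le> C * r powr (2 * s - 1) * Gag u"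
    if u: "u \<in> Hdot s" "radial u" and x: "a \<le> norm x" and r: "r > 0" and
      b: "ball x1 r1 \<subseteq> ball x r" "ball x2 r2 \<subseteq> ball x r" and r12: "r / 4 \<le> r1" "r / 4 \<le> r2"
    for u x x1 x2 r r1 r2
  proof -
    note [measurable] = HdotD(1)[OF u(1)]
    define q where "q = (mean u x1 r1 - mean u x2 r2)\<^sup>2"
    have x0: "x \<noteq> 0" using x assms by auto
    have r0: "r1 > 0" "r2 > 0" using r r12 by linarith+
    have "ennreal q * ennreal (vol r1 * vol r2) \<le>
      (\<integral>\<^sup>+z. \<integral>\<^sup>+w. ennreal ((u z - u w)\<^sup>2) * ib r1 x1 z * ib r2 x2 w \<partial>lborel \<partial>lborel)"
      unfolding q_def by (rule mean_diff_le[OF u(1) r0])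
    also have "\<dots> \<le> (\<integral>\<^sup>+z. \<integral>\<^sup>+w. ennreal ((2 * r) powr (N + 2 * s)) * (ennreal (gk u z w) * (ib r x z * ib r x w)) \<partial>lborel \<partial>lborel)"
    proof (intro nn_integral_mono)
      fix z w
      show "ennreal ((u z - u w)\<^sup>2) * ib r1 x1 z * ib r2 x2 w \<le>
        ennreal ((2 * r) powr (N + 2 * s)) * (ennreal (gk u z w) * (ib r x z * ib r x w))"
      proof (cases "dist x1 z < r1 \<and> dist x2 w < r2 \<and> z \<noteq> w")
        case True
        then have d: "dist x z < r" "dist x w < r" using b by (auto simp: subset_eq)
        then have "dist z w < 2 * r" using dist_triangle2[of z w x] by (simp add: dist_commute)
        then have "norm (z - w) powr (N + 2 * s) \<le> (2 * r) powr (N + 2 * s)"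
          using s_pos N_ge by (intro powr_mono2) (auto simp: dist_norm)
        then have "(u z - u w)\<^sup>2 \<le> (2 * r) powr (N + 2 * s) * gk u z w"
          using True mult_right_mono[of "norm (z - w) powr (N + 2 * s)" "(2 * r) powr (N + 2 * s)" "gk u z w"]
          by (simp add: gk_def)
        then have "ennreal ((u z - u w)\<^sup>2) \<le> ennreal ((2 * r) powr (N + 2 * s)) * ennreal (gk u z w)"
          by (subst ennreal_mult[symmetric]) (auto simp: gk_nonneg intro: ennreal_leI)
        then show ?thesis using True d by (simp add: ib_def)
      qed (auto simp: ib_def)
    qed
    also have "\<dots> = ennreal ((2 * r) powr (N + 2 * s)) * energy u x r"
      unfolding energy_def
      by (subst nn_integral_cmult[symmetric], measurable, intro nn_integral_cong nn_integral_cmult) measurable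
    finally have 1: "ennreal (q * (vol r1 * vol r2)) \<le> ennreal ((2 * r) powr (N + 2 * s)) * energy u x r"
      using vol_pos[OF r0(1)] vol_pos[OF r0(2)] by (simp add: q_def ennreal_mult)
    define c where "c = \<omega> * r * norm x powr (N - 1)"
    have c: "c > 0" using \<omega>_pos r x0 by (simp add: c_def)
    have "ennreal (q * (vol r1 * vol r2)) * ennreal c \<le> ennreal ((2 * r) powr (N + 2 * s)) * energy u x r * ennreal c"
      using 1 by (intro mult_right_mono) auto
    also have "\<dots> = ennreal ((2 * r) powr (N + 2 * s)) * (energy u x r * ennreal c)"
      by (simp add: mult.assoc)
    also have "\<dots> \<le> ennreal ((2 * r) powr (N + 2 * s)) * ennreal (vol (2 * r) * Gag u)"
      unfolding c_def by (intro mult_left_mono energy_le u x0 r) simp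
    finally have 2: "q * (vol r1 * vol r2) * c \<le> (2 * r) powr (N + 2 * s) * (vol (2 * r) * Gag u)"
      using c vol_pos[OF r0(1)] vol_pos[OF r0(2)] vol_pos[of "2 * r"] r Gag_nonneg[of u]
      by (simp add: q_def flip: ennreal_mult)
    define V where "V = vol (r / 4)"
    have V: "V > 0" using r by (simp add: V_def vol_pos)
    have "V \<le> vol r1" "V \<le> vol r2"
      unfolding V_def vol_def using r r12 \<omega>_pos N_ge by (auto intro!: mult_left_mono powr_mono2)
    then have "V * V \<le> vol r1 * vol r2" using V by (intro mult_mono) auto
    moreover have "\<omega> * r * a powr (N - 1) \<le> c"
      unfolding c_def using x assms \<omega>_pos r N_ge by (intro mult_left_mono powr_mono2) auto
    ultimately have "q * (V * V) * (\<omega> * r * a powr (N - 1)) \<le> q * (vol r1 * vol r2) * c"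
      using V c \<omega>_pos r assms vol_pos[OF r0(1)] vol_pos[OF r0(2)]
      by (intro mult_mono[OF mult_left_mono]) (auto simp: q_def)
    also note 2
    finally have "q * (V * V * (\<omega> * r * a powr (N - 1))) \<le> (2 * r) powr (N + 2 * s) * (vol (2 * r) * Gag u)"
      by (simp add: mult.assoc)
    moreover have "(2 * r) powr (N + 2 * s) * vol (2 * r) = C * r powr (2 * s - 1) * (V * V * (\<omega> * r * a powr (N - 1)))"
    proof -
      have "V * 4 powr N = \<omega> * r powr N" using r by (simp add: V_def vol_def powr_divide)
      then have VV: "V * V * (4 powr N)\<^sup>2 = \<omega>\<^sup>2 * (r powr N)\<^sup>2"
        by (metis power_mult_distrib power2_eq_square)
      have rr: "r powr (N + 2 * s) * r powr N = r powr (2 * s - 1) * r * (r powr N)\<^sup>2"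
        using r by (simp add: powr_add powr_diff power2_eq_square)
      have "C * r powr (2 * s - 1) * (V * V * (\<omega> * r * a powr (N - 1)))
          = 2 powr (N + 2 * s) * 2 powr N * (V * V * (4 powr N)\<^sup>2) / \<omega>\<^sup>2 * \<omega> * (r powr (2 * s - 1) * r)"
        using assms by (simp add: C_def)
      also have "\<dots> = 2 powr (N + 2 * s) * 2 powr N * \<omega> * (r powr (2 * s - 1) * r * (r powr N)\<^sup>2)"
        unfolding VV using \<omega>_pos by simp
      also have "\<dots> = (2 * r) powr (N + 2 * s) * vol (2 * r)"
        unfolding rr[symmetric] using r by (simp add: vol_def powr_mult)
      finally show ?thesis by simp
    qed
    ultimately have "q * (V * V * (\<omega> * r * a powr (N - 1))) \<le> (C * r powr (2 * s - 1) * Gag u) * (V * V * (\<omega> * r * a powr (N - 1)))"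
      by (simp add: algebra_simps)
    moreover have "V * V * (\<omega> * r * a powr (N - 1)) > 0" using V \<omega>_pos r assms by simp
    ultimately show ?thesis unfolding q_def by (metis mult_le_cancel_right_pos)
  qed
  ultimately show ?thesis by blast
qed

end

section \<open>Dyadic averages, Hoelder control and compactness of radial functions\<close>

lemma diagonal_convergent:
  fixes f :: "nat \<Rightarrow> nat \<Rightarrow> real"
  assumes "\<And>i. bounded (range (f i))"
  shows "\<exists>r::nat \<Rightarrow> nat. strict_mono r \<and> (\<forall>i. convergent (\<lambda>n. f i (r n)))"
proof -
  interpret subseqs "\<lambda>i r. convergent (f i \<circ> r)"
  proof
    fix i and r :: "nat \<Rightarrow> nat"
    have "bounded (range (f i \<circ> r))"
      using assms[of i] by (rule bounded_subset) auto
    then obtain l r' where "strict_mono (r' :: nat \<Rightarrow> nat)" "((f i \<circ> r) \<circ> r') \<longlonglongrightarrow> l"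
      using bounded_imp_convergent_subsequence by blast
    then show "\<exists>r'. strict_mono r' \<and> convergent (f i \<circ> (r \<circ> r'))"
      by (auto simp: convergent_def o_assoc)
  qed
  have conv: "convergent (f i \<circ> (diagseq \<circ> (+) (Suc i)))" for i
  proof (rule diagseq_holds)
    fix r t :: "nat \<Rightarrow> nat" and k
    assume "strict_mono r" "convergent (f k \<circ> t)"
    then show "convergent (f k \<circ> (t \<circ> r))"
      using convergent_subseq_convergent[of "f k \<circ> t" r] by (simp add: o_assoc)
  qed
  have "convergent (\<lambda>n. f i (diagseq (n + Suc i)))" for i
    using conv[of i] by (simp add: o_def add.commute)
  then have "convergent (\<lambda>n. f i (diagseq n))" for i
    by (rule convergent_ignore_initial_segment[THEN iffD1])
  then show ?thesis using subseq_diagseq by blast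
qed

context frac begin

text \<open>The factor by which the oscillation of means shrinks when the radius is halved; it is
  below 1 because s > 1/2.\<close>

definition \<theta> :: real where "\<theta> = (1/2) powr (s - 1/2)"

lemma \<theta>: "0 < \<theta>" "\<theta> < 1"
  using s_gt powr_less_mono2[of "s - 1/2" "1/2" 1] by (auto simp: \<theta>_def)

lemma \<theta>_pow: "((1/2::real) ^ k) powr (2 * s - 1) = (\<theta> ^ k)\<^sup>2"
proof -
  have "\<theta> ^ k = (1/2) powr ((s - 1/2) * real k)"
    unfolding \<theta>_def by (simp add: powr_powr flip: powr_realpow)
  then have "(\<theta> ^ k)\<^sup>2 = (1/2) powr (((s - 1/2) * real k) * 2)"
    by (simp only: powr_powr[symmetric]) simp
  also have "\<dots> = ((1/2) powr real k) powr (2 * s - 1)"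
    by (simp only: powr_powr) (simp add: algebra_simps)
  finally show ?thesis by (simp add: powr_realpow)
qed

lemma mean_approx:
  assumes "a > 0"
  shows "\<exists>C>0. \<forall>u x q k. u \<in> Hdot s \<longrightarrow> radial u \<longrightarrow> a \<le> norm x \<longrightarrow> Dsq u x < \<infinity> \<longrightarrow> dist x q < (1/2) ^ k \<longrightarrow>
     \<bar>u x - mean u q ((1/2) ^ k)\<bar> \<le> C * \<theta> ^ k * sqrt (Gag u)"
proof -
  obtain C0 where C0: "C0 > 0" "\<And>u x x1 x2 r r1 r2. u \<in> Hdot s \<Longrightarrow> radial u \<Longrightarrow> a \<le> norm x \<Longrightarrow> r > 0 \<Longrightarrow>
     ball x1 r1 \<subseteq> ball x r \<Longrightarrow> ball x2 r2 \<subseteq> ball x r \<Longrightarrow> r / 4 \<le> r1 \<Longrightarrow> r / 4 \<le> r2 \<Longrightarrow>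
     (mean u x1 r1 - mean u x2 r2)\<^sup>2 \<le> C0 * r powr (2 * s - 1) * Gag u"
    using mean_oscillation[OF assms] by blast
  define c1 where "c1 = sqrt C0"
  define c2 where "c2 = sqrt (C0 * 2 powr (2 * s - 1))"
  have c: "c1 > 0" "c2 > 0" using C0(1) by (auto simp: c1_def c2_def)
  define C where "C = c1 / (1 - \<theta>) + c2"
  have "C > 0" using c \<theta> by (simp add: C_def add_pos_pos)
  moreover have "\<bar>u x - mean u q ((1/2) ^ k)\<bar> \<le> C * \<theta> ^ k * sqrt (Gag u)"
    if u: "u \<in> Hdot s" "radial u" and x: "a \<le> norm x" and D: "Dsq u x < \<infinity>" and q: "dist x q < (1/2) ^ k"
    for u x q k
  proof -
    define g where "g = sqrt (Gag u)"
    have g: "g \<ge> 0" using Gag_nonneg[of u] by (simp add: g_def)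
    define m where "m k = mean u x ((1/2) ^ k)" for k
    have step: "\<bar>m j - m (Suc j)\<bar> \<le> c1 * \<theta> ^ j * g" for j
    proof -
      have "(m j - m (Suc j))\<^sup>2 \<le> C0 * ((1/2) ^ j) powr (2 * s - 1) * Gag u"
        unfolding m_def by (rule C0(2)[OF u x]) (auto intro!: subset_ball)
      then have "sqrt ((m j - m (Suc j))\<^sup>2) \<le> sqrt (C0 * (\<theta> ^ j)\<^sup>2 * Gag u)"
        unfolding \<theta>_pow by (rule real_sqrt_le_mono)
      then show ?thesis using \<theta> by (simp add: real_sqrt_mult c1_def g_def)
    qed
    have tele: "\<bar>m k - m (k + j)\<bar> \<le> c1 * g / (1 - \<theta>) * (\<theta> ^ k - \<theta> ^ (k + j))" for j
    proof (induction j)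
      case (Suc j)
      have "c1 * \<theta> ^ (k + j) * g = c1 * g / (1 - \<theta>) * (\<theta> ^ (k + j) - \<theta> ^ (k + Suc j))"
        using \<theta> by (simp add: field_simps)
      then have "c1 * g / (1 - \<theta>) * (\<theta> ^ k - \<theta> ^ (k + j)) + c1 * \<theta> ^ (k + j) * g
          = c1 * g / (1 - \<theta>) * (\<theta> ^ k - \<theta> ^ (k + Suc j))"
        by (simp only: distrib_left[symmetric]) simp
      then show ?case using Suc step[of "k + j"] by simp
    qed simp
    have le: "\<bar>m k - m (k + j)\<bar> \<le> c1 * g / (1 - \<theta>) * \<theta> ^ k" for j
    proof -
      have "c1 * g / (1 - \<theta>) * (\<theta> ^ k - \<theta> ^ (k + j)) \<le> c1 * g / (1 - \<theta>) * \<theta> ^ k"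
        using c g \<theta> by (intro mult_left_mono) auto
      then show ?thesis using tele[of j] by linarith
    qed
    have "(\<lambda>j. m (j + k)) \<longlonglongrightarrow> u x"
      unfolding m_def using LIMSEQ_ignore_initial_segment[OF mean_tendsto[OF u(1) D], of k] by simp
    then have "(\<lambda>j. \<bar>m k - m (j + k)\<bar>) \<longlonglongrightarrow> \<bar>m k - u x\<bar>"
      by (intro tendsto_intros)
    then have 1: "\<bar>m k - u x\<bar> \<le> c1 * g / (1 - \<theta>) * \<theta> ^ k"
      by (rule LIMSEQ_le_const2) (use le in \<open>auto simp: add.commute\<close>)
    \<comment> \<open>Both balls lie in the ball of twice the radius around \<open>x\<close>, hence
      the additional power of 2 in \<open>c2\<close>.\<close>
    have "(m k - mean u q ((1/2) ^ k))\<^sup>2 \<le> C0 * (2 * (1/2) ^ k) powr (2 * s - 1) * Gag u"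
      unfolding m_def
    proof (rule C0(2)[OF u x])
      show "ball q ((1/2) ^ k) \<subseteq> ball x (2 * (1/2) ^ k)"
      proof
        fix w assume "w \<in> ball q ((1/2) ^ k)"
        then show "w \<in> ball x (2 * (1/2) ^ k)" using dist_triangle[of x w q] q by simp
      qed
      show "ball x ((1/2) ^ k) \<subseteq> ball x (2 * (1/2) ^ k)" by (rule subset_ball) simp
    qed auto
    also have "(2 * (1/2) ^ k) powr (2 * s - 1) = 2 powr (2 * s - 1) * (\<theta> ^ k)\<^sup>2"
      unfolding \<theta>_pow[symmetric] by (simp add: powr_mult)
    finally have "sqrt ((m k - mean u q ((1/2) ^ k))\<^sup>2) \<le> sqrt (C0 * 2 powr (2 * s - 1) * (\<theta> ^ k)\<^sup>2 * Gag u)"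
      by (intro real_sqrt_le_mono) (simp add: mult.assoc)
    then have 2: "\<bar>m k - mean u q ((1/2) ^ k)\<bar> \<le> c2 * \<theta> ^ k * g"
      using \<theta> by (simp add: real_sqrt_mult c2_def g_def)
    have "\<bar>u x - mean u q ((1/2) ^ k)\<bar> \<le> c1 * g / (1 - \<theta>) * \<theta> ^ k + c2 * \<theta> ^ k * g"
      using 1 2 by linarith
    also have "\<dots> = C * \<theta> ^ k * g" by (simp add: C_def algebra_simps)
    finally show ?thesis by (simp add: g_def)
  qed
  ultimately show ?thesis by blast
qed

text \<open>The square of a mean is at most the mean of the square, which is split by
  \<open>sq_le_powr\<close> at a level tuned to the Sobolev bound. The constant depends on the
  radius but not on the centre.\<close>

lemma mean_bound:
  assumes r: "r > 0"
  shows "\<exists>C>0. \<forall>u x. u \<in> Hdot s \<longrightarrow> \<bar>mean u x r\<bar> \<le> C * sqrt (Gag u)"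
proof -
  obtain C0 where C0: "C0 > 0" "\<And>u::real^'n \<Rightarrow> real. u \<in> Hdot s \<Longrightarrow> Lp u powr (2 / p) \<le> C0 * Gag u"
    using Sobolev by blast
  define c where "c = 1 + 1 / vol r"
  have v: "vol r > 0" using r by (rule vol_pos)
  have c: "c > 0" using v by (simp add: c_def add_pos_pos)
  have "sqrt (c * C0) > 0" using c C0 by simp
  moreover have "\<bar>mean u x r\<bar> \<le> sqrt (c * C0) * sqrt (Gag u)" if u: "u \<in> Hdot s" for u x
  proof -
    note [measurable] = HdotD(1)[OF u]
    have "(mean u x r)\<^sup>2 \<le> c * (C0 * Gag u)"
    proof (rule field_le_epsilon)
      fix e :: real assume e: "e > 0"
      \<comment> \<open>The extra term keeps the level positive when the Gagliardo energy is 0;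
        after multiplication by \<open>c\<close> it costs exactly \<open>e\<close>.\<close>
      define b where "b = C0 * Gag u + e / c"
      have b: "b > 0" using C0 Gag_nonneg[of u] e c by (simp add: b_def add_nonneg_pos)
      define l where "l = sqrt b"
      have l: "l > 0" "l\<^sup>2 = b" using b by (auto simp: l_def)
      have "Lp u \<le> b powr (p / 2)"
      proof -
        have "Lp u powr (2 / p) \<le> b" using C0(2)[OF u] e c by (simp add: b_def add_increasing2)
        then have "(Lp u powr (2 / p)) powr (p / 2) \<le> b powr (p / 2)" using p_pos by (intro powr_mono2) auto
        then show ?thesis using p_pos Lp_nonneg[of u] by (simp add: powr_powr)
      qed
      also have "b powr (p / 2) = l powr p" using b p_pos by (simp add: l_def powr_half_sqrt[symmetric] powr_powr)
      finally have "l powr (2 - p) * Lp u \<le> l powr (2 - p) * l powr p" by (intro mult_left_mono) auto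
      also have "\<dots> = b" using l by (simp flip: powr_add)
      finally have lL: "l powr (2 - p) * Lp u \<le> b" .
      have "ennreal ((0 - mean u x r)\<^sup>2) * ennreal (vol r) \<le> (\<integral>\<^sup>+y. ennreal ((0 - u y)\<^sup>2) * ib r x y \<partial>lborel)"
        by (rule mean_sq_le[OF u r])
      also have "\<dots> \<le> (\<integral>\<^sup>+y. ennreal b * ib r x y + ennreal (l powr (2 - p)) * ennreal (\<bar>u y\<bar> powr p) \<partial>lborel)"
      proof (rule nn_integral_mono)
        fix y
        have "ennreal ((u y)\<^sup>2) \<le> ennreal (b + l powr (2 - p) * \<bar>u y\<bar> powr p)"
          using sq_le_powr[OF l(1), of "u y"] l by (intro ennreal_leI) simp
        also have "\<dots> = ennreal b + ennreal (l powr (2 - p)) * ennreal (\<bar>u y\<bar> powr p)"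
          using b by (simp add: ennreal_mult)
        finally show "ennreal ((0 - u y)\<^sup>2) * ib r x y
            \<le> ennreal b * ib r x y + ennreal (l powr (2 - p)) * ennreal (\<bar>u y\<bar> powr p)"
          by (auto simp: ib_def)
      qed
      also have "\<dots> = (\<integral>\<^sup>+y. ennreal b * ib r x y \<partial>lborel) + (\<integral>\<^sup>+y. ennreal (l powr (2 - p)) * ennreal (\<bar>u y\<bar> powr p) \<partial>lborel)"
        by (rule nn_integral_add) measurable
      also have "(\<integral>\<^sup>+y. ennreal b * ib r x y \<partial>lborel) = ennreal b * (\<integral>\<^sup>+y. ib r x y \<partial>lborel)"
        by (rule nn_integral_cmult) measurable
      also have "(\<integral>\<^sup>+y. ib r x y \<partial>lborel) = ennreal (vol r)" using r by (intro nn_integral_ib) simp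
      also have "(\<integral>\<^sup>+y. ennreal (l powr (2 - p)) * ennreal (\<bar>u y\<bar> powr p) \<partial>lborel)
          = ennreal (l powr (2 - p)) * (\<integral>\<^sup>+y. ennreal (\<bar>u y\<bar> powr p) \<partial>lborel)"
        by (rule nn_integral_cmult) measurable
      also have "\<dots> = ennreal (l powr (2 - p)) * ennreal (Lp u)" by (simp add: HdotD(3)[OF u])
      also have "ennreal b * ennreal (vol r) + \<dots> = ennreal (b * vol r + l powr (2 - p) * Lp u)"
        using b v Lp_nonneg[of u] by (simp add: ennreal_mult)
      finally have "ennreal ((mean u x r)\<^sup>2 * vol r) \<le> ennreal (b * vol r + l powr (2 - p) * Lp u)"
        using v by (simp add: ennreal_mult del: ennreal_plus)
      then have "(mean u x r)\<^sup>2 * vol r \<le> b * vol r + l powr (2 - p) * Lp u"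
        using b v Lp_nonneg[of u] by (subst (asm) ennreal_le_iff) auto
      also have "\<dots> \<le> b * vol r + b" using lL by simp
      also have "\<dots> = (c * b) * vol r" using v by (simp add: c_def field_simps)
      finally have "(mean u x r)\<^sup>2 \<le> c * b" using v by simp
      also have "\<dots> = c * (C0 * Gag u) + e" using c by (simp add: b_def distrib_left)
      finally show "(mean u x r)\<^sup>2 \<le> c * (C0 * Gag u) + e" .
    qed
    then have "sqrt ((mean u x r)\<^sup>2) \<le> sqrt (c * (C0 * Gag u))" by (rule real_sqrt_le_mono)
    then show ?thesis by (simp add: real_sqrt_mult mult.assoc)
  qed
  ultimately show ?thesis by blast
qed

text \<open>The value is close to the mean over the unit ball around it, and that mean is bounded.
  The exceptional null set is where \<open>Dsq u\<close> is infinite.\<close>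

lemma pointwise_bound:
  assumes "a > 0"
  shows "\<exists>C>0. \<forall>u\<in>Hdot s. radial u \<longrightarrow> (AE x in lborel. a \<le> norm (x::real^'n) \<longrightarrow> \<bar>u x\<bar> \<le> C * sqrt (Gag u))"
proof -
  obtain C1 where C1: "C1 > 0" "\<And>u x q k. u \<in> Hdot s \<Longrightarrow> radial u \<Longrightarrow> a \<le> norm x \<Longrightarrow> Dsq u x < \<infinity> \<Longrightarrow> dist x q < (1/2) ^ k \<Longrightarrow>
     \<bar>u x - mean u q ((1/2) ^ k)\<bar> \<le> C1 * \<theta> ^ k * sqrt (Gag u)"
    using mean_approx[OF assms] by blast
  obtain C2 where C2: "C2 > 0" "\<And>u x. u \<in> Hdot s \<Longrightarrow> \<bar>mean u x 1\<bar> \<le> C2 * sqrt (Gag u)"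
    using mean_bound[of 1] by auto
  have "AE x in lborel. a \<le> norm x \<longrightarrow> \<bar>u x\<bar> \<le> (C1 + C2) * sqrt (Gag u)"
    if u: "u \<in> Hdot s" "radial u" for u
    using Dsq_finite_AE[OF u(1)]
  proof eventually_elim
    case (elim x)
    show ?case
    proof
      assume "a \<le> norm x"
      then have "\<bar>u x - mean u x 1\<bar> \<le> C1 * sqrt (Gag u)" using C1(2)[OF u _ elim, of x 0] by simp
      then show "\<bar>u x\<bar> \<le> (C1 + C2) * sqrt (Gag u)" using C2(2)[OF u(1), of x] by (simp add: distrib_right)
    qed
  qed
  then show ?thesis using C1 C2 by (intro exI[of _ "C1 + C2"]) auto
qed

text \<open>The means over balls with centres in a countable dense set and dyadic radii form
  countably many bounded sequences, so a diagonal subsequence makes them all converge.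
  \<open>mean_approx\<close> transfers this to the values.\<close>

lemma AE_convergent_subsequence:
  fixes X :: "nat \<Rightarrow> real^'n \<Rightarrow> real"
  assumes X: "\<And>n. X n \<in> Hdot s" "\<And>n. radial (X n)" and M: "\<And>n. Gag (X n) \<le> M"
  shows "\<exists>r::nat \<Rightarrow> nat. strict_mono r \<and> (AE x in lborel. convergent (\<lambda>n. X (r n) x))"
proof -
  obtain Q :: "(real^'n) set" where Q: "countable Q" "\<And>U. open U \<Longrightarrow> U \<noteq> {} \<Longrightarrow> \<exists>d\<in>Q. d \<in> U"
    by (rule countable_dense_setE) blast
  have Qne: "Q \<noteq> {}" using Q(2)[of UNIV] by auto
  define e where "e = from_nat_into (Q \<times> (UNIV::nat set))"
  have range_e: "range e = Q \<times> UNIV"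
    unfolding e_def using Q(1) Qne by (intro range_from_nat_into) auto
  define f where "f i n = mean (X n) (fst (e i)) ((1/2) ^ snd (e i))" for i n
  have bf: "bounded (range (f i))" for i
  proof -
    obtain C where C: "C > 0" "\<And>u x. u \<in> Hdot s \<Longrightarrow> \<bar>mean u x ((1/2) ^ snd (e i))\<bar> \<le> C * sqrt (Gag u)"
      using mean_bound[of "(1/2) ^ snd (e i)"] by auto
    have "norm (f i n) \<le> C * sqrt M" for n
    proof -
      have "norm (f i n) \<le> C * sqrt (Gag (X n))" using C(2)[OF X(1)] by (simp add: f_def)
      also have "\<dots> \<le> C * sqrt M" using C(1) M[of n] by (intro mult_left_mono) auto
      finally show ?thesis .
    qed
    then show ?thesis by (auto simp: bounded_iff)
  qed
  obtain r :: "nat \<Rightarrow> nat" where r: "strict_mono r" "\<forall>i. convergent (\<lambda>n. f i (r n))"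
    using diagonal_convergent[of f, OF bf] by (elim exE conjE) (rule that; assumption)
  have conv: "Cauchy (\<lambda>n. mean (X (r n)) q ((1/2) ^ k))" if "q \<in> Q" for q k
  proof -
    have "(q, k) \<in> range e" using \<open>q \<in> Q\<close> by (simp add: range_e)
    then obtain i where "e i = (q, k)" by (metis rangeE)
    then show ?thesis using r(2)[rule_format, of i] by (simp add: f_def convergent_Cauchy)
  qed
  have "AE x in lborel. \<forall>n. Dsq (X n) x < \<infinity>"
    using Dsq_finite_AE[OF X(1)] by (simp add: AE_all_countable)
  moreover have "AE x in lborel. x \<noteq> (0::real^'n)" by (rule AE_lborel_singleton)
  ultimately have "AE x in lborel. convergent (\<lambda>n. X (r n) x)"
  proof eventually_elim
    case (elim x)
    \<comment> \<open>The constant may depend on the point, since only pointwise convergence is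
      claimed; it degenerates as \<open>x\<close> approaches 0.\<close>
    obtain C where C: "C > 0" "\<And>u y q k. u \<in> Hdot s \<Longrightarrow> radial u \<Longrightarrow> norm x \<le> norm y \<Longrightarrow> Dsq u y < \<infinity> \<Longrightarrow> dist y q < (1/2) ^ k \<Longrightarrow>
     \<bar>u y - mean u q ((1/2) ^ k)\<bar> \<le> C * \<theta> ^ k * sqrt (Gag u)"
      using mean_approx[of "norm x"] elim by auto
    have M0: "M \<ge> 0" using M[of 0] Gag_nonneg[of "X 0"] by linarith
    have "Cauchy (\<lambda>n. X (r n) x)"
    proof (rule metric_CauchyI)
      fix \<epsilon> :: real assume \<epsilon>: "\<epsilon> > 0"
      have "(\<lambda>k. C * sqrt M * \<theta> ^ k) \<longlonglongrightarrow> C * sqrt M * 0"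
        using \<theta> by (intro tendsto_mult_left LIMSEQ_realpow_zero) auto
      then have "\<forall>\<^sub>F k in sequentially. C * sqrt M * \<theta> ^ k < \<epsilon> / 3"
        using \<epsilon> by (intro order_tendstoD(2)[where y = "C * sqrt M * 0"]) auto
      then obtain k where k: "C * sqrt M * \<theta> ^ k < \<epsilon> / 3" by (auto simp: eventually_sequentially)
      obtain q where q: "q \<in> Q" "q \<in> ball x ((1/2) ^ k)"
      proof -
        have "(0::real) < (1/2) ^ k" by simp
        then have "ball x ((1/2) ^ k) \<noteq> {}" by (metis ball_eq_empty not_le)
        then show ?thesis using Q(2)[OF open_ball] that by blast
      qed
      have near: "\<bar>X n x - mean (X n) q ((1/2) ^ k)\<bar> < \<epsilon> / 3" for n
      proof -
        have "\<bar>X n x - mean (X n) q ((1/2) ^ k)\<bar> \<le> C * \<theta> ^ k * sqrt (Gag (X n))"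
          using C(2)[OF X(1) X(2), of x n q k] elim q by simp
        also have "\<dots> \<le> C * \<theta> ^ k * sqrt M"
          using C \<theta> M[of n] by (intro mult_left_mono) auto
        finally show ?thesis using k by (simp add: algebra_simps)
      qed
      obtain N0 where N0: "\<And>m n. m \<ge> N0 \<Longrightarrow> n \<ge> N0 \<Longrightarrow>
          dist (mean (X (r m)) q ((1/2) ^ k)) (mean (X (r n)) q ((1/2) ^ k)) < \<epsilon> / 3"
        using metric_CauchyD[OF conv[OF q(1), of k], of "\<epsilon> / 3"] \<epsilon> by auto
      show "\<exists>N0. \<forall>m\<ge>N0. \<forall>n\<ge>N0. dist (X (r m) x) (X (r n) x) < \<epsilon>"
      proof (intro exI[of _ N0] allI impI)
        fix m n assume "m \<ge> N0" "n \<ge> N0"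
        then show "dist (X (r m) x) (X (r n) x) < \<epsilon>"
          using N0[of m n] near[of "r m"] near[of "r n"] unfolding dist_real_def by linarith
      qed
    qed
    then show ?case by (simp add: Cauchy_convergent_iff)
  qed
  then show ?thesis using r(1) by blast
qed

end

lemma (in pair_sigma_finite) AE_pair_both:
  assumes "AE x in M1. P x" "AE y in M2. Q y"
  shows "AE z in M1 \<Otimes>\<^sub>M M2. P (fst z) \<and> Q (snd z)"
proof -
  obtain A where A: "{x \<in> space M1. \<not> P x} \<subseteq> A" "A \<in> null_sets M1"
    using assms(1) by (auto simp: eventually_ae_filter)
  obtain B where B: "{x \<in> space M2. \<not> Q x} \<subseteq> B" "B \<in> null_sets M2"
    using assms(2) by (auto simp: eventually_ae_filter)
  have [measurable]: "A \<in> sets M1" "B \<in> sets M2" using A B by auto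
  have "AE z in M1 \<Otimes>\<^sub>M M2. fst z \<notin> A \<and> snd z \<notin> B"
  proof (rule AE_pair_measure)
    show "AE x in M1. AE y in M2. fst (x, y) \<notin> A \<and> snd (x, y) \<notin> B"
      using AE_not_in[OF A(2)] AE_not_in[OF B(2)] by (auto elim!: eventually_mono)
  qed measurable
  then show ?thesis
    using AE_space by eventually_elim (use A B in \<open>auto simp: space_pair_measure\<close>)
qed

lemma nn_integral_Fatou_bound:
  fixes f :: "nat \<Rightarrow> 'a \<Rightarrow> real"
  assumes [measurable]: "\<And>n. f n \<in> borel_measurable M"
    and lim: "AE x in M. (\<lambda>n. f n x) \<longlonglongrightarrow> g x"
    and le: "\<And>n. (\<integral>\<^sup>+x. ennreal (f n x) \<partial>M) \<le> B"
  shows "(\<integral>\<^sup>+x. ennreal (g x) \<partial>M) \<le> B"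
proof -
  have "(\<integral>\<^sup>+x. ennreal (g x) \<partial>M) = (\<integral>\<^sup>+x. liminf (\<lambda>n. ennreal (f n x)) \<partial>M)"
  proof (rule nn_integral_cong_AE)
    show "AE x in M. ennreal (g x) = liminf (\<lambda>n. ennreal (f n x))"
      using lim
    proof eventually_elim
      case (elim x)
      then have "(\<lambda>n. ennreal (f n x)) \<longlonglongrightarrow> ennreal (g x)" by (rule tendsto_ennrealI)
      then show ?case by (intro lim_imp_Liminf[symmetric]) auto
    qed
  qed
  also have "\<dots> \<le> liminf (\<lambda>n. \<integral>\<^sup>+x. ennreal (f n x) \<partial>M)"
    by (rule nn_integral_liminf) measurable
  also have "\<dots> \<le> liminf (\<lambda>n::nat. B)"
    by (intro Liminf_mono always_eventually) (use le in auto)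
  also have "\<dots> = B" by (simp add: Liminf_const)
  finally show ?thesis .
qed

section \<open>The weighted space of radial functions\<close>

lemma integrable_nonneg_iff:
  fixes f :: "'a \<Rightarrow> real"
  assumes "f \<in> borel_measurable M" "\<And>x. f x \<ge> 0"
  shows "integrable M f \<longleftrightarrow> (\<integral>\<^sup>+x. ennreal (f x) \<partial>M) < \<infinity>"
  using assms by (simp add: integrable_iff_bounded)

lemma abs_mult_le_sum_squares: "\<bar>a * b\<bar> \<le> a\<^sup>2 + (b::real)\<^sup>2"
proof -
  have "0 \<le> (\<bar>a\<bar> - \<bar>b\<bar>)\<^sup>2" by simp
  then have "2 * \<bar>a * b\<bar> \<le> a\<^sup>2 + b\<^sup>2" by (simp add: power2_diff abs_mult mult.assoc)
  moreover have "0 \<le> \<bar>a * b\<bar>" by simp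
  ultimately show ?thesis by linarith
qed

locale frac_V = frac n s N for n :: "'n::finite itself" and s N +
  fixes V :: "real \<Rightarrow> real" and c0 :: real
  assumes c0_def: "c0 = CNs TYPE('n) s / 2"
    and V_cont: "continuous_on {0<..} V" and V_nonneg: "r > 0 \<Longrightarrow> V r \<ge> 0"
begin

lemma c0_pos: "c0 > 0"
  using CNs_pos[OF N2 s_pos s_less] by (simp add: c0_def)

lemma radial_continuous_measurable:
  assumes "continuous_on {0<..} (W :: real \<Rightarrow> real)"
  shows "(\<lambda>x::real^'n. W (norm x)) \<in> borel_measurable borel"
proof -
  have "(\<lambda>x::real^'n. if x \<in> - {0} then W (norm x) else W 0) \<in> borel_measurable borel"
    by (intro borel_measurable_continuous_on_if continuous_on_compose2[OF assms] continuous_intros) auto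
  moreover have "(\<lambda>x::real^'n. if x \<in> - {0} then W (norm x) else W 0) = (\<lambda>x. W (norm x))"
    by auto
  ultimately show ?thesis by simp
qed

lemma V_measurable [measurable]: "(\<lambda>x::real^'n. V (norm x)) \<in> borel_measurable borel"
  by (rule radial_continuous_measurable[OF V_cont])

text \<open>The hypotheses say nothing about \<open>V 0\<close>, so its value is replaced by \<open>0\<close>.\<close>

definition V' :: "real^'n \<Rightarrow> real" where "V' x = (if x = 0 then 0 else V (norm x))"

lemma V'_measurable [measurable]: "V' \<in> borel_measurable borel"
  unfolding V'_def[abs_def] by measurable

lemma V'_nonneg: "V' x \<ge> 0"
  by (simp add: V'_def V_nonneg)

lemma V'_AE: "AE x in lborel. V (norm x) = V' x"
  using AE_lborel_singleton[of "0::real^'n"] by eventually_elim (simp add: V'_def)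

definition SV :: "(real^'n \<Rightarrow> real) set" where "SV = HsVrad s V"

lemma SV_iff: "u \<in> SV \<longleftrightarrow> u \<in> borel_measurable borel \<and> radial u \<and> integrable lborel (\<lambda>x. \<bar>u x\<bar> powr p) \<and>
   integrable (lborel \<Otimes>\<^sub>M lborel) (\<lambda>q. gk u (fst q) (snd q)) \<and> integrable lborel (\<lambda>x. V' x * (u x)\<^sup>2)"
proof (cases "u \<in> borel_measurable borel")
  case True
  note [measurable] = True
  have "(\<integral>\<^sup>+x. ennreal (V (norm x) * (u x)\<^sup>2) \<partial>lborel) = (\<integral>\<^sup>+x. ennreal (V' x * (u x)\<^sup>2) \<partial>lborel)"
    by (rule nn_integral_cong_AE) (use V'_AE in eventually_elim, simp)
  moreover have "integrable lborel (\<lambda>x. V' x * (u x)\<^sup>2) \<longleftrightarrow> (\<integral>\<^sup>+x. ennreal (V' x * (u x)\<^sup>2) \<partial>lborel) < \<infinity>"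
    by (rule integrable_nonneg_iff) (auto simp: V'_nonneg)
  moreover have "integrable lborel (\<lambda>x. \<bar>u x\<bar> powr p) \<longleftrightarrow> (\<integral>\<^sup>+x. ennreal (\<bar>u x\<bar> powr p) \<partial>lborel) < \<infinity>"
    by (rule integrable_nonneg_iff) auto
  moreover have "integrable (lborel \<Otimes>\<^sub>M lborel) (\<lambda>q. gk u (fst q) (snd q)) \<longleftrightarrow> gagliardo_int s u < \<infinity>"
    unfolding gagliardo_gk by (rule integrable_nonneg_iff) (auto simp: gk_nonneg)
  ultimately show ?thesis using True by (auto simp: SV_def HsVrad_def HsV_def Hdot_def crit_exp_p)
qed (auto simp: SV_def HsVrad_def HsV_def Hdot_def)

lemma SVD:
  assumes "u \<in> SV"
  shows "u \<in> borel_measurable borel" "radial u" "integrable lborel (\<lambda>x. \<bar>u x\<bar> powr p)"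
   "integrable (lborel \<Otimes>\<^sub>M lborel) (\<lambda>q. gk u (fst q) (snd q))" "integrable lborel (\<lambda>x. V' x * (u x)\<^sup>2)"
  using assms SV_iff by auto

lemma SV_Hdot: "u \<in> SV \<Longrightarrow> u \<in> Hdot s"
  by (simp add: SV_def HsVrad_def HsV_def)

text \<open>Closure under linear combinations and under Lipschitz truncations alike.\<close>

lemma SV_dominated:
  assumes u: "u \<in> SV" and v: "v \<in> SV" and [measurable]: "w \<in> borel_measurable borel" and "radial w"
    and c: "c \<ge> 0" and w: "\<And>x. \<bar>w x\<bar> \<le> c * (\<bar>u x\<bar> + \<bar>v x\<bar>)"
    and dw: "\<And>x y. \<bar>w x - w y\<bar> \<le> c * (\<bar>u x - u y\<bar> + \<bar>v x - v y\<bar>)"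
  shows "w \<in> SV"
proof -
  note [measurable] = SVD(1)[OF u] SVD(1)[OF v]
  have sq: "t\<^sup>2 \<le> 2 * c\<^sup>2 * (a\<^sup>2 + b\<^sup>2)" if "\<bar>t\<bar> \<le> c * (\<bar>a\<bar> + \<bar>b\<bar>)" for t a b :: real
  proof -
    have "t\<^sup>2 \<le> (c * (\<bar>a\<bar> + \<bar>b\<bar>))\<^sup>2" using power_mono[OF that, of 2] by simp
    also have "\<dots> = c\<^sup>2 * (\<bar>a\<bar> + \<bar>b\<bar>)\<^sup>2" by (simp add: power_mult_distrib)
    also have "\<dots> \<le> c\<^sup>2 * (2 * (a\<^sup>2 + b\<^sup>2))"
      using zero_le_power2[of "\<bar>a\<bar> - \<bar>b\<bar>"] by (intro mult_left_mono) (simp_all add: power2_sum power2_diff)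
    finally show ?thesis by (simp only: mult.assoc mult.left_commute)
  qed
  have pw: "\<bar>w x\<bar> powr p \<le> (2 * c) powr p * (\<bar>u x\<bar> powr p + \<bar>v x\<bar> powr p)" for x
  proof -
    define M where "M = max \<bar>u x\<bar> \<bar>v x\<bar>"
    have "\<bar>u x\<bar> + \<bar>v x\<bar> \<le> 2 * M" unfolding M_def by linarith
    from mult_left_mono[OF this c] have "\<bar>w x\<bar> \<le> 2 * c * M" using w[of x] by simp
    then have "\<bar>w x\<bar> powr p \<le> (2 * c * M) powr p" using p_pos by (intro powr_mono2) auto
    also have "\<dots> = (2 * c) powr p * M powr p" using c by (simp add: powr_mult M_def)
    also have "\<dots> \<le> (2 * c) powr p * (\<bar>u x\<bar> powr p + \<bar>v x\<bar> powr p)"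
      by (intro mult_left_mono) (simp_all add: M_def max_def)
    finally show ?thesis by simp
  qed
  have "integrable lborel (\<lambda>x. (2 * c) powr p * (\<bar>u x\<bar> powr p + \<bar>v x\<bar> powr p))"
    using SVD(3)[OF u] SVD(3)[OF v] by simp
  then have 1: "integrable lborel (\<lambda>x. \<bar>w x\<bar> powr p)"
    by (rule Bochner_Integration.integrable_bound) (use pw in auto)
  have gkw: "gk w x y \<le> 2 * c\<^sup>2 * (gk u x y + gk v x y)" for x y
    using divide_right_mono[OF sq[OF dw[of x y]], of "norm (x - y) powr (N + 2 * s)"]
    by (simp add: gk_def add_divide_distrib distrib_left)
  have "integrable (lborel \<Otimes>\<^sub>M lborel) (\<lambda>q. 2 * c\<^sup>2 * (gk u (fst q) (snd q) + gk v (fst q) (snd q)))"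
    using SVD(4)[OF u] SVD(4)[OF v] by (intro integrable_mult_right Bochner_Integration.integrable_add)
  then have 2: "integrable (lborel \<Otimes>\<^sub>M lborel) (\<lambda>q. gk w (fst q) (snd q))"
    by (rule Bochner_Integration.integrable_bound) (use gkw gk_nonneg in auto)
  have int: "integrable lborel (\<lambda>x. 2 * c\<^sup>2 * (V' x * (u x)\<^sup>2 + V' x * (v x)\<^sup>2))"
    using SVD(5)[OF u] SVD(5)[OF v] by (intro integrable_mult_right Bochner_Integration.integrable_add)
  have "V' x * (w x)\<^sup>2 \<le> 2 * c\<^sup>2 * (V' x * (u x)\<^sup>2 + V' x * (v x)\<^sup>2)" for x
    using mult_left_mono[OF sq[OF w[of x]] V'_nonneg[of x]] by (simp add: algebra_simps)
  then have "AE x in lborel. norm (V' x * (w x)\<^sup>2) \<le> norm (2 * c\<^sup>2 * (V' x * (u x)\<^sup>2 + V' x * (v x)\<^sup>2))"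
    by (simp add: V'_nonneg)
  then have 3: "integrable lborel (\<lambda>x. V' x * (w x)\<^sup>2)"
    by (intro Bochner_Integration.integrable_bound[OF int]) measurable
  show ?thesis using 1 2 3 assms by (simp add: SV_iff)
qed

section \<open>The inner product of the weighted space and its completeness\<close>

definition bil :: "(real^'n \<Rightarrow> real) \<Rightarrow> (real^'n \<Rightarrow> real) \<Rightarrow> (real^'n) \<times> (real^'n) \<Rightarrow> real" where
  "bil u v q = (u (fst q) - u (snd q)) * (v (fst q) - v (snd q)) / norm (fst q - snd q) powr (N + 2 * s)"

definition ip :: "(real^'n \<Rightarrow> real) \<Rightarrow> (real^'n \<Rightarrow> real) \<Rightarrow> real" where
  "ip u v = c0 * integral\<^sup>L (lborel \<Otimes>\<^sub>M lborel) (bil u v) + integral\<^sup>L lborel (\<lambda>x. V' x * u x * v x)"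

lemma integrable_bil:
  assumes u: "u \<in> SV" and v: "v \<in> SV"
  shows "integrable (lborel \<Otimes>\<^sub>M lborel) (bil u v)"
proof -
  note [measurable] = SVD(1)[OF u] SVD(1)[OF v]
  have int: "integrable (lborel \<Otimes>\<^sub>M lborel) (\<lambda>q. gk u (fst q) (snd q) + gk v (fst q) (snd q))"
    using SVD(4)[OF u] SVD(4)[OF v] by (intro Bochner_Integration.integrable_add)
  have "\<bar>bil u v q\<bar> \<le> gk u (fst q) (snd q) + gk v (fst q) (snd q)" for q
  proof -
    from divide_right_mono[OF abs_mult_le_sum_squares, of "norm (fst q - snd q) powr (N + 2 * s)"] show ?thesis
      by (simp add: bil_def gk_def add_divide_distrib)
  qed
  then have "AE q in lborel \<Otimes>\<^sub>M lborel. norm (bil u v q) \<le> norm (gk u (fst q) (snd q) + gk v (fst q) (snd q))"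
    by (simp add: gk_nonneg)
  moreover have "bil u v \<in> borel_measurable (lborel \<Otimes>\<^sub>M lborel)"
    unfolding bil_def[abs_def] by measurable
  ultimately show ?thesis
    by (intro Bochner_Integration.integrable_bound[OF int])
qed

lemma integrable_V:
  assumes u: "u \<in> SV" and v: "v \<in> SV"
  shows "integrable lborel (\<lambda>x. V' x * u x * v x)"
proof -
  note [measurable] = SVD(1)[OF u] SVD(1)[OF v]
  have int: "integrable lborel (\<lambda>x. V' x * (u x)\<^sup>2 + V' x * (v x)\<^sup>2)"
    using SVD(5)[OF u] SVD(5)[OF v] by (intro Bochner_Integration.integrable_add)
  have "\<bar>V' x * u x * v x\<bar> \<le> V' x * (u x)\<^sup>2 + V' x * (v x)\<^sup>2" for x
  proof -
    from mult_left_mono[OF abs_mult_le_sum_squares V'_nonneg[of x]] show ?thesis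
      using V'_nonneg[of x] by (simp add: abs_mult distrib_left mult.assoc)
  qed
  then have "AE x in lborel. norm (V' x * u x * v x) \<le> norm (V' x * (u x)\<^sup>2 + V' x * (v x)\<^sup>2)"
    by (simp add: V'_nonneg)
  then show ?thesis
    by (intro Bochner_Integration.integrable_bound[OF int]) measurable
qed

lemma Gag_integral: "u \<in> SV \<Longrightarrow> Gag u = integral\<^sup>L (lborel \<Otimes>\<^sub>M lborel) (bil u u)"
proof -
  assume u: "u \<in> SV"
  have "gagliardo_int s u = ennreal (integral\<^sup>L (lborel \<Otimes>\<^sub>M lborel) (\<lambda>q. gk u (fst q) (snd q)))"
    unfolding gagliardo_gk by (rule nn_integral_eq_integral[OF SVD(4)[OF u]]) (simp add: gk_nonneg)
  moreover have "integral\<^sup>L (lborel \<Otimes>\<^sub>M lborel) (\<lambda>q. gk u (fst q) (snd q)) \<ge> 0" by (simp add: gk_nonneg)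
  ultimately show ?thesis by (simp add: Gag_def gk_def bil_def[abs_def] power2_eq_square)
qed

lemma ip_self: "u \<in> SV \<Longrightarrow> ip u u = c0 * Gag u + integral\<^sup>L lborel (\<lambda>x. V' x * (u x)\<^sup>2)"
  by (simp add: ip_def Gag_integral power2_eq_square mult.assoc)

lemma ip_self_ge: assumes "u \<in> SV" shows "ip u u \<ge> c0 * Gag u" "ip u u \<ge> integral\<^sup>L lborel (\<lambda>x. V' x * (u x)\<^sup>2)"
proof -
  have "integral\<^sup>L lborel (\<lambda>x. V' x * (u x)\<^sup>2) \<ge> 0" by (simp add: V'_nonneg)
  moreover have "c0 * Gag u \<ge> 0" using c0_pos Gag_nonneg[of u] by simp
  ultimately show "ip u u \<ge> c0 * Gag u" "ip u u \<ge> integral\<^sup>L lborel (\<lambda>x. V' x * (u x)\<^sup>2)"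
    by (simp_all add: ip_self[OF assms])
qed

lemma HsV_norm_sq_ip: "u \<in> SV \<Longrightarrow> HsV_norm_sq s V u = ip u u"
proof -
  assume u: "u \<in> SV"
  note [measurable] = SVD(1)[OF u]
  have "integral\<^sup>L lborel (\<lambda>x. V (norm x) * (u x)\<^sup>2) = integral\<^sup>L lborel (\<lambda>x. V' x * (u x)\<^sup>2)"
    by (rule integral_cong_AE) (measurable, use V'_AE in eventually_elim, simp)
  then show ?thesis using u by (simp add: HsV_norm_sq_def hs_semi_sq_def ip_self Gag_def flip: c0_def)
qed

lemma SV_zero: "0 \<in> SV"
  by (simp add: SV_iff radial_def gk_def zero_fun_def)

lemma SV_add: assumes u: "u \<in> SV" and v: "v \<in> SV" shows "u + v \<in> SV"
proof (rule SV_dominated[OF u v, where c = 1])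
  show "u + v \<in> borel_measurable borel" using SVD(1)[OF u] SVD(1)[OF v] by (simp add: plus_fun_def)
  have "u x + v x = u y + v y" if "norm x = norm y" for x y
    using SVD(2)[OF u] SVD(2)[OF v] that unfolding radial_def by metis
  then show "radial (u + v)" unfolding radial_def plus_fun_apply by blast
qed auto

lemma SV_scale: assumes u: "u \<in> SV" shows "c *\<^sub>R u \<in> SV"
proof (rule SV_dominated[OF u u, where c = "\<bar>c\<bar>"])
  show "c *\<^sub>R u \<in> borel_measurable borel" using SVD(1)[OF u] by (simp add: scaleR_fun_def)
  have "c * u x = c * u y" if "norm x = norm y" for x y
    using SVD(2)[OF u] that unfolding radial_def by metis
  then show "radial (c *\<^sub>R u)" unfolding radial_def scaleR_fun_apply real_scaleR_def by blast
  show "\<bar>(c *\<^sub>R u) x\<bar> \<le> \<bar>c\<bar> * (\<bar>u x\<bar> + \<bar>u x\<bar>)" for x by (simp add: abs_mult mult_left_mono)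
  have "\<bar>c * u x - c * u y\<bar> = \<bar>c\<bar> * \<bar>u x - u y\<bar>" for x y
    by (simp add: abs_mult flip: right_diff_distrib)
  then show "\<bar>(c *\<^sub>R u) x - (c *\<^sub>R u) y\<bar> \<le> \<bar>c\<bar> * (\<bar>u x - u y\<bar> + \<bar>u x - u y\<bar>)" for x y
    by (simp add: mult_left_mono)
qed simp

sublocale semi_inner_space SV ip
proof
  show "subspace SV" using SV_zero SV_add SV_scale by (simp add: subspace_def)
  show "ip (x + y) z = ip x z + ip y z" if "x \<in> SV" "y \<in> SV" "z \<in> SV" for x y z
  proof -
    have "bil (x + y) z = (\<lambda>q. bil x z q + bil y z q)"
      by (auto simp: bil_def fun_eq_iff algebra_simps simp flip: add_divide_distrib diff_divide_distrib)
    then show ?thesis using that integrable_bil[of x z] integrable_bil[of y z] integrable_V[of x z] integrable_V[of y z]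
      by (simp add: ip_def algebra_simps)
  qed
  show "ip (c *\<^sub>R x) y = c * ip x y" for x y c
  proof -
    have "bil (c *\<^sub>R x) y = (\<lambda>q. c * bil x y q)"
      by (auto simp: bil_def fun_eq_iff algebra_simps)
    moreover have "(\<lambda>z. V' z * (c *\<^sub>R x) z * y z) = (\<lambda>z. c * (V' z * x z * y z))"
      by (auto simp: fun_eq_iff)
    ultimately show ?thesis by (simp add: ip_def distrib_left)
  qed
  show "ip x y = ip y x" for x y
    by (simp add: ip_def bil_def[abs_def] mult.commute mult.left_commute)
  show "ip x x \<ge> 0" if "x \<in> SV" for x
    using ip_self_ge(1)[OF that] c0_pos Gag_nonneg[of x] by (smt (verit) mult_nonneg_nonneg)
qed

lemma Gag_le_nrm: assumes "u \<in> SV" shows "sqrt (Gag u) \<le> nrm u / sqrt c0"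
proof -
  have "sqrt (c0 * Gag u) \<le> nrm u"
    unfolding nrm_def using ip_self_ge(1)[OF assms] by (rule real_sqrt_le_mono)
  then show ?thesis using c0_pos by (simp add: real_sqrt_mult field_simps)
qed

lemma SV_pointwise:
  assumes "a > 0"
  shows "\<exists>C>0. \<forall>u\<in>SV. AE x in lborel. a \<le> norm x \<longrightarrow> \<bar>u x\<bar> \<le> C * nrm u"
proof -
  obtain C where C: "C > 0" "\<forall>u\<in>Hdot s. radial u \<longrightarrow> (AE x in lborel. a \<le> norm (x::real^'n) \<longrightarrow> \<bar>u x\<bar> \<le> C * sqrt (Gag u))"
    using pointwise_bound[OF assms] by blast
  have "AE x in lborel. a \<le> norm x \<longrightarrow> \<bar>u x\<bar> \<le> C / sqrt c0 * nrm u" if u: "u \<in> SV" for u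
  proof -
    have "AE x in lborel. a \<le> norm x \<longrightarrow> \<bar>u x\<bar> \<le> C * sqrt (Gag u)"
      using C(2) SV_Hdot[OF u] SVD(2)[OF u] by blast
    then show ?thesis
    proof eventually_elim
      case (elim x)
      then show ?case using mult_left_mono[OF Gag_le_nrm[OF u], of C] C(1) by auto
    qed
  qed
  then show ?thesis using C(1) c0_pos by (intro exI[of _ "C / sqrt c0"]) auto
qed

text \<open>The pointwise bound away from the origin gives convergence of the whole sequence, not
  merely of a subsequence; the radii 1/(k+1) exhaust the complement of 0.\<close>

lemma SV_AE_tendsto_zero:
  assumes X: "\<And>n. X n \<in> SV" and lim: "(\<lambda>n. nrm (X n)) \<longlonglongrightarrow> 0"
  shows "AE x in lborel. (\<lambda>n. X n x) \<longlonglongrightarrow> 0"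
proof -
  define P where "P k C \<longleftrightarrow> C > 0 \<and> (\<forall>u\<in>SV. AE x in lborel. 1 / real (Suc k) \<le> norm x \<longrightarrow> \<bar>u x\<bar> \<le> C * nrm u)"
    for k C
  have "\<forall>k. \<exists>C. P k C"
    unfolding P_def by (intro allI SV_pointwise) simp
  from choice[OF this] obtain C where "\<forall>k. P k (C k)" by (elim exE)
  then have C: "AE x in lborel. 1 / real (Suc k) \<le> norm x \<longrightarrow> \<bar>u x\<bar> \<le> C k * nrm u" if "u \<in> SV" for k u
    using that unfolding P_def by blast
  have "AE x in lborel. \<forall>k n. 1 / real (Suc k) \<le> norm x \<longrightarrow> \<bar>X n x\<bar> \<le> C k * nrm (X n)"
    unfolding AE_all_countable using C[OF X] by blast
  moreover have "AE x in lborel. x \<noteq> (0::real^'n)" by (rule AE_lborel_singleton)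
  ultimately show ?thesis
  proof eventually_elim
    case (elim x)
    obtain k where "1 / real (Suc k) < norm x"
      using reals_Archimedean[of "norm x"] elim(2) by (auto simp: inverse_eq_divide)
    then have "\<bar>X n x\<bar> \<le> C k * nrm (X n)" for n using elim(1) by auto
    then show ?case
      by (intro Lim_null_comparison[OF _ tendsto_mult_right_zero[OF lim, of "C k"]]) auto
  qed
qed

text \<open>Fatou's lemma is applied separately to the Gagliardo energy and to the potential term,
  each bounded by B^2; this costs a factor in the norm bound, which is harmless for membership and
  for convergence to 0.\<close>

lemma SV_Fatou:
  assumes X: "\<And>n. X n \<in> SV" and B: "\<And>n. nrm (X n) \<le> B"
    and lim: "AE x in lborel. (\<lambda>n. X n x) \<longlonglongrightarrow> u x"
    and [measurable]: "u \<in> borel_measurable borel" and rad: "radial u"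
  shows "u \<in> SV" "nrm u \<le> 2 * B"
proof -
  have meas [measurable]: "X n \<in> borel_measurable borel" for n using SVD(1)[OF X] .
  have B0: "B \<ge> 0" using B[of 0] nrm_nonneg[OF X, of 0] by linarith
  have ipB: "ip (X n) (X n) \<le> B\<^sup>2" for n
    using power_mono[OF B nrm_nonneg[OF X], of n 2] by (simp add: nrm_sq[OF X])
  have GB: "Gag (X n) \<le> B\<^sup>2 / c0" for n
    using order_trans[OF ip_self_ge(1)[OF X] ipB, of n] c0_pos by (simp add: field_simps)
  have 1: "(\<integral>\<^sup>+q. ennreal (gk u (fst q) (snd q)) \<partial>(lborel \<Otimes>\<^sub>M lborel)) \<le> ennreal (B\<^sup>2 / c0)"
  proof (rule nn_integral_Fatou_bound[where f = "\<lambda>n q. gk (X n) (fst q) (snd q)"])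
    show "AE q in lborel \<Otimes>\<^sub>M lborel. (\<lambda>n. gk (X n) (fst q) (snd q)) \<longlonglongrightarrow> gk u (fst q) (snd q)"
      using lborel_pair.AE_pair_both[OF lim lim]
    proof eventually_elim
      case (elim q)
      then show ?case unfolding gk_def divide_inverse by (intro tendsto_intros) auto
    qed
    show "(\<integral>\<^sup>+q. ennreal (gk (X n) (fst q) (snd q)) \<partial>(lborel \<Otimes>\<^sub>M lborel)) \<le> ennreal (B\<^sup>2 / c0)" for n
      using HdotD(2)[OF SV_Hdot[OF X], of n] GB[of n] unfolding gagliardo_gk by (simp add: ennreal_leI)
  qed measurable
  have 2: "(\<integral>\<^sup>+x. ennreal (V' x * (u x)\<^sup>2) \<partial>lborel) \<le> ennreal (B\<^sup>2)"
  proof (rule nn_integral_Fatou_bound[where f = "\<lambda>n x. V' x * (X n x)\<^sup>2"])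
    show "AE x in lborel. (\<lambda>n. V' x * (X n x)\<^sup>2) \<longlonglongrightarrow> V' x * (u x)\<^sup>2"
      using lim by eventually_elim (intro tendsto_intros, auto)
    show "(\<integral>\<^sup>+x. ennreal (V' x * (X n x)\<^sup>2) \<partial>lborel) \<le> ennreal (B\<^sup>2)" for n
      using order_trans[OF ip_self_ge(2)[OF X] ipB, of n]
      by (subst nn_integral_eq_integral[OF SVD(5)[OF X]]) (auto simp: V'_nonneg ennreal_leI)
  qed measurable
  obtain C0 where C0: "C0 > 0" "\<And>u::real^'n \<Rightarrow> real. u \<in> Hdot s \<Longrightarrow> Lp u powr (2 / p) \<le> C0 * Gag u"
    using Sobolev by blast
  \<comment> \<open>The norm does not contain the critical Lebesgue norm, so its uniform bound is
    supplied by the Sobolev inequality.\<close>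
  have 3: "(\<integral>\<^sup>+x. ennreal (\<bar>u x\<bar> powr p) \<partial>lborel) \<le> ennreal ((C0 * (B\<^sup>2 / c0)) powr (p / 2))"
  proof (rule nn_integral_Fatou_bound[where f = "\<lambda>n x. \<bar>X n x\<bar> powr p"])
    show "AE x in lborel. (\<lambda>n. \<bar>X n x\<bar> powr p) \<longlonglongrightarrow> \<bar>u x\<bar> powr p"
      using lim by eventually_elim (intro tendsto_powr2 tendsto_intros, use p_pos in auto)
    show "(\<integral>\<^sup>+x. ennreal (\<bar>X n x\<bar> powr p) \<partial>lborel) \<le> ennreal ((C0 * (B\<^sup>2 / c0)) powr (p / 2))" for n
    proof -
      have "Lp (X n) powr (2 / p) \<le> C0 * (B\<^sup>2 / c0)"
        using C0(2)[OF SV_Hdot[OF X]] mult_left_mono[OF GB, of C0 n] C0(1) by (meson less_imp_le order_trans)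
      then have "(Lp (X n) powr (2 / p)) powr (p / 2) \<le> (C0 * (B\<^sup>2 / c0)) powr (p / 2)"
        using p_pos by (intro powr_mono2) auto
      then have "Lp (X n) \<le> (C0 * (B\<^sup>2 / c0)) powr (p / 2)"
        using p_pos Lp_nonneg[of "X n"] by (simp add: powr_powr)
      then show ?thesis unfolding HdotD(3)[OF SV_Hdot[OF X]] by (rule ennreal_leI)
    qed
  qed measurable
  show uS: "u \<in> SV"
    unfolding SV_iff using 1 2 3 rad
    by (auto simp: integrable_nonneg_iff gk_nonneg V'_nonneg intro: le_less_trans[OF _ ennreal_less_top])
  have "ennreal (Gag u) \<le> ennreal (B\<^sup>2 / c0)"
    using 1 HdotD(2)[OF SV_Hdot[OF uS]] by (simp add: gagliardo_gk)
  then have "c0 * Gag u \<le> B\<^sup>2" using c0_pos by (subst (asm) ennreal_le_iff) (auto simp: field_simps)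
  moreover have "integral\<^sup>L lborel (\<lambda>x. V' x * (u x)\<^sup>2) \<le> B\<^sup>2"
    using 2 by (subst (asm) nn_integral_eq_integral[OF SVD(5)[OF uS]]) (auto simp: V'_nonneg)
  ultimately have "(nrm u)\<^sup>2 \<le> 2 * B\<^sup>2" by (simp add: nrm_sq[OF uS] ip_self[OF uS])
  also have "\<dots> \<le> (2 * B)\<^sup>2" by (simp add: power_mult_distrib)
  finally show "nrm u \<le> 2 * B" by (rule power2_le_imp_le) (use B0 in simp)
qed

lemma SV_compactness:
  fixes X :: "nat \<Rightarrow> real^'n \<Rightarrow> real"
  assumes X: "\<And>n. X n \<in> SV" and B: "\<And>n. nrm (X n) \<le> B"
  shows "\<exists>(r::nat \<Rightarrow> nat) u. strict_mono r \<and> u \<in> SV \<and> (AE x in lborel. (\<lambda>n. X (r n) x) \<longlonglongrightarrow> u x)"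
proof -
  have GB: "Gag (X n) \<le> B\<^sup>2 / c0" for n
  proof -
    have "c0 * Gag (X n) \<le> (nrm (X n))\<^sup>2" using ip_self_ge(1)[OF X, of n] by (simp add: nrm_sq[OF X])
    also have "\<dots> \<le> B\<^sup>2" using power_mono[OF B nrm_nonneg[OF X], of n 2] .
    finally show ?thesis using c0_pos by (simp add: field_simps)
  qed
  obtain r :: "nat \<Rightarrow> nat" where r: "strict_mono r" "AE x in lborel. convergent (\<lambda>n. X (r n) x)"
    using AE_convergent_subsequence[of X "B\<^sup>2 / c0"] SV_Hdot[OF X] SVD(2)[OF X] GB by blast
  \<comment> \<open>Where the sequence diverges, \<open>lim\<close> still depends only on the
    sequence of values, so \<open>u\<close> is radial at every point.\<close>
  define u where "u x = lim (\<lambda>n. X (r n) x)" for x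
  have [measurable]: "X n \<in> borel_measurable borel" for n using SVD(1)[OF X] .
  have um: "u \<in> borel_measurable borel" unfolding u_def[abs_def] by measurable
  have rad: "radial u"
    unfolding radial_def
  proof (intro allI impI)
    fix x y :: "real^'n" assume "norm x = norm y"
    then have "X n x = X n y" for n using SVD(2)[OF X] unfolding radial_def by blast
    then show "u x = u y" by (simp add: u_def)
  qed
  have lim: "AE x in lborel. (\<lambda>n. X (r n) x) \<longlonglongrightarrow> u x"
    using r(2) by eventually_elim (simp add: u_def convergent_LIMSEQ_iff)
  have "u \<in> SV" by (rule SV_Fatou(1)[OF _ _ lim um rad]) (rule X, rule B)
  then show ?thesis using r(1) lim by blast
qed

text \<open>A Cauchy sequence is bounded, so a subsequence converges almost everywhere to some
  \<open>u\<close>. Fatou applied to the differences X n - X m, with m running along the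
  subsequence, identifies \<open>u\<close> as the norm limit.\<close>

sublocale semi_hilbert SV ip
proof
  fix X :: "nat \<Rightarrow> real^'n \<Rightarrow> real"
  assume X: "\<And>n. X n \<in> SV" and C: "\<And>e. e > 0 \<Longrightarrow> \<exists>M. \<forall>m\<ge>M. \<forall>n\<ge>M. nrm (X m - X n) < e"
  obtain M where M: "\<And>m n. m \<ge> M \<Longrightarrow> n \<ge> M \<Longrightarrow> nrm (X m - X n) < 1" using C[of 1] by auto
  have "nrm (X (n + M)) \<le> nrm (X M) + 1" for n
    using nrm_diff_ge[OF X X, of "n + M" M] M[of "n + M" M] by simp
  then obtain r :: "nat \<Rightarrow> nat" and u where r: "strict_mono r" and u: "u \<in> SV"
      and lim: "AE x in lborel. (\<lambda>n. X (r n + M) x) \<longlonglongrightarrow> u x"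
    using SV_compactness[of "\<lambda>n. X (n + M)" "nrm (X M) + 1"] X by blast
  have "(\<lambda>n. nrm (X n - u)) \<longlonglongrightarrow> 0"
  proof (rule LIMSEQ_I)
    fix e :: real assume e: "e > 0"
    obtain K where K: "\<And>m n. m \<ge> K \<Longrightarrow> n \<ge> K \<Longrightarrow> nrm (X m - X n) < e / 4" using C[of "e / 4"] e by auto
    have "nrm (X n - u) < e" if n: "n \<ge> K" for n
    proof -
      have "nrm (X n - u) \<le> 2 * (e / 4)"
      \<comment> \<open>The shift by \<open>K\<close> puts all indices in the Cauchy range; the
        radius e/4 absorbs the factor 2 lost in \<open>SV_Fatou\<close>.\<close>
      proof (rule SV_Fatou(2)[where X = "\<lambda>m. X n - X (r (m + K) + M)"])
        show "X n - X (r (m + K) + M) \<in> SV" for m using X by (intro S_diff)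
        have "r (m + K) + M \<ge> K" for m using seq_suble[OF r, of "m + K"] by linarith
        then show "nrm (X n - X (r (m + K) + M)) \<le> e / 4" for m using K[OF n] by (simp add: less_imp_le)
        show "AE x in lborel. (\<lambda>m. (X n - X (r (m + K) + M)) x) \<longlonglongrightarrow> (X n - u) x"
          using lim
        proof eventually_elim
          case (elim x)
          from LIMSEQ_ignore_initial_segment[OF this, of K] show ?case by (auto intro!: tendsto_intros)
        qed
        show "X n - u \<in> borel_measurable borel" "radial (X n - u)"
          using SVD(1,2)[OF S_diff[OF X u]] by auto
      qed
      then show ?thesis using e by simp
    qed
    then show "\<exists>K. \<forall>n\<ge>K. norm (nrm (X n - u) - 0) < e"
      using nrm_nonneg[OF S_diff[OF X u]] by (intro exI[of _ K]) auto
  qed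
  then show "\<exists>x\<in>SV. (\<lambda>n. nrm (X n - x)) \<longlonglongrightarrow> 0" using u by blast
qed

end

section \<open>The nonlinear part of the functional\<close>

text \<open>\<open>small_ball\<close> and \<open>small_outside\<close> are the hypotheses on the
  suprema, extended from the unit sphere to all of \<open>SV\<close> by homogeneity. The outer
  radius can be placed beyond any given \<open>R1\<close>, so that an annulus remains between the
  two regions. The locale is instantiated with the truncated nonlinearity in the role of
  \<open>f\<close>.\<close>

locale frac_VK = frac_V n s N V c0 for n :: "'n::finite itself" and s N V c0 +
  fixes K f F :: "real \<Rightarrow> real" and q1 q2 Cf \<mu> :: real
  assumes K_cont: "continuous_on {0<..} K" and K_pos: "r > 0 \<Longrightarrow> K r > 0"
    and f_cont: "continuous_on UNIV f"
    and q1: "q1 > 2" and q2: "q2 > 2"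
    and Cf: "Cf > 0" and f_bound: "\<bar>f t\<bar> \<le> Cf * min (\<bar>t\<bar> powr (q1 - 1)) (\<bar>t\<bar> powr (q2 - 1))"
    and F_deriv: "(F has_real_derivative f t) (at t)" and F_zero: "F 0 = 0"
    and \<mu>2: "\<mu> > 2" and F_nonneg: "F t \<ge> 0" and F_AR: "\<mu> * F t \<le> f t * t"
    and small_ball: "\<epsilon> > 0 \<Longrightarrow> \<exists>R>0. \<forall>u\<in>SV.
      (\<integral>\<^sup>+x. ennreal ((if x = 0 then 0 else K (norm x)) * \<bar>u x\<bar> powr q1) * indicator (ball 0 R) (x::real^'n) \<partial>lborel)
        \<le> ennreal (\<epsilon> * nrm u powr q1)"
    and small_outside: "\<epsilon> > 0 \<Longrightarrow> \<exists>R>R1. \<forall>u\<in>SV.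
      (\<integral>\<^sup>+x. ennreal ((if x = 0 then 0 else K (norm x)) * \<bar>u x\<bar> powr q2) * indicator (- ball 0 R) (x::real^'n) \<partial>lborel)
        \<le> ennreal (\<epsilon> * nrm u powr q2)"
begin

definition K' :: "real^'n \<Rightarrow> real" where "K' x = (if x = 0 then 0 else K (norm x))"

lemma K'_measurable [measurable]: "K' \<in> borel_measurable borel"
proof -
  have [measurable]: "(\<lambda>x::real^'n. K (norm x)) \<in> borel_measurable borel"
    by (rule radial_continuous_measurable[OF K_cont])
  show ?thesis unfolding K'_def[abs_def] by measurable
qed

lemma K'_nonneg: "K' x \<ge> 0"
  using K_pos[of "norm x"] by (simp add: K'_def less_imp_le)

lemma f_measurable [measurable]: "f \<in> borel_measurable borel"
  using f_cont by (rule borel_measurable_continuous_onI)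

lemma F_measurable [measurable]: "F \<in> borel_measurable borel"
  using F_deriv by (intro borel_measurable_continuous_onI DERIV_continuous_on[where D = f]) (auto intro: has_field_derivative_at_within)

lemma K'_bounded: assumes "0 < a" shows "\<exists>k>0. \<forall>x. a \<le> norm x \<longrightarrow> norm x \<le> b \<longrightarrow> K' x \<le> k"
proof -
  have "bounded (K ` {a..b})"
    using assms by (intro compact_imp_bounded compact_continuous_image continuous_on_subset[OF K_cont]) auto
  then obtain k where k: "\<forall>t\<in>{a..b}. \<bar>K t\<bar> \<le> k" by (auto simp: bounded_iff)
  have "K' x \<le> max 1 k" if "a \<le> norm x" "norm x \<le> b" for x
  proof -
    have "x \<noteq> 0" using that assms by auto
    moreover have "\<bar>K (norm x)\<bar> \<le> k" using k that by auto
    ultimately show ?thesis by (simp add: K'_def)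
  qed
  then show ?thesis by (intro exI[of _ "max 1 k"]) auto
qed

text \<open>The growth bound of \<open>f\<close>, multiplied by \<open>|t|\<close>.\<close>

definition h :: "real \<Rightarrow> real" where "h t = min (\<bar>t\<bar> powr q1) (\<bar>t\<bar> powr q2)"

lemma h_nonneg: "h t \<ge> 0" by (simp add: h_def)

lemma h_measurable [measurable]: "h \<in> borel_measurable borel"
  unfolding h_def[abs_def] by measurable

lemma h_abs [simp]: "h \<bar>t\<bar> = h t" by (simp add: h_def)

lemma h_max: "h (max \<bar>a\<bar> \<bar>b\<bar>) \<le> h a + h b"
  using h_nonneg[of a] h_nonneg[of b] by (auto simp: max_def)

lemma min_powr_mult: "a \<ge> 0 \<Longrightarrow> min (a powr (q1 - 1)) (a powr (q2 - 1)) * a = h a"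
proof -
  assume a: "a \<ge> 0"
  have "a powr (q - 1) * a = a powr q" for q
    using a by (cases "a = 0") (auto simp: powr_diff)
  then show ?thesis using a by (simp add: h_def min_mult_distrib_right)
qed

lemma f_mult_le: assumes "\<bar>t\<bar> \<le> a" "\<bar>v\<bar> \<le> a" shows "\<bar>f t\<bar> * \<bar>v\<bar> \<le> Cf * h a"
proof -
  have a: "a \<ge> 0" using assms by linarith
  have "\<bar>f t\<bar> \<le> Cf * min (a powr (q1 - 1)) (a powr (q2 - 1))"
    using f_bound[of t] Cf assms q1 q2
    by (elim order_trans) (intro mult_left_mono min.mono powr_mono2, auto)
  then have "\<bar>f t\<bar> * \<bar>v\<bar> \<le> Cf * min (a powr (q1 - 1)) (a powr (q2 - 1)) * a"
    using assms Cf a by (intro mult_mono) auto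
  then show ?thesis using min_powr_mult[OF a] by (simp add: mult.assoc)
qed

lemma f_mult_le_h: "\<bar>f t * v\<bar> \<le> Cf * (h t + h v)"
proof -
  have "\<bar>f t\<bar> * \<bar>v\<bar> \<le> Cf * h (max \<bar>t\<bar> \<bar>v\<bar>)" by (rule f_mult_le) auto
  also have "\<dots> \<le> Cf * (h t + h v)" using Cf by (intro mult_left_mono h_max) auto
  finally show ?thesis by (simp add: abs_mult)
qed

text \<open>The bound is read off the Ambrosetti-Rabinowitz condition rather than obtained by
  integrating \<open>f\<close>.\<close>

lemma F_le_h: "F t \<le> Cf * h t"
proof -
  have "F t \<le> \<mu> * F t" using \<mu>2 F_nonneg[of t] mult_right_mono[of 1 \<mu> "F t"] by simp
  also have "\<dots> \<le> \<bar>f t\<bar> * \<bar>t\<bar>" using F_AR[of t] abs_ge_self[of "f t * t"] by (simp add: abs_mult)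
  also have "\<dots> \<le> Cf * h \<bar>t\<bar>" by (rule f_mult_le) auto
  finally show ?thesis by simp
qed

text \<open>Near 0 the power q1 and near infinity the power q2 is controlled by the smallness
  hypotheses with \<epsilon> = 1. On the annulus between them \<open>K\<close> is bounded and
  \<open>u\<close> is bounded by a multiple of its norm.\<close>

lemma h_integral_bound:
  "\<exists>C>0. \<forall>u\<in>SV. (\<integral>\<^sup>+x. ennreal (K' x * h (u x)) \<partial>lborel) \<le> ennreal (C * (nrm u powr q1 + nrm u powr q2))"
proof -
  obtain R1 where R1: "R1 > 0" "\<And>u. u \<in> SV \<Longrightarrow>
     (\<integral>\<^sup>+x. ennreal (K' x * \<bar>u x\<bar> powr q1) * indicator (ball 0 R1) x \<partial>lborel) \<le> ennreal (1 * nrm u powr q1)"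
    using small_ball[of 1] by (auto simp: K'_def)
  obtain R2 where R2: "R2 > R1" "\<And>u. u \<in> SV \<Longrightarrow>
     (\<integral>\<^sup>+x. ennreal (K' x * \<bar>u x\<bar> powr q2) * indicator (- ball 0 R2) x \<partial>lborel) \<le> ennreal (1 * nrm u powr q2)"
    using small_outside[of 1 R1] by (auto simp: K'_def)
  obtain k where k: "k > 0" "\<And>x. R1 \<le> norm x \<Longrightarrow> norm x \<le> R2 \<Longrightarrow> K' x \<le> k"
    using K'_bounded[OF R1(1), of R2] by blast
  obtain C where C: "C > 0" "\<And>u. u \<in> SV \<Longrightarrow> AE x in lborel. R1 \<le> norm x \<longrightarrow> \<bar>u x\<bar> \<le> C * nrm u"
    using SV_pointwise[OF R1(1)] by blast
  define c where "c = k * C powr q1 * vol R2"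
  have c: "c > 0" using k C R1 R2 by (simp add: c_def vol_pos)
  have "(\<integral>\<^sup>+x. ennreal (K' x * h (u x)) \<partial>lborel) \<le> ennreal ((1 + c) * (nrm u powr q1 + nrm u powr q2))"
    if u: "u \<in> SV" for u
  proof -
    note [measurable] = SVD(1)[OF u]
    have [measurable]: "ball (0::real^'n) R \<in> sets borel" for R by simp
    have "(\<integral>\<^sup>+x. ennreal (K' x * h (u x)) \<partial>lborel) \<le>
      (\<integral>\<^sup>+x. ennreal (K' x * \<bar>u x\<bar> powr q1) * indicator (ball 0 R1) x +
        (ennreal (K' x * \<bar>u x\<bar> powr q2) * indicator (- ball 0 R2) x +
         ennreal (k * (C * nrm u) powr q1) * indicator (ball 0 R2) x) \<partial>lborel)"
    proof (rule nn_integral_mono_AE)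
      show "AE x in lborel. ennreal (K' x * h (u x)) \<le> ennreal (K' x * \<bar>u x\<bar> powr q1) * indicator (ball 0 R1) x +
        (ennreal (K' x * \<bar>u x\<bar> powr q2) * indicator (- ball 0 R2) x +
         ennreal (k * (C * nrm u) powr q1) * indicator (ball 0 R2) x)"
        using C(2)[OF u]
      proof eventually_elim
        case (elim x)
        consider "norm x < R1" | "norm x \<ge> R2" | "R1 \<le> norm x" "norm x < R2" by linarith
        then show ?case
        proof cases
          case 1
          have "ennreal (K' x * h (u x)) \<le> ennreal (K' x * \<bar>u x\<bar> powr q1)"
            by (intro ennreal_leI mult_left_mono) (auto simp: h_def K'_nonneg)
          also have "\<dots> \<le> ennreal (K' x * \<bar>u x\<bar> powr q1) * indicator (ball 0 R1) x + y" for y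
            using 1 by simp
          finally show ?thesis .
        next
          case 2
          have "ennreal (K' x * h (u x)) \<le> ennreal (K' x * \<bar>u x\<bar> powr q2)"
            by (intro ennreal_leI mult_left_mono) (auto simp: h_def K'_nonneg)
          also have "\<dots> \<le> z + (ennreal (K' x * \<bar>u x\<bar> powr q2) * indicator (- ball 0 R2) x + y)" for y z
            using 2 by (simp add: add_increasing)
          finally show ?thesis .
        next
          case 3
          have "K' x * h (u x) \<le> k * (C * nrm u) powr q1"
          proof (intro mult_mono)
            have "h (u x) \<le> \<bar>u x\<bar> powr q1" by (simp add: h_def)
            also have "\<dots> \<le> (C * nrm u) powr q1" using 3 elim q1 by (intro powr_mono2) auto
            finally show "h (u x) \<le> (C * nrm u) powr q1" .
          qed (use 3 k h_nonneg in auto)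
          then have "ennreal (K' x * h (u x)) \<le> ennreal (k * (C * nrm u) powr q1)" by (rule ennreal_leI)
          also have "\<dots> \<le> z + (y + ennreal (k * (C * nrm u) powr q1) * indicator (ball 0 R2) x)" for y z
            using 3 by (simp add: add_increasing)
          finally show ?thesis .
        qed
      qed
    qed
    also have "\<dots> = (\<integral>\<^sup>+x. ennreal (K' x * \<bar>u x\<bar> powr q1) * indicator (ball 0 R1) x \<partial>lborel) +
        ((\<integral>\<^sup>+x. ennreal (K' x * \<bar>u x\<bar> powr q2) * indicator (- ball 0 R2) x \<partial>lborel) +
         (\<integral>\<^sup>+x. ennreal (k * (C * nrm u) powr q1) * indicator (ball 0 R2) (x::real^'n) \<partial>lborel))"
    proof -
      have "(\<integral>\<^sup>+y. f1 y + (f2 y + f3 y) \<partial>lborel)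
        = (\<integral>\<^sup>+y. f1 y \<partial>lborel) + ((\<integral>\<^sup>+y. f2 y \<partial>lborel) + (\<integral>\<^sup>+y. f3 y \<partial>lborel))"
        if [measurable]: "f1 \<in> borel_measurable borel" "f2 \<in> borel_measurable borel" "f3 \<in> borel_measurable borel"
        for f1 f2 f3 :: "real^'n \<Rightarrow> ennreal"
        by (simp add: nn_integral_add)
      then show ?thesis by this measurable
    qed
    also have "(\<integral>\<^sup>+x. ennreal (k * (C * nrm u) powr q1) * indicator (ball 0 R2) (x::real^'n) \<partial>lborel)
        = ennreal (k * (C * nrm u) powr q1) * ennreal (vol R2)"
      using R1(1) R2(1) by (subst nn_integral_cmult_indicator) (auto simp: emeasure_ball_vol)
    also have "\<dots> = ennreal (c * nrm u powr q1)"
      using C k vol_pos[of R2] R1(1) R2(1) nrm_nonneg[OF u]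
      by (simp add: c_def powr_mult ac_simps flip: ennreal_mult)
    finally have "(\<integral>\<^sup>+x. ennreal (K' x * h (u x)) \<partial>lborel)
        \<le> ennreal (1 * nrm u powr q1) + (ennreal (1 * nrm u powr q2) + ennreal (c * nrm u powr q1))"
      using add_mono[OF R1(2)[OF u] add_right_mono[OF R2(2)[OF u]]] by (rule order_trans)
    also have "\<dots> = ennreal (nrm u powr q1 + (nrm u powr q2 + c * nrm u powr q1))"
      using c by simp
    also have "\<dots> \<le> ennreal ((1 + c) * (nrm u powr q1 + nrm u powr q2))"
      using c by (intro ennreal_leI) (simp add: algebra_simps)
    finally show ?thesis .
  qed
  then show ?thesis using c by (intro exI[of _ "1 + c"]) auto
qed

lemma integrable_h: assumes u: "u \<in> SV" shows "integrable lborel (\<lambda>x. K' x * h (u x))"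
proof -
  note [measurable] = SVD(1)[OF u]
  obtain C where "(\<integral>\<^sup>+x. ennreal (K' x * h (u x)) \<partial>lborel) \<le> ennreal (C * (nrm u powr q1 + nrm u powr q2))"
    using h_integral_bound u by blast
  then have "(\<integral>\<^sup>+x. ennreal (K' x * h (u x)) \<partial>lborel) < \<infinity>"
    by (rule le_less_trans) simp
  then show ?thesis by (intro integrableI_nonneg) (auto simp: K'_nonneg h_nonneg)
qed

definition H :: "(real^'n \<Rightarrow> real) \<Rightarrow> real" where "H u = integral\<^sup>L lborel (\<lambda>x. K' x * h (u x))"

lemma H_bound: "\<exists>C>0. \<forall>u\<in>SV. H u \<le> C * (nrm u powr q1 + nrm u powr q2)"
proof -
  obtain C where C: "C > 0" "\<forall>u\<in>SV. (\<integral>\<^sup>+x. ennreal (K' x * h (u x)) \<partial>lborel) \<le> ennreal (C * (nrm u powr q1 + nrm u powr q2))"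
    using h_integral_bound by blast
  have "H u \<le> C * (nrm u powr q1 + nrm u powr q2)" if u: "u \<in> SV" for u
  proof -
    have "(\<integral>\<^sup>+x. ennreal (K' x * h (u x)) \<partial>lborel) = ennreal (H u)"
      unfolding H_def by (rule nn_integral_eq_integral[OF integrable_h[OF u]]) (simp add: K'_nonneg h_nonneg)
    then have "ennreal (H u) \<le> ennreal (C * (nrm u powr q1 + nrm u powr q2))" using C(2) u by auto
    then show ?thesis using C(1) by (subst (asm) ennreal_le_iff) auto
  qed
  then show ?thesis using C(1) by blast
qed

definition \<Phi> :: "(real^'n \<Rightarrow> real) \<Rightarrow> real" where "\<Phi> u = integral\<^sup>L lborel (\<lambda>x. K' x * F (u x))"

definition D :: "(real^'n \<Rightarrow> real) \<Rightarrow> (real^'n \<Rightarrow> real) \<Rightarrow> real" where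
  "D u v = integral\<^sup>L lborel (\<lambda>x. K' x * f (u x) * v x)"

lemma integrable_F: assumes u: "u \<in> SV" shows "integrable lborel (\<lambda>x. K' x * F (u x))"
proof -
  note [measurable] = SVD(1)[OF u]
  have int: "integrable lborel (\<lambda>x. Cf * (K' x * h (u x)))" using integrable_h[OF u] by simp
  have "K' x * F (u x) \<le> Cf * (K' x * h (u x))" for x
    using mult_left_mono[OF F_le_h[of "u x"] K'_nonneg[of x]] by (simp add: mult.left_commute)
  then have "AE x in lborel. norm (K' x * F (u x)) \<le> norm (Cf * (K' x * h (u x)))"
    using Cf by (simp add: K'_nonneg F_nonneg h_nonneg)
  then show ?thesis by (intro Bochner_Integration.integrable_bound[OF int]) measurable
qed

lemma Kfv_le: "\<bar>K' x * f (u x) * v x\<bar> \<le> Cf * (K' x * h (u x) + K' x * h (v x))"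
  using mult_left_mono[OF f_mult_le_h[of "u x" "v x"] K'_nonneg[of x]] K'_nonneg[of x]
  by (simp add: abs_mult algebra_simps)

lemma integrable_D: assumes u: "u \<in> SV" and v: "v \<in> SV" shows "integrable lborel (\<lambda>x. K' x * f (u x) * v x)"
proof -
  note [measurable] = SVD(1)[OF u] SVD(1)[OF v]
  have int: "integrable lborel (\<lambda>x. Cf * (K' x * h (u x) + K' x * h (v x)))"
    using integrable_h[OF u] integrable_h[OF v] by simp
  have "AE x in lborel. norm (K' x * f (u x) * v x) \<le> norm (Cf * (K' x * h (u x) + K' x * h (v x)))"
    using Kfv_le by (intro AE_I2) (metis abs_ge_self order_trans real_norm_def)
  then show ?thesis by (intro Bochner_Integration.integrable_bound[OF int]) measurable
qed

lemma D_le_H: assumes u: "u \<in> SV" and v: "v \<in> SV" shows "\<bar>D u v\<bar> \<le> Cf * (H u + H v)"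
proof -
  have "\<bar>D u v\<bar> \<le> (LINT x|lborel. \<bar>K' x * f (u x) * v x\<bar>)"
    unfolding D_def by (rule integral_abs_bound)
  also have "\<dots> \<le> (LINT x|lborel. Cf * (K' x * h (u x) + K' x * h (v x)))"
    using integrable_D[OF u v] integrable_h[OF u] integrable_h[OF v] Kfv_le by (intro integral_mono) auto
  also have "\<dots> = Cf * (H u + H v)" using integrable_h[OF u] integrable_h[OF v] by (simp add: H_def)
  finally show ?thesis .
qed

lemma D_additive: assumes "u \<in> SV" "v \<in> SV" "w \<in> SV" shows "D u (v + w) = D u v + D u w"
  using integrable_D[of u v] integrable_D[of u w] assms by (simp add: D_def distrib_left)

lemma D_homogeneous: "D u (c *\<^sub>R v) = c * D u v"
proof -
  have "(\<lambda>x. K' x * f (u x) * (c *\<^sub>R v) x) = (\<lambda>x. c * (K' x * f (u x) * v x))" by (auto simp: fun_eq_iff)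
  then show ?thesis by (simp add: D_def)
qed

text \<open>A vector of norm 0 has all its multiples in the unit ball, so a functional bounded there
  must vanish on it; other vectors are normalised.\<close>

lemma linear_bound_from_ball:
  assumes add: "\<And>c v. v \<in> SV \<Longrightarrow> L (c *\<^sub>R v) = c * L v" and b: "\<And>v. v \<in> SV \<Longrightarrow> nrm v \<le> 1 \<Longrightarrow> \<bar>L v\<bar> \<le> B"
    and v: "v \<in> SV"
  shows "\<bar>L v\<bar> \<le> B * nrm v"
proof (cases "nrm v = 0")
  case True
  have "L v = 0"
  proof (rule ccontr)
    assume "L v \<noteq> 0"
    have "\<bar>L (((B + 1) / L v) *\<^sub>R v)\<bar> \<le> B"
      using v True by (intro b) (auto simp: S_mem nrm_scale)
    then show False using add[OF v, of "(B + 1) / L v"] \<open>L v \<noteq> 0\<close> by simp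
  qed
  then show ?thesis using True by simp
next
  case False
  then have p: "nrm v > 0" using nrm_nonneg[OF v] by simp
  have "\<bar>L ((1 / nrm v) *\<^sub>R v)\<bar> \<le> B" using p v by (intro b) (auto simp: S_mem nrm_scale)
  then show ?thesis using add[OF v, of "1 / nrm v"] p by (simp add: abs_mult field_simps)
qed

lemma D_bounded: assumes u: "u \<in> SV" shows "\<exists>B. \<forall>v\<in>SV. \<bar>D u v\<bar> \<le> B * nrm v"
proof -
  obtain C where C: "C > 0" "\<forall>u\<in>SV. H u \<le> C * (nrm u powr q1 + nrm u powr q2)" using H_bound by blast
  have "\<bar>D u v\<bar> \<le> Cf * (H u + C * 2)" if v: "v \<in> SV" "nrm v \<le> 1" for v
  proof -
    have "nrm v powr q1 \<le> 1" "nrm v powr q2 \<le> 1"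
      using v nrm_nonneg[OF v(1)] q1 q2 by (auto intro!: powr_le1)
    then have "C * (nrm v powr q1 + nrm v powr q2) \<le> C * 2" using C by (intro mult_left_mono) auto
    then have "H v \<le> C * 2" using C(2) v(1) by fastforce
    then have "Cf * (H u + H v) \<le> Cf * (H u + C * 2)" using Cf by simp
    then show ?thesis using D_le_H[OF u v(1)] by linarith
  qed
  then have "\<bar>D u v\<bar> \<le> (Cf * (H u + C * 2)) * nrm v" if "v \<in> SV" for v
    using that by (intro linear_bound_from_ball[of "D u"]) (auto simp: D_homogeneous)
  then show ?thesis by blast
qed

lemma \<Phi>_AR: assumes u: "u \<in> SV" shows "\<mu> * \<Phi> u \<le> D u u"
proof -
  have "\<mu> * \<Phi> u = (LINT x|lborel. \<mu> * (K' x * F (u x)))" by (simp add: \<Phi>_def)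
  also have "\<dots> \<le> (LINT x|lborel. K' x * f (u x) * u x)"
  proof (rule integral_mono)
    show "\<mu> * (K' x * F (u x)) \<le> K' x * f (u x) * u x" for x
      using mult_left_mono[OF F_AR[of "u x"] K'_nonneg[of x]] by (simp add: algebra_simps)
  qed (use integrable_F[OF u] integrable_D[OF u u] in auto)
  finally show ?thesis by (simp add: D_def)
qed

text \<open>Yields a majorant of the difference quotients that is independent of \<open>r\<close>:
  the intermediate point has modulus at most |a| + |b|, hence at most twice the larger of the
  two.\<close>

lemma F_diff_le: assumes "\<bar>r\<bar> \<le> 1" shows "\<bar>F (a + r * b) - F a\<bar> \<le> \<bar>r\<bar> * (Cf * (h (2 * a) + h (2 * b)))"
proof -
  have mvt: "\<exists>z. \<bar>z - a\<bar> \<le> \<bar>d\<bar> \<and> F (a + d) - F a = d * f z" for d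
  proof (cases d "0::real" rule: linorder_cases)
    case less
    then obtain z where "a + d < z" "z < a" "F a - F (a + d) = (a - (a + d)) * f z"
      using MVT2[of "a + d" a F f] F_deriv by auto
    then show ?thesis by (intro exI[of _ z]) auto
  next
    case equal
    then show ?thesis by (intro exI[of _ a]) simp
  next
    case greater
    then obtain z where "a < z" "z < a + d" "F (a + d) - F a = (a + d - a) * f z"
      using MVT2[of a "a + d" F f] F_deriv by auto
    then show ?thesis by (intro exI[of _ z]) auto
  qed
  obtain z where z: "\<bar>z - a\<bar> \<le> \<bar>r * b\<bar>" "F (a + r * b) - F a = r * b * f z" using mvt by blast
  have rb: "\<bar>r * b\<bar> \<le> \<bar>b\<bar>" using assms mult_right_mono[of "\<bar>r\<bar>" 1 "\<bar>b\<bar>"] by (simp add: abs_mult)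
  have "\<bar>f z\<bar> * \<bar>b\<bar> \<le> Cf * h (max \<bar>2 * a\<bar> \<bar>2 * b\<bar>)"
    using z rb by (intro f_mult_le) auto
  also have "\<dots> \<le> Cf * (h (2 * a) + h (2 * b))" using Cf by (intro mult_left_mono h_max) auto
  finally have "\<bar>r\<bar> * (\<bar>f z\<bar> * \<bar>b\<bar>) \<le> \<bar>r\<bar> * (Cf * (h (2 * a) + h (2 * b)))" by (intro mult_left_mono) auto
  then show ?thesis unfolding z(2) by (simp add: abs_mult ac_simps)
qed

text \<open>Dominated convergence along sequences gives the derivative at 0 from an arbitrary base
  point; moving the base point along the line gives it at every t.\<close>

lemma \<Phi>_has_derivative: assumes u: "u \<in> SV" and v: "v \<in> SV"
  shows "((\<lambda>t. \<Phi> (u + t *\<^sub>R v)) has_real_derivative D (u + t *\<^sub>R v) v) (at t)"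
proof -
  have base: "((\<lambda>r. \<Phi> (w + r *\<^sub>R v)) has_real_derivative D w v) (at 0)" if w: "w \<in> SV" for w
    unfolding has_field_derivative_iff
  proof (rule tendsto_at_iff_sequentially[THEN iffD2], intro allI impI)
    note [measurable] = SVD(1)[OF w] SVD(1)[OF v]
    fix r :: "nat \<Rightarrow> real" assume r: "\<forall>i. r i \<in> UNIV - {0}" "r \<longlonglongrightarrow> 0"
    have "\<forall>\<^sub>F i in sequentially. dist (r i) 0 < 1" using r(2) by (rule tendstoD) simp
    then obtain n0 where "\<forall>i\<ge>n0. \<bar>r i\<bar> < 1" by (auto simp: eventually_sequentially)
    then have n0: "\<bar>r i\<bar> \<le> 1" if "i \<ge> n0" for i using that by (simp add: less_imp_le)
    define g where "g i x = K' x * ((F (w x + r i * v x) - F (w x)) / r i)" for i x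
    have w2: "2 *\<^sub>R w \<in> SV" "2 *\<^sub>R v \<in> SV" using w v by (auto intro: S_mem)
    define b where "b x = Cf * (K' x * h (2 * w x) + K' x * h (2 * v x))" for x
    have intb: "integrable lborel b"
      unfolding b_def[abs_def] using integrable_h[OF w2(1)] integrable_h[OF w2(2)] by simp
    have "(\<lambda>i. LINT x|lborel. g (i + n0) x) \<longlonglongrightarrow> (LINT x|lborel. K' x * f (w x) * v x)"
    proof (rule integral_dominated_convergence[OF _ _ intb])
      show "AE x in lborel. (\<lambda>i. g (i + n0) x) \<longlonglongrightarrow> K' x * f (w x) * v x"
      proof (rule AE_I2)
        fix x
        have "((\<lambda>t. F (w x + t * v x)) has_real_derivative f (w x + 0 * v x) * v x) (at 0)"
          by (rule DERIV_chain2[where f = F]) (use F_deriv in \<open>auto intro!: derivative_eq_intros\<close>)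
        then have "((\<lambda>t. (F (w x + t * v x) - F (w x)) / t) \<longlongrightarrow> f (w x) * v x) (at 0)"
          by (simp add: has_field_derivative_iff)
        then have "(\<lambda>i. (F (w x + r i * v x) - F (w x)) / r i) \<longlonglongrightarrow> f (w x) * v x"
          using r by (auto simp: tendsto_at_iff_sequentially o_def)
        then have "(\<lambda>i. g i x) \<longlonglongrightarrow> K' x * (f (w x) * v x)"
          unfolding g_def by (rule tendsto_mult_left)
        then show "(\<lambda>i. g (i + n0) x) \<longlonglongrightarrow> K' x * f (w x) * v x"
          using LIMSEQ_ignore_initial_segment[of "\<lambda>i. g i x" _ n0] by (simp add: mult.assoc)
      qed
      show "AE x in lborel. norm (g (i + n0) x) \<le> b x" for i
      proof (rule AE_I2)
        fix x
        let ?r = "r (i + n0)"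
        have "?r \<noteq> 0" using r(1) by auto
        then have "\<bar>(F (w x + ?r * v x) - F (w x)) / ?r\<bar> \<le> Cf * (h (2 * w x) + h (2 * v x))"
          using F_diff_le[OF n0, of "i + n0" "w x" "v x"] by (simp add: field_simps)
        from mult_left_mono[OF this K'_nonneg[of x]]
        have "K' x * \<bar>(F (w x + ?r * v x) - F (w x)) / ?r\<bar> \<le> b x"
          by (simp add: b_def algebra_simps)
        moreover have "norm (g (i + n0) x) = K' x * \<bar>(F (w x + ?r * v x) - F (w x)) / ?r\<bar>"
          using K'_nonneg[of x] unfolding g_def by (simp only: real_norm_def abs_mult abs_of_nonneg)
        ultimately show "norm (g (i + n0) x) \<le> b x" by simp
      qed
    qed (unfold g_def, measurable)
    then have "(\<lambda>i. LINT x|lborel. g i x) \<longlonglongrightarrow> D w v"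
      unfolding D_def by (rule LIMSEQ_offset)
    moreover have "(LINT x|lborel. g i x) = (\<Phi> (w + r i *\<^sub>R v) - \<Phi> (w + 0 *\<^sub>R v)) / (r i - 0)" for i
    proof -
      have "w + r i *\<^sub>R v \<in> SV" using w v by (intro S_mem)
      from integrable_F[OF this] integrable_F[OF w] show ?thesis
        by (simp add: g_def \<Phi>_def right_diff_distrib diff_divide_distrib)
    qed
    ultimately show "((\<lambda>y. (\<Phi> (w + y *\<^sub>R v) - \<Phi> (w + 0 *\<^sub>R v)) / (y - 0)) \<circ> r) \<longlonglongrightarrow> D w v"
      by (simp add: o_def)
  qed
  have "u + t *\<^sub>R v \<in> SV" using u v by (intro S_mem)
  from base[OF this] have "((\<lambda>r. \<Phi> (u + (r + t) *\<^sub>R v)) has_real_derivative D (u + t *\<^sub>R v) v) (at 0)"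
    by (simp add: algebra_simps)
  then show ?thesis using DERIV_shift[of "\<lambda>r. \<Phi> (u + r *\<^sub>R v)" "D (u + t *\<^sub>R v) v" 0 t] by simp
qed

section \<open>Compactness and uniform continuity of the derivative\<close>

lemma Kfv_ball:
  fixes q :: real
  assumes q: "q > 1" and f: "\<bar>f a\<bar> \<le> Cf * \<bar>a\<bar> powr (q - 1)" "\<bar>f b\<bar> \<le> Cf * \<bar>b\<bar> powr (q - 1)"
  shows "\<bar>(f a - f b) * c\<bar> \<le> Cf * (\<bar>a\<bar> powr q + \<bar>b\<bar> powr q + 2 * \<bar>c\<bar> powr q)"
proof -
  have young: "x powr (q - 1) * y \<le> x powr q + y powr q" if "x \<ge> 0" "y \<ge> 0" for x y :: real
  proof -
    define m where "m = max x y"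
    have "x powr (q - 1) * y \<le> m powr (q - 1) * m"
      using that q by (intro mult_mono powr_mono2) (auto simp: m_def)
    also have "\<dots> = m powr q" using that by (cases "m = 0") (auto simp: powr_diff m_def)
    also have "\<dots> \<le> x powr q + y powr q" by (simp add: m_def max_def)
    finally show ?thesis .
  qed
  have "\<bar>f a - f b\<bar> * \<bar>c\<bar> \<le> (Cf * \<bar>a\<bar> powr (q - 1) + Cf * \<bar>b\<bar> powr (q - 1)) * \<bar>c\<bar>"
    using f by (intro mult_right_mono) auto
  also have "\<dots> = Cf * (\<bar>a\<bar> powr (q - 1) * \<bar>c\<bar> + \<bar>b\<bar> powr (q - 1) * \<bar>c\<bar>)"
    by (simp add: algebra_simps)
  also have "\<dots> \<le> Cf * ((\<bar>a\<bar> powr q + \<bar>c\<bar> powr q) + (\<bar>b\<bar> powr q + \<bar>c\<bar> powr q))"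
    using Cf by (intro mult_left_mono add_mono young) auto
  also have "\<dots> = Cf * (\<bar>a\<bar> powr q + \<bar>b\<bar> powr q + 2 * \<bar>c\<bar> powr q)" by simp
  finally show ?thesis by (simp only: abs_mult)
qed

lemma f_bound1: "\<bar>f a\<bar> \<le> Cf * \<bar>a\<bar> powr (q1 - 1)" and f_bound2: "\<bar>f a\<bar> \<le> Cf * \<bar>a\<bar> powr (q2 - 1)"
  using f_bound[of a] Cf by (auto elim!: order_trans intro!: mult_left_mono)

text \<open>No convergence is involved: on a region where the weighted q-integrals are small
  relative to the norm, boundedness of the three functions suffices, uniformly in \<open>c\<close>.
  It is used near 0 with q1 and near infinity with q2.\<close>

lemma tail_estimate:
  fixes q :: real and B :: "(real^'n) set"
  assumes q: "q > 1" and f: "\<And>a. \<bar>f a\<bar> \<le> Cf * \<bar>a\<bar> powr (q - 1)" and [measurable]: "B \<in> sets borel"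
    and small: "\<And>w. w \<in> SV \<Longrightarrow> (\<integral>\<^sup>+x. ennreal (K' x * \<bar>w x\<bar> powr q) * indicator B x \<partial>lborel) \<le> ennreal (\<epsilon> * nrm w powr q)"
    and S: "a \<in> SV" "b \<in> SV" "c \<in> SV" and M: "nrm a \<le> M" "nrm b \<le> M" "nrm c \<le> 1" and \<epsilon>: "\<epsilon> > 0"
  shows "(\<integral>\<^sup>+x. ennreal (K' x * \<bar>(f (a x) - f (b x)) * c x\<bar>) * indicator B x \<partial>lborel) \<le> ennreal (Cf * \<epsilon> * (2 * M powr q + 2))"
proof -
  note [measurable] = SVD(1)[OF S(1)] SVD(1)[OF S(2)] SVD(1)[OF S(3)]
  let ?I = "\<lambda>w. (\<integral>\<^sup>+x. ennreal (K' x * \<bar>w x\<bar> powr q) * indicator B x \<partial>lborel)"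
  have "(\<integral>\<^sup>+x. ennreal (K' x * \<bar>(f (a x) - f (b x)) * c x\<bar>) * indicator B x \<partial>lborel)
    \<le> (\<integral>\<^sup>+x. ennreal Cf * (ennreal (K' x * \<bar>a x\<bar> powr q) * indicator B x + (ennreal (K' x * \<bar>b x\<bar> powr q) * indicator B x
        + 2 * (ennreal (K' x * \<bar>c x\<bar> powr q) * indicator B x))) \<partial>lborel)"
  proof (rule nn_integral_mono)
    fix x
    have "K' x * \<bar>(f (a x) - f (b x)) * c x\<bar> \<le> K' x * (Cf * (\<bar>a x\<bar> powr q + \<bar>b x\<bar> powr q + 2 * \<bar>c x\<bar> powr q))"
      by (intro mult_left_mono Kfv_ball q f K'_nonneg)
    then have "ennreal (K' x * \<bar>(f (a x) - f (b x)) * c x\<bar>) \<le>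
      ennreal (Cf * (K' x * \<bar>a x\<bar> powr q + (K' x * \<bar>b x\<bar> powr q + 2 * (K' x * \<bar>c x\<bar> powr q))))"
      by (intro ennreal_leI) (simp add: algebra_simps)
    also have "\<dots> = ennreal Cf * (ennreal (K' x * \<bar>a x\<bar> powr q) + (ennreal (K' x * \<bar>b x\<bar> powr q)
        + 2 * ennreal (K' x * \<bar>c x\<bar> powr q)))"
      using Cf K'_nonneg[of x] by (simp add: ennreal_mult'[of Cf] ennreal_mult'[of 2])
    finally show "ennreal (K' x * \<bar>(f (a x) - f (b x)) * c x\<bar>) * indicator B x \<le>
       ennreal Cf * (ennreal (K' x * \<bar>a x\<bar> powr q) * indicator B x + (ennreal (K' x * \<bar>b x\<bar> powr q) * indicator B x
        + 2 * (ennreal (K' x * \<bar>c x\<bar> powr q) * indicator B x)))"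
      by (cases "x \<in> B") auto
  qed
  also have "\<dots> = ennreal Cf * (?I a + (?I b + 2 * ?I c))"
  proof -
    have "(\<integral>\<^sup>+y. ennreal Cf * (f1 y + (f2 y + 2 * f3 y)) \<partial>lborel)
      = ennreal Cf * ((\<integral>\<^sup>+y. f1 y \<partial>lborel) + ((\<integral>\<^sup>+y. f2 y \<partial>lborel) + 2 * (\<integral>\<^sup>+y. f3 y \<partial>lborel)))"
      if [measurable]: "f1 \<in> borel_measurable borel" "f2 \<in> borel_measurable borel" "f3 \<in> borel_measurable borel"
      for f1 f2 f3 :: "real^'n \<Rightarrow> ennreal"
      by (simp add: nn_integral_add nn_integral_cmult)
    then show ?thesis by this measurable
  qed
  also have "\<dots> \<le> ennreal Cf * (ennreal (\<epsilon> * M powr q) + (ennreal (\<epsilon> * M powr q) + 2 * ennreal (\<epsilon> * 1)))"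
  proof (intro mult_left_mono add_mono)
    have le: "?I w \<le> ennreal (\<epsilon> * L powr q)" if "w \<in> SV" "nrm w \<le> L" for w L
    proof -
      have "\<epsilon> * nrm w powr q \<le> \<epsilon> * L powr q"
        using that nrm_nonneg[OF that(1)] q \<epsilon> by (intro mult_left_mono powr_mono2) auto
      then show ?thesis using small[OF that(1)] by (meson ennreal_leI order_trans)
    qed
    show "?I a \<le> ennreal (\<epsilon> * M powr q)" "?I b \<le> ennreal (\<epsilon> * M powr q)" "?I c \<le> ennreal (\<epsilon> * 1)"
      using le[OF S(1) M(1)] le[OF S(2) M(2)] le[OF S(3) M(3)] by simp_all
  qed auto
  also have "\<dots> = ennreal (Cf * \<epsilon> * (2 * M powr q + 2))"
  proof -
    define y where "y = \<epsilon> * M powr q + (\<epsilon> * M powr q + 2 * (\<epsilon> * 1))"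
    have "ennreal (a + (b + 2 * c)) = ennreal a + (ennreal b + 2 * ennreal c)"
      if "a \<ge> 0" "b \<ge> 0" "c \<ge> 0" for a b c :: real
      using that by (simp add: ennreal_mult'[of 2])
    then have "ennreal y = ennreal (\<epsilon> * M powr q) + (ennreal (\<epsilon> * M powr q) + 2 * ennreal (\<epsilon> * 1))"
      using \<epsilon> unfolding y_def by (metis less_imp_le mult_nonneg_nonneg powr_ge_zero zero_le_one)
    moreover have e: "Cf * \<epsilon> * (2 * M powr q + 2) = Cf * y" by (simp add: y_def algebra_simps)
    ultimately show ?thesis unfolding e using ennreal_mult'[of Cf y] Cf by simp
  qed
  finally show ?thesis .
qed

text \<open>On an annulus both \<open>K\<close> and the bounded sequence are bounded, so dominated
  convergence applies. The test function is left out; it is bounded there by a multiple of its norm,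
  which makes the later estimate uniform.\<close>

lemma annulus_convergence:
  assumes X: "\<And>k::nat. X k \<in> SV" "\<And>k. nrm (X k) \<le> M" and u: "u \<in> SV" "nrm u \<le> M"
    and lim: "AE x in lborel. (\<lambda>k. X k x) \<longlonglongrightarrow> u x" and R: "0 < R1"
  shows "(\<lambda>k. LINT x|lborel. indicator (ball 0 R2 - ball 0 R1) x * (K' x * \<bar>f (X k x) - f (u x)\<bar>)) \<longlonglongrightarrow> 0"
    "\<And>k. integrable lborel (\<lambda>x. indicator (ball 0 R2 - ball 0 R1) x * (K' x * \<bar>f (X k x) - f (u x)\<bar>))"
proof -
  let ?A = "ball (0::real^'n) R2 - ball 0 R1"
  have [measurable]: "X k \<in> borel_measurable borel" "u \<in> borel_measurable borel" for k
    using SVD(1) X(1) u(1) by auto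
  have [measurable]: "?A \<in> sets borel" by simp
  obtain C where C: "C > 0" "\<And>w. w \<in> SV \<Longrightarrow> AE x in lborel. R1 \<le> norm x \<longrightarrow> \<bar>w x\<bar> \<le> C * nrm w"
    using SV_pointwise[OF R] by blast
  obtain k where k: "k > 0" "\<And>x. R1 \<le> norm x \<Longrightarrow> norm x \<le> R2 \<Longrightarrow> K' x \<le> k"
    using K'_bounded[OF R, of R2] by blast
  define T where "T = Cf * (C * M) powr (q1 - 1)"
  have fT: "AE x in lborel. R1 \<le> norm x \<longrightarrow> \<bar>f (w x)\<bar> \<le> T" if w: "w \<in> SV" "nrm w \<le> M" for w
    using C(2)[OF w(1)]
  proof eventually_elim
    case (elim x)
    show ?case
    proof
      assume "R1 \<le> norm x"
      then have "\<bar>w x\<bar> \<le> C * M" using elim w C(1) by (meson mult_left_mono less_imp_le order_trans)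
      then have "\<bar>w x\<bar> powr (q1 - 1) \<le> (C * M) powr (q1 - 1)" using q1 by (intro powr_mono2) auto
      then show "\<bar>f (w x)\<bar> \<le> T" using f_bound1[of "w x"] Cf unfolding T_def
        by (meson mult_left_mono less_imp_le order_trans)
    qed
  qed
  have w: "integrable lborel (\<lambda>x::real^'n. indicator (ball 0 R2) x * (k * (2 * T)))"
  proof (cases "R2 \<ge> 0")
    case True
    then show ?thesis by (rule integrable_ball_const)
  next
    case False
    then have e: "ball (0::real^'n) R2 = {}" by simp
    show ?thesis unfolding e by simp
  qed
  have lim0: "AE x in lborel. (\<lambda>j. indicator ?A x * (K' x * \<bar>f (X j x) - f (u x)\<bar>)) \<longlonglongrightarrow> 0"
    using lim
  proof eventually_elim
    case (elim x)
    have "(\<lambda>j. f (X j x)) \<longlonglongrightarrow> f (u x)"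
      using f_cont elim by (intro isCont_tendsto_compose[where g = f]) (auto simp: continuous_on_eq_continuous_at)
    then have "(\<lambda>j. f (X j x) - f (u x)) \<longlonglongrightarrow> 0" by (simp add: LIM_zero)
    then have "(\<lambda>j. \<bar>f (X j x) - f (u x)\<bar>) \<longlonglongrightarrow> 0" by (simp add: tendsto_rabs_zero)
    then show ?case by (intro tendsto_mult_right_zero)
  qed
  have bound: "AE x in lborel. norm (indicator ?A x * (K' x * \<bar>f (X j x) - f (u x)\<bar>)) \<le> indicator (ball 0 R2) x * (k * (2 * T))" for j
    using fT[OF X(1) X(2), of j] fT[OF u]
  proof eventually_elim
    case (elim x)
    show ?case
    proof (cases "x \<in> ?A")
      case True
      then have "R1 \<le> norm x" "norm x \<le> R2" by auto
      then have "K' x * \<bar>f (X j x) - f (u x)\<bar> \<le> k * (2 * T)"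
        using elim k(1) k(2)[of x] by (intro mult_mono) auto
      then show ?thesis using True K'_nonneg[of x] by simp
    next
      case False
      have "0 \<le> T" using Cf by (simp add: T_def)
      then show ?thesis using False k(1) by (simp add: indicator_def)
    qed
  qed
  have meas: "(\<lambda>x. indicator ?A x * (K' x * \<bar>f (X j x) - f (u x)\<bar>)) \<in> borel_measurable lborel" for j
    by measurable
  show "integrable lborel (\<lambda>x. indicator ?A x * (K' x * \<bar>f (X j x) - f (u x)\<bar>))" for j
    by (rule integrable_dominated_convergence2[OF _ meas w lim0 bound]) simp
  show "(\<lambda>j. LINT x|lborel. indicator ?A x * (K' x * \<bar>f (X j x) - f (u x)\<bar>)) \<longlonglongrightarrow> 0"
    using integral_dominated_convergence[OF _ meas w lim0 bound] by simp
qed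

text \<open>Almost everywhere convergence of a bounded sequence already gives convergence of the
  derivatives in the dual norm: two tails and an annulus contribute a third of \<epsilon>
  each.\<close>

lemma D_converges:
  assumes X: "\<And>k::nat. X k \<in> SV" "\<And>k. nrm (X k) \<le> M" and u: "u \<in> SV"
    and lim: "AE x in lborel. (\<lambda>k. X k x) \<longlonglongrightarrow> u x" and \<epsilon>: "\<epsilon> > 0"
  shows "\<exists>k0. \<forall>k\<ge>k0. \<forall>v\<in>SV. \<bar>D (X k) v - D u v\<bar> \<le> \<epsilon> * nrm v"
proof -
  define L where "L = max M (nrm u)"
  have L: "nrm (X k) \<le> L" "nrm u \<le> L" for k using X(2)[of k] by (auto simp: L_def)
  have [measurable]: "X k \<in> borel_measurable borel" "u \<in> borel_measurable borel" for k
    using SVD(1) X(1) u(1) by auto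
  \<comment> \<open>Inverts the constant of \<open>tail_estimate\<close>, with \<open>L\<close>
    bounding the sequence and its limit.\<close>
  define \<epsilon>1 where "\<epsilon>1 = \<epsilon> / 3 / (Cf * (2 * L powr q1 + 2))"
  define \<epsilon>2 where "\<epsilon>2 = \<epsilon> / 3 / (Cf * (2 * L powr q2 + 2))"
  have pos: "Cf * (2 * L powr q + 2) > 0" for q using Cf powr_ge_zero[of L q] by (intro mult_pos_pos) linarith+
  have \<epsilon>12: "\<epsilon>1 > 0" "\<epsilon>2 > 0" using \<epsilon> pos by (auto simp: \<epsilon>1_def \<epsilon>2_def)
  have \<epsilon>eq: "Cf * \<epsilon>1 * (2 * L powr q1 + 2) = \<epsilon> / 3" "Cf * \<epsilon>2 * (2 * L powr q2 + 2) = \<epsilon> / 3"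
    using pos[of q1] pos[of q2] unfolding \<epsilon>1_def \<epsilon>2_def by (auto simp: field_simps)
  obtain R1 where R1: "R1 > 0" "\<And>w. w \<in> SV \<Longrightarrow>
     (\<integral>\<^sup>+x. ennreal (K' x * \<bar>w x\<bar> powr q1) * indicator (ball 0 R1) x \<partial>lborel) \<le> ennreal (\<epsilon>1 * nrm w powr q1)"
    using small_ball[OF \<epsilon>12(1)] by (auto simp: K'_def)
  obtain R2 where R2: "R2 > R1" "\<And>w. w \<in> SV \<Longrightarrow>
     (\<integral>\<^sup>+x. ennreal (K' x * \<bar>w x\<bar> powr q2) * indicator (- ball 0 R2) x \<partial>lborel) \<le> ennreal (\<epsilon>2 * nrm w powr q2)"
    using small_outside[OF \<epsilon>12(2), of R1] by (auto simp: K'_def)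
  let ?A = "ball (0::real^'n) R2 - ball 0 R1"
  have [measurable]: "?A \<in> sets borel" "ball (0::real^'n) R1 \<in> sets borel" "- ball (0::real^'n) R2 \<in> sets borel" by auto
  obtain C where C: "C > 0" "\<And>w. w \<in> SV \<Longrightarrow> AE x in lborel. R1 \<le> norm x \<longrightarrow> \<bar>w x\<bar> \<le> C * nrm w"
    using SV_pointwise[OF R1(1)] by blast
  define J where "J k = (LINT x|lborel. indicator ?A x * (K' x * \<bar>f (X k x) - f (u x)\<bar>))" for k
  have "J \<longlonglongrightarrow> 0"
    unfolding J_def[abs_def] by (rule annulus_convergence(1)[OF X(1) L(1) u L(2) lim R1(1)])
  then have "\<forall>\<^sub>F k in sequentially. J k < \<epsilon> / 3 / C" using \<epsilon> C(1) by (intro order_tendstoD(2)) auto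
  then obtain k0 where k0: "\<forall>k\<ge>k0. J k < \<epsilon> / 3 / C" by (auto simp: eventually_sequentially)
  note intA = annulus_convergence(2)[OF X(1) L(1) u L(2) lim R1(1)]
  have "\<bar>D (X k) v - D u v\<bar> \<le> \<epsilon>" if k: "k \<ge> k0" and v: "v \<in> SV" "nrm v \<le> 1" for k v
  proof -
    have [measurable]: "v \<in> borel_measurable borel" using SVD(1)[OF v(1)] .
    let ?g = "\<lambda>x. K' x * \<bar>(f (X k x) - f (u x)) * v x\<bar>"
    have eq: "(\<lambda>x. K' x * f (X k x) * v x - K' x * f (u x) * v x) = (\<lambda>x. K' x * ((f (X k x) - f (u x)) * v x))"
      by (auto simp: fun_eq_iff algebra_simps)
    have int: "integrable lborel (\<lambda>x. K' x * ((f (X k x) - f (u x)) * v x))"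
      using Bochner_Integration.integrable_diff[OF integrable_D[OF X(1)[of k] v(1)] integrable_D[OF u v(1)]] unfolding eq .
    have "D (X k) v - D u v = (LINT x|lborel. K' x * ((f (X k x) - f (u x)) * v x))"
      unfolding D_def eq[symmetric]
      by (rule Bochner_Integration.integral_diff[symmetric, OF integrable_D[OF X(1) v(1)] integrable_D[OF u v(1)]])
    then have "ennreal \<bar>D (X k) v - D u v\<bar> \<le> (\<integral>\<^sup>+x. ennreal (?g x) \<partial>lborel)"
      using integral_norm_bound_ennreal[OF int] K'_nonneg by (simp add: abs_mult)
    also have "\<dots> \<le> (\<integral>\<^sup>+x. ennreal (?g x) * indicator (ball 0 R1) x + (ennreal (?g x) * indicator (- ball 0 R2) x
        + ennreal C * ennreal (indicator ?A x * (K' x * \<bar>f (X k x) - f (u x)\<bar>))) \<partial>lborel)"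
    proof (rule nn_integral_mono_AE)
      show "AE x in lborel. ennreal (?g x) \<le> ennreal (?g x) * indicator (ball 0 R1) x + (ennreal (?g x) * indicator (- ball 0 R2) x
        + ennreal C * ennreal (indicator ?A x * (K' x * \<bar>f (X k x) - f (u x)\<bar>)))"
        using C(2)[OF v(1)]
      proof eventually_elim
        case (elim x)
        consider "norm x < R1" | "norm x \<ge> R2" | "R1 \<le> norm x" "norm x < R2" by linarith
        then show ?case
        proof cases
          case 3
          have "\<bar>v x\<bar> \<le> C * 1" using elim 3 v(2) C(1) by (meson mult_left_mono less_imp_le order_trans)
          then have "?g x \<le> C * (K' x * \<bar>f (X k x) - f (u x)\<bar>)"
            using K'_nonneg[of x] mult_right_mono[of "\<bar>v x\<bar>" C "K' x * \<bar>f (X k x) - f (u x)\<bar>"]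
            by (simp add: abs_mult mult.left_commute mult.commute)
          then have "ennreal (?g x) \<le> ennreal C * ennreal (K' x * \<bar>f (X k x) - f (u x)\<bar>)"
            using C(1) by (subst ennreal_mult'[symmetric]) (auto intro: ennreal_leI)
          then show ?thesis using 3 by (simp add: add_increasing)
        qed (simp_all add: add_increasing)
      qed
    qed
    also have "\<dots> = (\<integral>\<^sup>+x. ennreal (?g x) * indicator (ball 0 R1) x \<partial>lborel) +
      ((\<integral>\<^sup>+x. ennreal (?g x) * indicator (- ball 0 R2) x \<partial>lborel) +
       ennreal C * (\<integral>\<^sup>+x. ennreal (indicator ?A x * (K' x * \<bar>f (X k x) - f (u x)\<bar>)) \<partial>lborel))"
    proof -
      have "(\<integral>\<^sup>+y. f1 y + (f2 y + ennreal C * f3 y) \<partial>lborel)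
        = (\<integral>\<^sup>+y. f1 y \<partial>lborel) + ((\<integral>\<^sup>+y. f2 y \<partial>lborel) + ennreal C * (\<integral>\<^sup>+y. f3 y \<partial>lborel))"
        if [measurable]: "f1 \<in> borel_measurable borel" "f2 \<in> borel_measurable borel" "f3 \<in> borel_measurable borel"
        for f1 f2 f3 :: "real^'n \<Rightarrow> ennreal"
        by (simp add: nn_integral_add nn_integral_cmult)
      then show ?thesis by this measurable
    qed
    also have "(\<integral>\<^sup>+x. ennreal (indicator ?A x * (K' x * \<bar>f (X k x) - f (u x)\<bar>)) \<partial>lborel) = ennreal (J k)"
      unfolding J_def by (rule nn_integral_eq_integral[OF intA]) (simp add: K'_nonneg)
    also have "(\<integral>\<^sup>+x. ennreal (?g x) * indicator (ball 0 R1) x \<partial>lborel) +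
      ((\<integral>\<^sup>+x. ennreal (?g x) * indicator (- ball 0 R2) x \<partial>lborel) + ennreal C * ennreal (J k))
      \<le> ennreal (\<epsilon> / 3) + (ennreal (\<epsilon> / 3) + ennreal (\<epsilon> / 3))"
    proof (intro add_mono)
      show "(\<integral>\<^sup>+x. ennreal (?g x) * indicator (ball 0 R1) x \<partial>lborel) \<le> ennreal (\<epsilon> / 3)"
        unfolding \<epsilon>eq(1)[symmetric] by (rule tail_estimate[OF _ f_bound1 _ R1(2) X(1) u v(1) L v(2) \<epsilon>12(1)]) (use q1 in auto)
      show "(\<integral>\<^sup>+x. ennreal (?g x) * indicator (- ball 0 R2) x \<partial>lborel) \<le> ennreal (\<epsilon> / 3)"
        unfolding \<epsilon>eq(2)[symmetric] by (rule tail_estimate[OF _ f_bound2 _ R2(2) X(1) u v(1) L v(2) \<epsilon>12(2)]) (use q2 in auto)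
      have "C * J k \<le> \<epsilon> / 3" using k0 k C(1) by (simp add: field_simps less_imp_le)
      then show "ennreal C * ennreal (J k) \<le> ennreal (\<epsilon> / 3)"
        using C(1) by (subst ennreal_mult'[symmetric]) (auto intro: ennreal_leI)
    qed
    also have "\<dots> = ennreal \<epsilon>" using \<epsilon> by (simp flip: ennreal_plus)
    finally show ?thesis using \<epsilon> by simp
  qed
  then have "\<bar>D (X k) v - D u v\<bar> \<le> \<epsilon> * nrm v" if "k \<ge> k0" "v \<in> SV" for k v
    using that by (intro linear_bound_from_ball[of "\<lambda>v. D (X k) v - D u v"]) (auto simp: D_homogeneous right_diff_distrib)
  then show ?thesis by blast
qed

lemma D_compactness:
  fixes X :: "nat \<Rightarrow> real^'n \<Rightarrow> real"
  assumes X: "\<And>k. X k \<in> SV" "\<And>k. nrm (X k) \<le> R"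
  shows "\<exists>r::nat \<Rightarrow> nat. strict_mono r \<and> (\<forall>\<epsilon>>0. \<exists>M. \<forall>m\<ge>M. \<forall>n\<ge>M. \<forall>v\<in>SV.
          \<bar>D (X (r m)) v - D (X (r n)) v\<bar> \<le> \<epsilon> * nrm v)"
proof -
  obtain r :: "nat \<Rightarrow> nat" and u where r: "strict_mono r" "u \<in> SV" "AE x in lborel. (\<lambda>k. X (r k) x) \<longlonglongrightarrow> u x"
    using SV_compactness[of X R] X by blast
  have "\<exists>M. \<forall>m\<ge>M. \<forall>n\<ge>M. \<forall>v\<in>SV. \<bar>D (X (r m)) v - D (X (r n)) v\<bar> \<le> \<epsilon> * nrm v" if "\<epsilon> > 0" for \<epsilon>
  proof -
    have "\<epsilon> / 2 > 0" using that by simp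
    from D_converges[OF X(1) X(2) r(2,3) this] obtain k0
      where k0: "\<forall>k\<ge>k0. \<forall>v\<in>SV. \<bar>D (X (r k)) v - D u v\<bar> \<le> \<epsilon> / 2 * nrm v" by blast
    have "\<bar>D (X (r m)) v - D (X (r n)) v\<bar> \<le> \<epsilon> * nrm v" if "m \<ge> k0" "n \<ge> k0" "v \<in> SV" for m n v
    proof -
      have "\<epsilon> / 2 * nrm v = \<epsilon> * nrm v / 2" by simp
      then show ?thesis using k0[rule_format, OF that(1,3)] k0[rule_format, OF that(2,3)] by linarith
    qed
    then show ?thesis by blast
  qed
  then show ?thesis using r(1) by blast
qed

text \<open>By contradiction: violating pairs at vanishing distance have, along a subsequence, the
  same almost everywhere limit, so by \<open>D_converges\<close> both derivatives approach the
  derivative at that limit.\<close>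

lemma D_uniformly_continuous:
  assumes \<epsilon>: "\<epsilon> > 0"
  shows "\<exists>\<delta>>0. \<forall>u\<in>SV. \<forall>w\<in>SV. nrm u \<le> R \<longrightarrow> nrm w \<le> R \<longrightarrow> nrm (u - w) < \<delta> \<longrightarrow>
        (\<forall>v\<in>SV. \<bar>D u v - D w v\<bar> \<le> \<epsilon> * nrm v)"
proof (rule ccontr)
  assume neg: "\<not> ?thesis"
  define P where "P k u w v \<longleftrightarrow> u \<in> SV \<and> w \<in> SV \<and> nrm u \<le> R \<and> nrm w \<le> R \<and> nrm (u - w) < inverse (real (Suc k)) \<and>
      v \<in> SV \<and> \<bar>D u v - D w v\<bar> > \<epsilon> * nrm v" for k :: nat and u w v
  have "\<forall>k. \<exists>u w v. P k u w v"
  proof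
    fix k :: nat
    have "inverse (real (Suc k)) > 0" by simp
    then show "\<exists>u w v. P k u w v" using neg unfolding P_def not_le[symmetric] by blast
  qed
  then obtain U W Z where "\<forall>k. P k (U k) (W k) (Z k)" by metis
  then have U: "U k \<in> SV" "nrm (U k) \<le> R" and W: "W k \<in> SV" "nrm (W k) \<le> R" and Z: "Z k \<in> SV"
    and d: "nrm (U k - W k) < inverse (real (Suc k))" and big: "\<bar>D (U k) (Z k) - D (W k) (Z k)\<bar> > \<epsilon> * nrm (Z k)" for k
    unfolding P_def by auto
  obtain r :: "nat \<Rightarrow> nat" and u where r: "strict_mono r" "u \<in> SV" "AE x in lborel. (\<lambda>k. U (r k) x) \<longlonglongrightarrow> u x"
    using SV_compactness[of U R] U by blast
  have "(\<lambda>k. nrm (U k - W k)) \<longlonglongrightarrow> 0"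
    by (rule Lim_null_comparison[OF _ LIMSEQ_inverse_real_of_nat])
      (use d nrm_nonneg[OF S_diff[OF U(1) W(1)]] in \<open>auto simp: less_imp_le\<close>)
  from LIMSEQ_subseq_LIMSEQ[OF this r(1)] have "(\<lambda>k. nrm (U (r k) - W (r k))) \<longlonglongrightarrow> 0" by (simp add: o_def)
  then have "AE x in lborel. (\<lambda>k. (U (r k) - W (r k)) x) \<longlonglongrightarrow> 0"
    by (intro SV_AE_tendsto_zero S_diff U W)
  then have wl: "AE x in lborel. (\<lambda>k. W (r k) x) \<longlonglongrightarrow> u x"
    using r(3)
  proof eventually_elim
    case (elim x)
    from tendsto_diff[OF elim(2) elim(1)] show ?case by simp
  qed
  have e2: "\<epsilon> / 2 > 0" using \<epsilon> by simp
  obtain k1 where k1: "\<forall>k\<ge>k1. \<forall>v\<in>SV. \<bar>D (U (r k)) v - D u v\<bar> \<le> \<epsilon> / 2 * nrm v"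
    using D_converges[OF U(1) U(2) r(2,3) e2] by blast
  obtain k2 where k2: "\<forall>k\<ge>k2. \<forall>v\<in>SV. \<bar>D (W (r k)) v - D u v\<bar> \<le> \<epsilon> / 2 * nrm v"
    using D_converges[OF W(1) W(2) r(2) wl e2] by blast
  define k where "k = max k1 k2"
  have "\<bar>D (U (r k)) (Z (r k)) - D (W (r k)) (Z (r k))\<bar> \<le> \<epsilon> * nrm (Z (r k))"
  proof -
    have "\<epsilon> / 2 * nrm (Z (r k)) = \<epsilon> * nrm (Z (r k)) / 2" by simp
    moreover have "k1 \<le> k" "k2 \<le> k" by (auto simp: k_def)
    ultimately show ?thesis
      using k1[rule_format, of k, OF _ Z[of "r k"]] k2[rule_format, of k, OF _ Z[of "r k"]] by linarith
  qed
  then show False using big[of "r k"] by simp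
qed

sublocale mountain_pass SV ip \<Phi> D \<mu>
proof
  show "\<Phi> 0 = 0" by (simp add: \<Phi>_def F_zero)
qed (rule D_additive D_homogeneous D_bounded \<Phi>_has_derivative D_uniformly_continuous D_compactness \<mu>2 \<Phi>_AR; assumption)+

end

section \<open>Mountain pass geometry and existence\<close>

context frac_V begin

text \<open>A radial tent over the shell 1 < |x| < 3. It vanishes near the origin, where
  \<open>V\<close> may be unbounded.\<close>

definition bump :: "real^'n \<Rightarrow> real" where "bump x = max 0 (1 - \<bar>norm x - 2\<bar>)"

lemma bump_range: "0 \<le> bump x" "bump x \<le> 1" by (auto simp: bump_def)

lemma bump_zero: "norm x \<ge> 4 \<Longrightarrow> bump x = 0" "norm x \<le> 1 \<Longrightarrow> bump x = 0" by (auto simp: bump_def)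

lemma bump_measurable [measurable]: "bump \<in> borel_measurable borel"
  unfolding bump_def[abs_def] by (intro borel_measurable_continuous_onI continuous_intros)

lemma bump_lipschitz: "\<bar>bump x - bump y\<bar> \<le> norm (x - y)"
proof -
  have "\<bar>bump x - bump y\<bar> \<le> \<bar>norm x - norm y\<bar>" by (auto simp: bump_def max_def abs_if)
  then show ?thesis using norm_triangle_ineq3[of x y] by linarith
qed

text \<open>The Lipschitz bound serves small distances and the range bound large ones; a pair
  contributes only if one of its points lies in the ball.\<close>

lemma bump_gk: "gk bump x y \<le> min 1 ((norm (x - y))\<^sup>2) / norm (x - y) powr (N + 2 * s) * (indicator (ball 0 4) x + indicator (ball 0 4) y)"
proof (cases "norm x < 4 \<or> norm y < 4")
  case True
  have "(bump x - bump y)\<^sup>2 \<le> (norm (x - y))\<^sup>2"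
    using power_mono[OF bump_lipschitz[of x y], of 2] by simp
  moreover have "\<bar>bump x - bump y\<bar> \<le> 1" using bump_range[of x] bump_range[of y] by auto
  then have "(bump x - bump y)\<^sup>2 \<le> 1" by (simp add: abs_square_le_1)
  ultimately have "gk bump x y \<le> min 1 ((norm (x - y))\<^sup>2) / norm (x - y) powr (N + 2 * s)"
    unfolding gk_def by (intro divide_right_mono) auto
  also have "\<dots> \<le> min 1 ((norm (x - y))\<^sup>2) / norm (x - y) powr (N + 2 * s) * (indicator (ball 0 4) x + indicator (ball 0 4) y)"
  proof -
    have "(1::real) \<le> indicator (ball 0 4) x + indicator (ball 0 4) y" using True by (auto simp: indicator_def)
    from mult_left_mono[OF this, of "min 1 ((norm (x - y))\<^sup>2) / norm (x - y) powr (N + 2 * s)"] show ?thesis by simp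
  qed
  finally show ?thesis .
qed (simp add: gk_def bump_zero)

text \<open>By translation invariance each of the two indicator terms integrates to the integral of
  the Levy kernel times the volume of a ball.\<close>

lemma bump_gagliardo: "gagliardo_int s bump < \<infinity>"
proof -
  define L where "L z = ennreal (min 1 ((norm z)\<^sup>2) / norm z powr (N + 2 * s))" for z :: "real^'n"
  have [measurable]: "L \<in> borel_measurable borel" unfolding L_def[abs_def] by measurable
  have Lfin: "(\<integral>\<^sup>+z. L z \<partial>lborel) < \<infinity>"
    using nn_integral_Levy_kernel[OF N2 s_pos s_less] by (simp add: L_def dimN_def flip: N_def)
  have shift: "(\<integral>\<^sup>+y. L (x - y) \<partial>lborel) = (\<integral>\<^sup>+z. L z \<partial>lborel)" for x
  proof -
    have "(\<integral>\<^sup>+y. L (x - y) \<partial>lborel) = (\<integral>\<^sup>+y. L (- x + y) \<partial>lborel)"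
      by (intro nn_integral_cong) (simp add: L_def norm_minus_commute)
    then show ?thesis using nn_integral_lborel_translate[of L "- x"] by simp
  qed
  have shift': "(\<integral>\<^sup>+x. L (x - y) \<partial>lborel) = (\<integral>\<^sup>+z. L z \<partial>lborel)" for y
    using nn_integral_lborel_translate[of L "- y"] by simp
  have "gagliardo_int s bump \<le> (\<integral>\<^sup>+x. \<integral>\<^sup>+y. L (x - y) * ib 4 0 x + L (x - y) * ib 4 0 y \<partial>lborel \<partial>lborel)"
    unfolding gagliardo_Dsq[OF bump_measurable] Dsq_def
  proof (intro nn_integral_mono)
    fix x y
    have "ennreal (gk bump x y) \<le> ennreal (min 1 ((norm (x - y))\<^sup>2) / norm (x - y) powr (N + 2 * s) * (indicator (ball 0 4) x + indicator (ball 0 4) y))"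
      by (rule ennreal_leI[OF bump_gk])
    also have "\<dots> = L (x - y) * ib 4 0 x + L (x - y) * ib 4 0 y"
      by (auto simp: L_def ib_def indicator_def simp flip: ennreal_plus)
    finally show "ennreal (gk bump x y) \<le> L (x - y) * ib 4 0 x + L (x - y) * ib 4 0 y" .
  qed
  also have "\<dots> = (\<integral>\<^sup>+x. (\<integral>\<^sup>+y. L (x - y) * ib 4 0 x \<partial>lborel) + (\<integral>\<^sup>+y. L (x - y) * ib 4 0 y \<partial>lborel) \<partial>lborel)"
    by (intro nn_integral_cong nn_integral_add) measurable
  also have "\<dots> = (\<integral>\<^sup>+x. \<integral>\<^sup>+y. L (x - y) * ib 4 0 x \<partial>lborel \<partial>lborel) + (\<integral>\<^sup>+x. \<integral>\<^sup>+y. L (x - y) * ib 4 0 y \<partial>lborel \<partial>lborel)"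
    by (rule nn_integral_add) measurable
  also have "(\<integral>\<^sup>+x. \<integral>\<^sup>+y. L (x - y) * ib 4 0 y \<partial>lborel \<partial>lborel) = (\<integral>\<^sup>+y. \<integral>\<^sup>+x. L (x - y) * ib 4 0 y \<partial>lborel \<partial>lborel)"
    by (rule lborel_pair.Fubini') measurable
  also have "\<dots> = (\<integral>\<^sup>+y. (\<integral>\<^sup>+z. L z \<partial>lborel) * ib 4 0 y \<partial>lborel)"
    by (intro nn_integral_cong, subst nn_integral_multc) (measurable, simp add: shift')
  also have "(\<integral>\<^sup>+x. \<integral>\<^sup>+y. L (x - y) * ib 4 0 x \<partial>lborel \<partial>lborel) = (\<integral>\<^sup>+x. (\<integral>\<^sup>+z. L z \<partial>lborel) * ib 4 0 x \<partial>lborel)"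
    by (intro nn_integral_cong, subst nn_integral_multc) (measurable, simp add: shift)
  also have "(\<integral>\<^sup>+x. (\<integral>\<^sup>+z. L z \<partial>lborel) * ib 4 0 x \<partial>lborel) = (\<integral>\<^sup>+z. L z \<partial>lborel) * (\<integral>\<^sup>+x. ib 4 0 x \<partial>lborel)"
    by (rule nn_integral_cmult) measurable
  also have "(\<integral>\<^sup>+x. ib 4 0 x \<partial>lborel) = ennreal (vol 4)" by (rule nn_integral_ib) simp
  finally show ?thesis using Lfin by (elim le_less_trans) (simp add: ennreal_mult_less_top)
qed

lemma bump_SV: "bump \<in> SV"
proof -
  have "radial bump" by (simp add: radial_def bump_def)
  moreover have "integrable lborel (\<lambda>x. \<bar>bump x\<bar> powr p)"
  proof (rule Bochner_Integration.integrable_bound)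
    show "integrable lborel (\<lambda>x::real^'n. indicator (ball 0 4) x * (1::real))" by (rule integrable_ball_const) simp
    show "AE x in lborel. norm (\<bar>bump x\<bar> powr p) \<le> norm (indicator (ball 0 4) x * (1::real))"
    proof (rule AE_I2)
      fix x :: "real^'n"
      show "norm (\<bar>bump x\<bar> powr p) \<le> norm (indicator (ball 0 4) x * (1::real))"
        using bump_range[of x] p_pos by (cases "norm x < 4") (auto simp: bump_zero powr_le1)
    qed
  qed measurable
  moreover have "integrable (lborel \<Otimes>\<^sub>M lborel) (\<lambda>q. gk bump (fst q) (snd q))"
    using bump_gagliardo unfolding gagliardo_gk by (subst integrable_nonneg_iff) (auto simp: gk_nonneg)
  moreover have "integrable lborel (\<lambda>x. V' x * (bump x)\<^sup>2)"
  proof -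
    have "bounded (V ` {1..4})"
      by (intro compact_imp_bounded compact_continuous_image continuous_on_subset[OF V_cont]) auto
    then obtain k where k: "\<forall>t\<in>{1..4}. \<bar>V t\<bar> \<le> k" by (auto simp: bounded_iff)
    have int: "integrable lborel (\<lambda>x::real^'n. indicator (ball 0 4) x * k)" by (rule integrable_ball_const) simp
    have "AE x in lborel. norm (V' x * (bump x)\<^sup>2) \<le> norm (indicator (ball 0 4) x * k)"
    proof (rule AE_I2)
      fix x :: "real^'n"
      show "norm (V' x * (bump x)\<^sup>2) \<le> norm (indicator (ball 0 4) x * k)"
      proof (cases "1 < norm x \<and> norm x < 4")
        case True
        then have "\<bar>V (norm x)\<bar> \<le> k" using k by auto
        moreover have "V' x = V (norm x)" using True by (auto simp: V'_def)
        moreover have "(bump x)\<^sup>2 \<le> 1" using bump_range[of x] by (simp add: power_le_one)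
        ultimately have "\<bar>V' x\<bar> * (bump x)\<^sup>2 \<le> k * 1" by (intro mult_mono) auto
        then show ?thesis using True \<open>\<bar>V (norm x)\<bar> \<le> k\<close> by (simp add: abs_mult)
      next
        case False
        then have "bump x = 0" using bump_zero[of x] by auto
        then show ?thesis by simp
      qed
    qed
    then show ?thesis by (intro Bochner_Integration.integrable_bound[OF int]) measurable
  qed
  ultimately show ?thesis by (simp add: SV_iff)
qed

text \<open>The constant sequence \<open>u\<close> converges to 0 in norm, hence almost
  everywhere.\<close>

lemma nrm_zero_AE: assumes "u \<in> SV" "nrm u = 0" shows "AE x in lborel. u x = 0"
proof -
  have "AE x in lborel. (\<lambda>n::nat. u x) \<longlonglongrightarrow> 0"
    by (rule SV_AE_tendsto_zero) (use assms in auto)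
  then show ?thesis by eventually_elim (simp add: LIMSEQ_const_iff)
qed

text \<open>Scaling to the unit sphere, where the supremum applies. A function of norm 0 cannot be
  scaled, but it vanishes almost everywhere.\<close>

lemma sup_homogeneous:
  assumes [measurable]: "B \<in> sets borel" and W: "continuous_on {0<..} W" and q: "q > 0" and \<epsilon>: "\<epsilon> > 0"
    and sup: "(SUP u\<in>{u::real^'n \<Rightarrow> real. u \<in> HsVrad s V \<and> HsV_norm_sq s V u = 1}.
      \<integral>\<^sup>+x\<in>B. ennreal (W (norm x) * \<bar>u x\<bar> powr q) \<partial>lborel) < ennreal \<epsilon>"
    and u: "u \<in> SV"
  shows "(\<integral>\<^sup>+x. ennreal ((if x = 0 then 0 else W (norm x)) * \<bar>u x\<bar> powr q) * indicator B x \<partial>lborel) \<le> ennreal (\<epsilon> * nrm u powr q)"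
proof -
  note [measurable] = SVD(1)[OF u] radial_continuous_measurable[OF W]
  have eq: "(\<integral>\<^sup>+x. ennreal ((if x = 0 then 0 else W (norm x)) * \<bar>u x\<bar> powr q) * indicator B x \<partial>lborel)
      = (\<integral>\<^sup>+x. ennreal (W (norm x) * \<bar>u x\<bar> powr q) * indicator B x \<partial>lborel)"
    by (rule nn_integral_cong_AE) (use AE_lborel_singleton[of "0::real^'n"] in eventually_elim, simp)
  show ?thesis
  proof (cases "nrm u = 0")
    case True
    have "(\<integral>\<^sup>+x. ennreal (W (norm x) * \<bar>u x\<bar> powr q) * indicator B x \<partial>lborel) = (\<integral>\<^sup>+x. 0 * indicator B x \<partial>lborel)"
      by (rule nn_integral_cong_AE) (use nrm_zero_AE[OF u True] in eventually_elim, simp)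
    then show ?thesis by (simp add: eq)
  next
    case False
    define t where "t = nrm u"
    have t: "t > 0" using False nrm_nonneg[OF u] by (simp add: t_def)
    define w where "w = (1 / t) *\<^sub>R u"
    have w: "w \<in> SV" using u by (simp add: w_def S_mem)
    have "nrm w = 1" using t u by (simp add: w_def nrm_scale t_def)
    then have "ip w w = 1" using nrm_sq[OF w] by simp
    then have "HsV_norm_sq s V w = 1" using HsV_norm_sq_ip[OF w] by simp
    then have "(\<integral>\<^sup>+x\<in>B. ennreal (W (norm x) * \<bar>w x\<bar> powr q) \<partial>lborel) \<le> (SUP u\<in>{u::real^'n \<Rightarrow> real. u \<in> HsVrad s V \<and> HsV_norm_sq s V u = 1}.
      \<integral>\<^sup>+x\<in>B. ennreal (W (norm x) * \<bar>u x\<bar> powr q) \<partial>lborel)"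
      using w by (intro SUP_upper) (simp add: SV_def)
    then have le: "(\<integral>\<^sup>+x\<in>B. ennreal (W (norm x) * \<bar>w x\<bar> powr q) \<partial>lborel) \<le> ennreal \<epsilon>" using sup by simp
    have [measurable]: "w \<in> borel_measurable borel" using SVD(1)[OF w] .
    have "(\<integral>\<^sup>+x. ennreal (W (norm x) * \<bar>u x\<bar> powr q) * indicator B x \<partial>lborel)
        = (\<integral>\<^sup>+x. ennreal (t powr q) * (ennreal (W (norm x) * \<bar>w x\<bar> powr q) * indicator B x) \<partial>lborel)"
    proof (rule nn_integral_cong)
      fix x
      have "\<bar>u x\<bar> = t * \<bar>w x\<bar>" using t by (simp add: w_def abs_mult)
      then have e: "W (norm x) * \<bar>u x\<bar> powr q = t powr q * (W (norm x) * \<bar>w x\<bar> powr q)"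
        using t by (simp add: powr_mult)
      then show "ennreal (W (norm x) * \<bar>u x\<bar> powr q) * indicator B x
          = ennreal (t powr q) * (ennreal (W (norm x) * \<bar>w x\<bar> powr q) * indicator B x)"
        unfolding e by (simp add: ennreal_mult' mult.assoc)
    qed
    also have "\<dots> = ennreal (t powr q) * (\<integral>\<^sup>+x. ennreal (W (norm x) * \<bar>w x\<bar> powr q) * indicator B x \<partial>lborel)"
      by (rule nn_integral_cmult) measurable
    also have "\<dots> \<le> ennreal (t powr q) * ennreal \<epsilon>" by (rule mult_left_mono[OF le]) simp
    also have "\<dots> = ennreal (\<epsilon> * nrm u powr q)" using \<epsilon> by (simp add: ennreal_mult t_def mult.commute)
    finally show ?thesis by (simp add: eq)
  qed
qed

end

section \<open>Geometry of the functional and the critical point\<close>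

context frac_VK begin

lemma \<Phi>_le_H: assumes u: "u \<in> SV" shows "\<Phi> u \<le> Cf * H u"
proof -
  have "\<Phi> u \<le> (LINT x|lborel. Cf * (K' x * h (u x)))"
    unfolding \<Phi>_def
  proof (rule integral_mono)
    show "K' x * F (u x) \<le> Cf * (K' x * h (u x))" for x
      using mult_left_mono[OF F_le_h[of "u x"] K'_nonneg[of x]] by (simp add: mult.left_commute)
  qed (use integrable_F[OF u] integrable_h[OF u] in auto)
  then show ?thesis by (simp add: H_def)
qed

lemma E_positive_on_sphere: "\<exists>\<rho>>0. \<exists>\<alpha>>0. \<forall>u\<in>SV. nrm u = \<rho> \<longrightarrow> \<alpha> \<le> E u"
proof -
  obtain C where C: "C > 0" "\<forall>u\<in>SV. H u \<le> C * (nrm u powr q1 + nrm u powr q2)" using H_bound by blast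
  define m where "m = min q1 q2 - 2"
  have m: "m > 0" using q1 q2 by (simp add: m_def)
  \<comment> \<open>With \<rho> \<le> 1 both powers are at most \<rho>^(2+m), and the second bound
    makes the nonlinear part at most \<rho>^2/4, half of the quadratic part.\<close>
  define \<rho> where "\<rho> = min 1 ((1 / (8 * Cf * C)) powr (1 / m))"
  have \<rho>: "0 < \<rho>" "\<rho> \<le> 1" using Cf C(1) by (auto simp: \<rho>_def)
  have "\<rho> powr m \<le> ((1 / (8 * Cf * C)) powr (1 / m)) powr m" using \<rho> m by (intro powr_mono2) (auto simp: \<rho>_def)
  also have "\<dots> = 1 / (8 * Cf * C)" using m Cf C(1) by (simp add: powr_powr)
  finally have \<rho>m: "Cf * C * \<rho> powr m \<le> 1 / 8" using Cf C(1) by (simp add: field_simps)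
  have "\<rho>\<^sup>2 / 4 \<le> E u" if u: "u \<in> SV" "nrm u = \<rho>" for u
  proof -
    have "\<rho> powr q \<le> \<rho> powr m * \<rho>\<^sup>2" if "q \<ge> m + 2" for q
    proof -
      have "\<rho> powr q \<le> \<rho> powr (m + 2)" using \<rho> that by (intro powr_mono') auto
      then show ?thesis using \<rho> by (simp add: powr_add)
    qed
    from this[of q1] this[of q2] have "\<rho> powr q1 + \<rho> powr q2 \<le> 2 * (\<rho> powr m * \<rho>\<^sup>2)"
      by (auto simp: m_def)
    then have "C * (\<rho> powr q1 + \<rho> powr q2) \<le> C * (2 * (\<rho> powr m * \<rho>\<^sup>2))" using C(1) by (intro mult_left_mono) auto
    then have "H u \<le> C * (2 * (\<rho> powr m * \<rho>\<^sup>2))" using C(2) u by fastforce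
    then have "Cf * H u \<le> Cf * (C * (2 * (\<rho> powr m * \<rho>\<^sup>2)))" using Cf by (intro mult_left_mono) auto
    also have "\<dots> = (Cf * C * \<rho> powr m) * (2 * \<rho>\<^sup>2)" by simp
    also have "\<dots> \<le> 1 / 8 * (2 * \<rho>\<^sup>2)" using \<rho>m by (intro mult_right_mono) auto
    finally show ?thesis using \<Phi>_le_H[OF u(1)] u(2) by (simp add: E_def)
  qed
  then show ?thesis using \<rho> by (intro exI[of _ \<rho>] conjI exI[of _ "\<rho>\<^sup>2 / 4"]) auto
qed

text \<open>The Ambrosetti-Rabinowitz condition says precisely that F(t) t^(-\<mu>) is nondecreasing
  for t > 0.\<close>

lemma F_superquadratic:
  assumes t0: "t0 > 0" "t \<ge> t0" shows "F t \<ge> F t0 * (t / t0) powr \<mu>"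
proof -
  have "F t0 * t0 powr (- \<mu>) \<le> F t * t powr (- \<mu>)"
  proof (rule DERIV_nonneg_imp_nondecreasing[OF t0(2)])
    fix x assume "t0 \<le> x" "x \<le> t"
    then have x: "x > 0" using t0 by simp
    have "((\<lambda>x. F x * x powr (- \<mu>)) has_real_derivative f x * x powr (- \<mu>) + F x * (- \<mu> * x powr (- \<mu> - 1))) (at x)"
      using x by (auto intro!: derivative_eq_intros F_deriv)
    moreover have "f x * x powr (- \<mu>) + F x * (- \<mu> * x powr (- \<mu> - 1)) = (f x * x - \<mu> * F x) * x powr (- \<mu> - 1)"
      using x by (simp add: powr_diff field_simps)
    moreover have "\<dots> \<ge> 0" using F_AR[of x] by simp
    ultimately show "\<exists>y. ((\<lambda>x. F x * x powr (- \<mu>)) has_real_derivative y) (at x) \<and> y \<ge> 0" by metis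
  qed
  then have "F t0 * t0 powr (- \<mu>) * t powr \<mu> \<le> F t * t powr (- \<mu>) * t powr \<mu>" by (intro mult_right_mono) auto
  also have "\<dots> = F t" using t0 by (simp add: mult.assoc flip: powr_add)
  finally show ?thesis using t0 by (simp add: powr_divide powr_minus_divide)
qed

text \<open>Along the ray through \<open>bump\<close> the quadratic part grows like l^2 and
  \<open>\<Phi>\<close> at least like l^\<mu> with \<mu> > 2.\<close>

lemma exists_far_nonpositive_E:
  assumes t0: "t0 > 0" "F t0 > 0"
  shows "\<exists>e\<in>SV. \<rho> < nrm e \<and> E e \<le> 0"
proof -
  obtain c :: "real^'n" where c: "norm c = 2" using vector_choose_size[of 2] by auto
  obtain m where m: "m > 0" "\<And>t. t \<in> {1..4} \<Longrightarrow> m \<le> K t"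
  proof -
    have "continuous_on {1..4} K" by (rule continuous_on_subset[OF K_cont]) auto
    then obtain t where "t \<in> {1..4::real}" "\<forall>y\<in>{1..4}. K t \<le> K y"
      using continuous_attains_inf[of "{1..4::real}" K] by auto
    then show ?thesis using that[of "K t"] K_pos[of t] by auto
  qed
  have ball: "norm x \<in> {1..4} \<and> bump x \<ge> 1/2" if "x \<in> ball c (1/4)" for x
  proof -
    have "\<bar>norm c - norm x\<bar> < 1/4" using that norm_triangle_ineq3[of c x] by (simp add: dist_norm)
    then have "7/4 < norm x" "norm x < 9/4" "\<bar>norm x - 2\<bar> < 1/4" using c by linarith+
    moreover have "1 - \<bar>norm x - 2\<bar> \<le> bump x" by (simp add: bump_def)
    ultimately show ?thesis by auto
  qed
  \<comment> \<open>Only a ball of radius 1/4 around a point at the peak of the tent is used. There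
    \<open>bump\<close> is at least 1/2, so for l \<ge> 2 t0 the values l * bump exceed the
    threshold of \<open>F_superquadratic\<close>.\<close>
  define k0 where "k0 = m * F t0 * vol (1/4) / (2 * t0) powr \<mu>"
  have k0: "k0 > 0" using m t0 by (simp add: k0_def vol_pos)
  have \<Phi>_ge: "k0 * l powr \<mu> \<le> \<Phi> (l *\<^sub>R bump)" if l: "l \<ge> 2 * t0" for l
  proof -
    have lS: "l *\<^sub>R bump \<in> SV" using bump_SV by (rule S_scale)
    define d where "d = m * (F t0 * (l / (2 * t0)) powr \<mu>)"
    have "k0 * l powr \<mu> = vol (1/4) * d"
      using l t0 by (simp add: k0_def d_def powr_divide)
    also have "\<dots> = (LINT x::real^'n|lborel. indicator (ball c (1/4)) x * d)"
      by (rule integral_ball_const[symmetric]) simp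
    also have "\<dots> \<le> \<Phi> (l *\<^sub>R bump)"
      unfolding \<Phi>_def
    proof (rule integral_mono)
      show "integrable lborel (\<lambda>x::real^'n. indicator (ball c (1/4)) x * d)" by (rule integrable_ball_const) simp
      show "integrable lborel (\<lambda>x. K' x * F ((l *\<^sub>R bump) x))" by (rule integrable_F[OF lS])
      fix x
      show "indicator (ball c (1/4)) x * d \<le> K' x * F ((l *\<^sub>R bump) x)"
      proof (cases "x \<in> ball c (1/4)")
        case True
        then have x: "norm x \<in> {1..4}" "bump x \<ge> 1/2" using ball by auto
        then have mK: "m \<le> K' x" using m(2) by (auto simp: K'_def)
        have lb: "l * bump x \<ge> l / 2" using x l t0 mult_left_mono[of "1/2" "bump x" l] by simp
        then have 1: "F t0 * (l * bump x / t0) powr \<mu> \<le> F (l * bump x)"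
          using l t0 by (intro F_superquadratic) linarith+
        have "(l / (2 * t0)) powr \<mu> \<le> (l * bump x / t0) powr \<mu>"
          using lb l t0 \<mu>2 by (intro powr_mono2) (auto simp: field_simps)
        then have "F t0 * (l / (2 * t0)) powr \<mu> \<le> F t0 * (l * bump x / t0) powr \<mu>"
          using t0 by (intro mult_left_mono) auto
        also note 1
        finally have "d \<le> K' x * F (l * bump x)"
          using mK m(1) t0 unfolding d_def by (intro mult_mono) auto
        then show ?thesis using True by simp
      qed (simp add: K'_nonneg F_nonneg)
    qed
    finally show ?thesis .
  qed
  define b where "b = nrm bump"
  \<comment> \<open>If \<open>bump\<close> had norm 0, so would its multiples, and the bound on
    \<open>H\<close> would make \<open>\<Phi>\<close> nonpositive on them, against
    \<open>\<Phi>_ge\<close>.\<close>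
  have b: "b > 0"
  proof (rule ccontr)
    assume "\<not> b > 0"
    then have b0: "nrm bump = 0" using nrm_nonneg[OF bump_SV] by (simp add: b_def)
    obtain C where C: "C > 0" "\<forall>u\<in>SV. H u \<le> C * (nrm u powr q1 + nrm u powr q2)" using H_bound by blast
    have lS: "(2 * t0) *\<^sub>R bump \<in> SV" using bump_SV by (rule S_scale)
    have "H ((2 * t0) *\<^sub>R bump) \<le> 0" using bspec[OF C(2) lS] b0 by (simp add: nrm_scale bump_SV)
    then have "\<Phi> ((2 * t0) *\<^sub>R bump) \<le> 0" using \<Phi>_le_H[OF lS] Cf by (meson less_imp_le mult_nonneg_nonpos order_trans)
    moreover have "k0 * (2 * t0) powr \<mu> > 0" using k0 t0 by simp
    ultimately show False using \<Phi>_ge[of "2 * t0"] by simp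
  qed
  \<comment> \<open>The three bounds make \<open>\<Phi>_ge\<close> applicable, put the endpoint
    outside the sphere, and let the power l^\<mu> dominate the quadratic term.\<close>
  define l where "l = max (2 * t0) (max ((\<bar>\<rho>\<bar> + 1) / b) ((b\<^sup>2 / (2 * k0)) powr (1 / (\<mu> - 2))))"
  have l: "l \<ge> 2 * t0" "l > 0" "l \<ge> (\<bar>\<rho>\<bar> + 1) / b" "(b\<^sup>2 / (2 * k0)) powr (1 / (\<mu> - 2)) \<le> l"
    using t0 by (auto simp: l_def)
  have "((b\<^sup>2 / (2 * k0)) powr (1 / (\<mu> - 2))) powr (\<mu> - 2) \<le> l powr (\<mu> - 2)"
    using l \<mu>2 by (intro powr_mono2) auto
  then have "b\<^sup>2 / (2 * k0) \<le> l powr (\<mu> - 2)" using b k0 \<mu>2 by (simp add: powr_powr)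
  then have "b\<^sup>2 / 2 \<le> k0 * l powr (\<mu> - 2)" using k0 by (simp add: field_simps)
  then have "l\<^sup>2 * (b\<^sup>2 / 2) \<le> l\<^sup>2 * (k0 * l powr (\<mu> - 2))" by (intro mult_left_mono) auto
  also have "\<dots> = k0 * l powr \<mu>" using l by (simp add: powr_diff)
  also have "\<dots> \<le> \<Phi> (l *\<^sub>R bump)" using l by (intro \<Phi>_ge)
  finally have "E (l *\<^sub>R bump) \<le> 0"
    using l bump_SV by (simp add: E_def nrm_scale b_def power_mult_distrib)
  moreover have "\<rho> < nrm (l *\<^sub>R bump)"
  proof -
    have "\<bar>\<rho>\<bar> + 1 \<le> l * b" using l(3) b by (simp add: field_simps)
    then show ?thesis using l bump_SV by (simp add: nrm_scale b_def)
  qed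
  ultimately show ?thesis using bump_SV S_scale by blast
qed

text \<open>Nontriviality is read off the level: a critical point vanishing almost everywhere would
  have norm 0 and nonnegative \<open>\<Phi>\<close>, hence energy at most 0.\<close>

lemma exists_critical_point:
  assumes t0: "t0 > 0" "F t0 > 0"
  shows "\<exists>u\<in>SV. (\<forall>v\<in>SV. ip u v = D u v) \<and> \<not> (AE x in lborel. u x = 0)"
proof -
  obtain \<rho> \<alpha> where \<rho>: "\<rho> > 0" and \<alpha>: "\<alpha> > 0" "\<forall>u\<in>SV. nrm u = \<rho> \<longrightarrow> \<alpha> \<le> E u"
    using E_positive_on_sphere by blast
  obtain e where e: "e \<in> SV" "\<rho> < nrm e" "E e \<le> 0" using exists_far_nonpositive_E[OF t0] by blast
  obtain u where u: "u \<in> SV" "\<forall>v\<in>SV. ip u v = D u v" "E u \<ge> \<alpha>"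
    using mountain_pass[OF \<rho> \<alpha>(1) _ e] \<alpha>(2) by blast
  have "\<not> (AE x in lborel. u x = 0)"
  proof
    assume z: "AE x in lborel. u x = 0"
    have [measurable]: "u \<in> borel_measurable borel" using SVD(1)[OF u(1)] .
    have "D u u = (LINT x::real^'n|lborel. 0)"
      unfolding D_def by (rule integral_cong_AE) (measurable, use z in eventually_elim, simp)
    then have "(nrm u)\<^sup>2 = 0" using u(1,2) by (simp add: nrm_sq)
    moreover have "\<Phi> u \<ge> 0" unfolding \<Phi>_def using K'_nonneg F_nonneg by (intro integral_nonneg_AE) auto
    ultimately show False using u(3) \<alpha>(1) by (simp add: E_def)
  qed
  then show ?thesis using u by blast
qed

text \<open>Testing with the negative part: the nonlinear term vanishes because \<open>f\<close> is
  0 wherever the negative part is not, while the form is at most minus the squared norm of the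
  negative part.\<close>

lemma critical_point_nonneg:
  assumes f0: "\<And>t. t \<le> 0 \<Longrightarrow> f t = 0" and u: "u \<in> SV" and crit: "\<forall>v\<in>SV. ip u v = D u v"
  shows "AE x in lborel. u x \<ge> 0"
proof -
  note [measurable] = SVD(1)[OF u]
  define v where "v x = max 0 (- u x)" for x
  have v: "v \<in> SV"
  proof (rule SV_dominated[OF u u, where c = 1])
    show "v \<in> borel_measurable borel" unfolding v_def[abs_def] by measurable
    show "radial v" using SVD(2)[OF u] unfolding radial_def v_def by metis
    show "\<bar>v x - v y\<bar> \<le> 1 * (\<bar>u x - u y\<bar> + \<bar>u x - u y\<bar>)" for x y
      unfolding v_def by (cases "u x \<le> 0"; cases "u y \<le> 0") (auto simp: abs_minus_commute[of "u y"])
  qed (auto simp: v_def)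
  have "D u v = (LINT x::real^'n|lborel. 0)"
    unfolding D_def by (intro Bochner_Integration.integral_cong) (auto simp: v_def max_def f0)
  then have "ip u v = 0" using crit v by simp
  moreover have "ip u v \<le> - ip v v"
  proof -
    have "integral\<^sup>L (lborel \<Otimes>\<^sub>M lborel) (bil u v) \<le> integral\<^sup>L (lborel \<Otimes>\<^sub>M lborel) (\<lambda>q. - bil v v q)"
    proof (rule integral_mono)
      fix q
      have "a * (max 0 (- x) - max 0 (- y)) \<le> - ((max 0 (- x) - max 0 (- y)) * (max 0 (- x) - max 0 (- y)))"
        if "a = x - y" for a x y :: real
      proof -
        \<comment> \<open>Positive and negative parts are oppositely monotone, so their increments
          never have the same sign.\<close>
        have "(x - y) * (max 0 (- x) - max 0 (- y)) + (max 0 (- x) - max 0 (- y)) * (max 0 (- x) - max 0 (- y))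
            = (max 0 x - max 0 y) * (max 0 (- x) - max 0 (- y))"
          by (auto simp: max_def algebra_simps)
        also have "\<dots> \<le> 0" by (auto simp: max_def mult_nonneg_nonpos mult_nonpos_nonneg)
        finally show ?thesis unfolding that by linarith
      qed
      from divide_right_mono[OF this[OF refl], of "norm (fst q - snd q) powr (N + 2 * s)" "u (fst q)" "u (snd q)"]
      show "bil u v q \<le> - bil v v q" by (simp add: bil_def v_def)
    qed (use integrable_bil u v in auto)
    then have "c0 * integral\<^sup>L (lborel \<Otimes>\<^sub>M lborel) (bil u v) \<le> c0 * (- integral\<^sup>L (lborel \<Otimes>\<^sub>M lborel) (bil v v))"
      using c0_pos by (intro mult_left_mono) auto
    moreover have "integral\<^sup>L lborel (\<lambda>x. V' x * u x * v x) = integral\<^sup>L lborel (\<lambda>x. - (V' x * v x * v x))"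
      by (intro Bochner_Integration.integral_cong) (auto simp: v_def max_def)
    ultimately show ?thesis by (simp add: ip_def)
  qed
  ultimately have "(nrm v)\<^sup>2 \<le> 0" using v by (simp add: nrm_sq)
  then have "nrm v = 0" by simp
  from nrm_zero_AE[OF v this] show ?thesis
    by eventually_elim (simp add: v_def max_def split: if_splits)
qed

end

section \<open>Truncation of the nonlinearity and the main existence result\<close>

lemma primF_deriv:
  assumes "continuous_on UNIV g"
  shows "(primF g has_real_derivative g t) (at t)"
proof -
  define M where "M = \<bar>t\<bar> + 1"
  have "((\<lambda>u. LBINT y=ereal 0..u. g y) has_vector_derivative g t) (at t within {- M..M})"
    by (rule interval_integral_FTC2) (use assms in \<open>auto simp: M_def intro: continuous_on_subset\<close>)
  moreover have "at t within {- M..M} = at t"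
    by (rule at_within_interior) (auto simp: M_def abs_if)
  ultimately show ?thesis
    by (simp add: primF_def[abs_def] has_real_derivative_iff_has_vector_derivative zero_ereal_def)
qed

theorem theorem5p5:
  fixes s q1 q2 :: real
    and V K :: "real \<Rightarrow> real"
    and f :: "real \<Rightarrow> real"
  assumes N2: "CARD('n::finite) \<ge> 2"
    and s: "1/2 < s" "s < 1"
    and V: "continuous_on {0<..} V" "\<And>r. r > 0 \<Longrightarrow> V r \<ge> 0"
    and K: "continuous_on {0<..} K" "\<And>r. r > 0 \<Longrightarrow> K r > 0"
    and fc: "continuous_on UNIV f"
    and q: "q1 > 2" "q2 > 2"
    and f1: "\<exists>C>0. \<forall>t. \<bar>f t\<bar> \<le> C * min (\<bar>t\<bar> powr (q1 - 1)) (\<bar>t\<bar> powr (q2 - 1))"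
    and f2: "\<exists>t0>0. primF f t0 > 0"
    and f3: "\<exists>\<mu>>2. \<forall>t. 0 \<le> \<mu> * primF f t \<and> \<mu> * primF f t \<le> f t * t"
    and lim0: "((\<lambda>R. S0 s V K TYPE('n) q1 R) \<longlongrightarrow> 0) (at_right 0)"
    and liminf: "((\<lambda>R. Sinf s V K TYPE('n) q2 R) \<longlongrightarrow> 0) at_top"
  shows "\<exists>u :: real^'n \<Rightarrow> real. weak_solution s V K f u
           \<and> \<not> (AE x in lborel. u x = 0) \<and> (AE x in lborel. u x \<ge> 0)"
proof -
  obtain C where C: "C > 0" "\<And>t. \<bar>f t\<bar> \<le> C * min (\<bar>t\<bar> powr (q1 - 1)) (\<bar>t\<bar> powr (q2 - 1))"
    using f1 by blast
  obtain \<mu> where \<mu>: "\<mu> > 2" "\<And>t. 0 \<le> \<mu> * primF f t" "\<And>t. \<mu> * primF f t \<le> f t * t"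
    using f3 by blast
  obtain t0 where t0: "t0 > 0" "primF f t0 > 0" using f2 by blast
  interpret A: frac_V "TYPE('n)" s "real CARD('n)" V "CNs TYPE('n) s / 2"
    by unfold_locales (use N2 s V in auto)
  \<comment> \<open>The truncation stays continuous and, as (f1) forces f 0 = 0, vanishes on the
    negative axis.\<close>
  define g where "g t = f (max t 0)" for t
  define F where "F = primF g"
  have f0: "f 0 = 0" using C(2)[of 0] by simp
  have g_neg: "g t = 0" if "t \<le> 0" for t using that f0 by (simp add: g_def max_def)
  have g_pos: "g t = f t" if "t \<ge> 0" for t using that by (simp add: g_def)
  have gc: "continuous_on UNIV g"
    unfolding g_def[abs_def] by (intro continuous_on_compose2[OF fc] continuous_intros) auto
  have F_pos: "F t = primF f t" if "t \<ge> 0" for t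
    unfolding F_def primF_def
    by (rule interval_integral_cong) (use that in \<open>auto simp: g_pos einterval_iff min_def max_def zero_ereal_def split: if_splits\<close>)
  have F_neg: "F t = 0" if "t \<le> 0" for t
  proof -
    have "F t = (LBINT \<tau>=0..t. 0)"
      unfolding F_def primF_def
      by (rule interval_integral_cong) (use that in \<open>auto simp: g_neg einterval_iff min_def max_def zero_ereal_def split: if_splits\<close>)
    then show ?thesis by simp
  qed
  \<comment> \<open>For negative arguments all quantities are 0, so (f3) survives the truncation;
    for the others nothing has changed.\<close>
  have F_nonneg: "F t \<ge> 0" and F_AR: "\<mu> * F t \<le> g t * t" for t
    using \<mu>(1) \<mu>(2)[of t] \<mu>(3)[of t]
    by (cases "t \<ge> 0"; simp add: F_pos F_neg g_pos g_neg zero_le_mult_iff)+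
  have g_bound: "\<bar>g t\<bar> \<le> C * min (\<bar>t\<bar> powr (q1 - 1)) (\<bar>t\<bar> powr (q2 - 1))" for t
    using C(1) C(2)[of t] by (cases "t \<ge> 0") (simp_all add: g_pos g_neg)
  have small_ball: "\<exists>R>0. \<forall>u\<in>A.SV.
      (\<integral>\<^sup>+x. ennreal ((if x = 0 then 0 else K (norm x)) * \<bar>u x\<bar> powr q1) * indicator (ball 0 R) x \<partial>lborel)
        \<le> ennreal (\<epsilon> * A.nrm u powr q1)" if \<epsilon>: "\<epsilon> > 0" for \<epsilon>
  proof -
    have "\<forall>\<^sub>F R in at_right 0. S0 s V K TYPE('n) q1 R < ennreal \<epsilon>"
      using order_tendstoD(2)[OF lim0, of "ennreal \<epsilon>"] \<epsilon> by simp
    moreover have "\<forall>\<^sub>F R in at_right (0::real). R > 0" by (rule eventually_at_right_less)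
    ultimately have "\<forall>\<^sub>F R in at_right (0::real). S0 s V K TYPE('n) q1 R < ennreal \<epsilon> \<and> R > 0"
      by eventually_elim simp
    then obtain R where R: "S0 s V K TYPE('n) q1 R < ennreal \<epsilon>" "R > 0"
      using eventually_happens[of _ "at_right (0::real)"] by auto
    show ?thesis
    proof (intro exI[of _ R] conjI ballI)
      show "(\<integral>\<^sup>+x. ennreal ((if x = 0 then 0 else K (norm x)) * \<bar>u x\<bar> powr q1) * indicator (ball 0 R) x \<partial>lborel)
          \<le> ennreal (\<epsilon> * A.nrm u powr q1)" if "u \<in> A.SV" for u
        using R(1) unfolding S0_def by (intro A.sup_homogeneous K that \<epsilon>) (use q in auto)
    qed (rule R)
  qed
  have small_outside: "\<exists>R>R1. \<forall>u\<in>A.SV.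
      (\<integral>\<^sup>+x. ennreal ((if x = 0 then 0 else K (norm x)) * \<bar>u x\<bar> powr q2) * indicator (- ball 0 R) x \<partial>lborel)
        \<le> ennreal (\<epsilon> * A.nrm u powr q2)" if \<epsilon>: "\<epsilon> > 0" for \<epsilon> R1
  proof -
    have "\<forall>\<^sub>F R in at_top. Sinf s V K TYPE('n) q2 R < ennreal \<epsilon>"
      using order_tendstoD(2)[OF liminf, of "ennreal \<epsilon>"] \<epsilon> by simp
    moreover have "\<forall>\<^sub>F R in at_top. R > R1" by (rule eventually_gt_at_top)
    ultimately have "\<forall>\<^sub>F R in at_top. Sinf s V K TYPE('n) q2 R < ennreal \<epsilon> \<and> R > R1"
      by eventually_elim simp
    then obtain R where R: "Sinf s V K TYPE('n) q2 R < ennreal \<epsilon>" "R > R1"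
      using eventually_happens[of _ "at_top :: real filter"] by auto
    show ?thesis
    proof (intro exI[of _ R] conjI ballI)
      show "(\<integral>\<^sup>+x. ennreal ((if x = 0 then 0 else K (norm x)) * \<bar>u x\<bar> powr q2) * indicator (- ball 0 R) x \<partial>lborel)
          \<le> ennreal (\<epsilon> * A.nrm u powr q2)" if "u \<in> A.SV" for u
        using R(1) unfolding Sinf_def by (intro A.sup_homogeneous K that \<epsilon>) (use q in auto)
    qed (rule R)
  qed
  interpret B: frac_VK "TYPE('n)" s "real CARD('n)" V "CNs TYPE('n) s / 2" K g F q1 q2 C \<mu>
    by unfold_locales
      (fact K gc q C(1) g_bound primF_deriv[OF gc, folded F_def] F_neg[of 0, simplified] \<mu>(1) F_nonneg F_AR small_ball small_outside)+
  obtain u where u: "u \<in> A.SV" "\<forall>v\<in>A.SV. A.ip u v = B.D u v" and nz: "\<not> (AE x in lborel. u x = 0)"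
    using B.exists_critical_point[of t0] t0 by (auto simp: F_pos)
  have pos: "AE x in lborel. u x \<ge> 0"
    by (rule B.critical_point_nonneg[OF g_neg u])
  have [measurable]: "u \<in> borel_measurable borel" using A.SVD(1)[OF u(1)] .
  have "weak_solution s V K f u"
    unfolding weak_solution_def
  proof (intro conjI ballI)
    show "u \<in> HsVrad s V" using u(1) by (simp add: A.SV_def)
    fix v :: "real^'n \<Rightarrow> real" assume "v \<in> HsVrad s V"
    then have v: "v \<in> A.SV" by (simp add: A.SV_def)
    have [measurable]: "v \<in> borel_measurable borel" using A.SVD(1)[OF v] .
    have [measurable]: "(\<lambda>x::real^'n. K (norm x)) \<in> borel_measurable borel" "f \<in> borel_measurable borel"
      by (rule A.radial_continuous_measurable[OF K(1)], rule borel_measurable_continuous_onI[OF fc])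
    have "(LINT x|lborel. V (norm x) * u x * v x) = (LINT x|lborel. A.V' x * u x * v x)"
      by (rule integral_cong_AE) (measurable, use A.V'_AE in eventually_elim, simp)
    moreover have "(LINT x|lborel. K (norm x) * f (u x) * v x) = B.D u v"
      unfolding B.D_def
    proof (rule integral_cong_AE)
      \<comment> \<open>Nonnegativity of \<open>u\<close> undoes the truncation: almost everywhere g
        (u x) = f (u x), and the modified weight differs from \<open>K\<close> only at the
        origin.\<close>
      show "AE x in lborel. K (norm x) * f (u x) * v x = B.K' x * g (u x) * v x"
        using pos AE_lborel_singleton[of "0::real^'n"] by eventually_elim (simp add: B.K'_def g_pos)
    qed measurable
    ultimately show "CNs TYPE('n) s / 2 * integral\<^sup>L (lborel \<Otimes>\<^sub>M lborel)
         (\<lambda>p. (u (fst p) - u (snd p)) * (v (fst p) - v (snd p)) /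
               norm (fst p - snd p) powr (dimN TYPE('n) + 2 * s))
      + integral\<^sup>L lborel (\<lambda>x. V (norm x) * u x * v x)
      - integral\<^sup>L lborel (\<lambda>x. K (norm x) * f (u x) * v x) = 0"
      using u(2) v by (simp add: A.ip_def A.bil_def[abs_def] dimN_def)
  qed
  then show ?thesis using nz pos by blast
qed

end
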